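(* Let $k$ be an arbitrary field (not necessarily algebraically closed) and let $\Lambda = kQ/I$ be the algebra of a bound quiver $(Q,I)$. If $\Lambda$ is minimal $\tau$-tilting infinite, then $\Lambda$ is node-free, i.e. $(Q,I)$ has no nodes.
   Context: Algebras $\Lambda=kQ/I$ are finite dimensional, basic, connected, associative, unital; $Q$ is a finite quiver and $I$ is an admissible ideal of the path algebra $kQ$. Ideals are two-sided, $\operatorname{mod}\Lambda$ is the category of finitely generated $\Lambda$-modules, and paths are composed from right to left ($\beta\alpha$ means first $\alpha$, then $\beta$). A module $M$ in $\operatorname{mod}\Lambda$ is $\tau$-rigid if $\operatorname{Hom}_\Lambda(M,\tau M)=0$, where $\tau$ is the Auslander–Reiten translation. An algebra is $\tau$-tilting finite if it has only finitely many isomorphism classes of indecomposable $\tau$-rigid modules (equivalently, of basic support $\tau$-tilting modules); otherwise it is $\tau$-tilting infinite. $\Lambda$ is minimal $\tau$-tilting infinite if $\Lambda$ is $\tau$-tilting infinite but $\Lambda/J$ is $\tau$-tilting finite for every nonzero ideal $J$ of $\Lambda$. A vertex $x$ of $Q$ is a node of $(Q,I)$ if it is neither a sink nor a source and $\beta\alpha\in I$ for every arrow $\alpha$ ending at $x$ and every arrow $\beta$ starting at $x$. $\Lambda$ is node-free if it has no nodes. *)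

theory Defs
  imports "Graph_Theory.Digraph_Component" "HOL-Algebra.QuotRing" "HOL-Algebra.Ideal_Product"
    "HOL-Algebra.Module"
begin

section \<open>Modules over a not necessarily commutative ring\<close>

text \<open>
  The locale \<^locale>\<open>module\<close> of the library requires a commutative ring of scalars. We keep its
  record type and its axioms, but allow an arbitrary ring. The multiplication and the unit of the
  module record are irrelevant, unless the record is used for a \<open>K\<close>-algebra.
\<close>

locale left_module = R?: ring + M?: abelian_group M for M (structure) +
  assumes smult_closed [simp, intro]:
      "\<lbrakk>a \<in> carrier R; x \<in> carrier M\<rbrakk> \<Longrightarrow> a \<odot>\<^bsub>M\<^esub> x \<in> carrier M"
    and smult_l_distr:
      "\<lbrakk>a \<in> carrier R; b \<in> carrier R; x \<in> carrier M\<rbrakk>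
        \<Longrightarrow> (a \<oplus> b) \<odot>\<^bsub>M\<^esub> x = a \<odot>\<^bsub>M\<^esub> x \<oplus>\<^bsub>M\<^esub> b \<odot>\<^bsub>M\<^esub> x"
    and smult_r_distr:
      "\<lbrakk>a \<in> carrier R; x \<in> carrier M; y \<in> carrier M\<rbrakk>
        \<Longrightarrow> a \<odot>\<^bsub>M\<^esub> (x \<oplus>\<^bsub>M\<^esub> y) = a \<odot>\<^bsub>M\<^esub> x \<oplus>\<^bsub>M\<^esub> a \<odot>\<^bsub>M\<^esub> y"
    and smult_assoc1:
      "\<lbrakk>a \<in> carrier R; b \<in> carrier R; x \<in> carrier M\<rbrakk>
        \<Longrightarrow> (a \<otimes> b) \<odot>\<^bsub>M\<^esub> x = a \<odot>\<^bsub>M\<^esub> (b \<odot>\<^bsub>M\<^esub> x)"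
    and smult_one [simp]:
      "x \<in> carrier M \<Longrightarrow> \<one> \<odot>\<^bsub>M\<^esub> x = x"

definition with_smult :: "('b, 'c) ring_scheme \<Rightarrow> ('a \<Rightarrow> 'b \<Rightarrow> 'b) \<Rightarrow> ('a, 'b) module"
  where "with_smult G s = ring.extend (ring.truncate G) (module.fields s)"

lemma with_smult_simps [simp]:
  "carrier (with_smult G s) = carrier G"
  "monoid.mult (with_smult G s) = monoid.mult G"
  "monoid.one (with_smult G s) = monoid.one G"
  "ring.zero (with_smult G s) = ring.zero G"
  "ring.add (with_smult G s) = ring.add G"
  "smult (with_smult G s) = s"
  by (simp_all add: with_smult_def ring.defs module.defs)

definition regular_module :: "('a, 'c) ring_scheme \<Rightarrow> ('a, 'a) module"
  where "regular_module A = with_smult A (monoid.mult A)"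

text \<open>
  The quotient \<open>M/N\<close>, both for a submodule of a module and for a two-sided ideal of a
  \<open>K\<close>-algebra; in the latter case it also carries the product of the quotient ring.
\<close>
definition quot_module :: "('a, 'b) module \<Rightarrow> 'b set \<Rightarrow> ('a, 'b set) module"  (infixl \<open>'/\<^sub>m\<close> 65)
  where "M /\<^sub>m N = with_smult (M Quot N) (\<lambda>a X. \<Union>x\<in>X. N +>\<^bsub>M\<^esub> (a \<odot>\<^bsub>M\<^esub> x))"

text \<open>Homomorphisms are extensional, so that \<open>Hom\<close> is the honest set of homomorphisms.\<close>
definition module_hom ::
    "('a, 'c) ring_scheme \<Rightarrow> ('a, 'b) module \<Rightarrow> ('a, 'd) module \<Rightarrow> ('b \<Rightarrow> 'd) set"
  where "module_hom A M N = {h \<in> carrier M \<rightarrow>\<^sub>E carrier N.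
    (\<forall>x\<in>carrier M. \<forall>y\<in>carrier M. h (x \<oplus>\<^bsub>M\<^esub> y) = h x \<oplus>\<^bsub>N\<^esub> h y) \<and>
    (\<forall>a\<in>carrier A. \<forall>x\<in>carrier M. h (a \<odot>\<^bsub>M\<^esub> x) = a \<odot>\<^bsub>N\<^esub> h x)}"

definition zero_hom :: "('a, 'b) module \<Rightarrow> ('a, 'd) module \<Rightarrow> 'b \<Rightarrow> 'd"
  where "zero_hom M N = (\<lambda>x\<in>carrier M. \<zero>\<^bsub>N\<^esub>)"

definition module_iso ::
    "('a, 'c) ring_scheme \<Rightarrow> ('a, 'b) module \<Rightarrow> ('a, 'd) module \<Rightarrow> bool"
  where "module_iso A M N \<longleftrightarrow> (\<exists>h\<in>module_hom A M N. bij_betw h (carrier M) (carrier N))"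

definition fin_gen :: "('a, 'c) ring_scheme \<Rightarrow> ('a, 'b) module \<Rightarrow> bool"
  where "fin_gen A M \<longleftrightarrow> (\<exists>S. finite S \<and> S \<subseteq> carrier M \<and>
    (\<forall>N. submodule N A M \<and> S \<subseteq> N \<longrightarrow> N = carrier M))"

definition indecomposable :: "('a, 'c) ring_scheme \<Rightarrow> ('a, 'b) module \<Rightarrow> bool"
  where "indecomposable A M \<longleftrightarrow> carrier M \<noteq> {\<zero>\<^bsub>M\<^esub>} \<and>
    (\<forall>X Y. submodule X A M \<and> submodule Y A M \<and> X \<inter> Y = {\<zero>\<^bsub>M\<^esub>} \<and> X <+>\<^bsub>M\<^esub> Y = carrier M
      \<longrightarrow> X = {\<zero>\<^bsub>M\<^esub>} \<or> Y = {\<zero>\<^bsub>M\<^esub>})"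

definition superfluous :: "('a, 'c) ring_scheme \<Rightarrow> ('a, 'b) module \<Rightarrow> 'b set \<Rightarrow> bool"
  where "superfluous A M N \<longleftrightarrow> submodule N A M \<and>
    (\<forall>X. submodule X A M \<and> N <+>\<^bsub>M\<^esub> X = carrier M \<longrightarrow> X = carrier M)"


section \<open>The category of finitely generated modules and projective presentations\<close>

text \<open>
  The objects of \<open>mod A\<close> have their elements in the fixed type \<^typ>\<open>nat \<Rightarrow> 'k\<close>, where \<open>'k\<close> is the
  type of the elements of the ground field \<open>K\<close>. For a finite-dimensional \<open>K\<close>-algebra \<open>A\<close> this
  loses nothing: a finitely generated \<open>A\<close>-module is finite-dimensional over \<open>K\<close>, hence isomorphic
  to one whose underlying space is \<open>K\<^sup>n\<close>, realized as the functions vanishing at all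
  arguments \<open>\<ge> n\<close>.
\<close>
type_synonym ('a, 'k) fmod = "('a, nat \<Rightarrow> 'k) module"

definition mod_cat :: "('a, 'c) ring_scheme \<Rightarrow> ('a, 'k) fmod set"
  where "mod_cat A = {M. left_module A M \<and> fin_gen A M}"

definition projective :: "('a, 'c) ring_scheme \<Rightarrow> ('a, 'k) fmod \<Rightarrow> bool"
  where "projective A P \<longleftrightarrow> P \<in> mod_cat A \<and>
    (\<forall>X \<in> mod_cat A. \<forall>Y \<in> mod_cat A. \<forall>g \<in> module_hom A X Y. \<forall>h \<in> module_hom A P Y.
      g ` carrier X = carrier (Y :: ('a, 'k) fmod) \<longrightarrow>
      (\<exists>h' \<in> module_hom A P (X :: ('a, 'k) fmod). compose (carrier P) g h' = h))"

definition projective_cover ::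
    "('a, 'c) ring_scheme \<Rightarrow> ('a, 'k) fmod \<Rightarrow> ('a, 'k) fmod \<Rightarrow> ((nat \<Rightarrow> 'k) \<Rightarrow> nat \<Rightarrow> 'k) \<Rightarrow> bool"
  where "projective_cover A P M g \<longleftrightarrow> projective A P \<and> g \<in> module_hom A P M \<and>
    g ` carrier P = carrier M \<and> superfluous A P (a_kernel P M g)"

text \<open>\<open>P1 \<rightarrow> P0 \<rightarrow> M \<rightarrow> 0\<close> with maps \<open>f\<close> and \<open>g\<close>.\<close>
definition minimal_projective_presentation ::
    "('a, 'c) ring_scheme \<Rightarrow> ('a, 'k) fmod \<Rightarrow> ('a, 'k) fmod \<Rightarrow> ('a, 'k) fmod \<Rightarrow>
      ((nat \<Rightarrow> 'k) \<Rightarrow> nat \<Rightarrow> 'k) \<Rightarrow> ((nat \<Rightarrow> 'k) \<Rightarrow> nat \<Rightarrow> 'k) \<Rightarrow> bool"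
  where "minimal_projective_presentation A P1 P0 M f g \<longleftrightarrow>
    projective_cover A P0 M g \<and>
    projective_cover A P1 (P0\<lparr>carrier := a_kernel P0 M g\<rparr>) f"


section \<open>The Auslander-Reiten translation\<close>

text \<open>
  Right \<open>A\<close>-modules are left modules over the opposite ring. So \<open>Hom\<^sub>A(P, A)\<close>, with
  \<open>(\<phi>a)(x) = \<phi>(x)a\<close>, and the transpose are modules over the opposite ring of \<open>A\<close>.
\<close>
definition opposite_ring :: "('a, 'c) ring_scheme \<Rightarrow> ('a, 'c) ring_scheme"
  where "opposite_ring A = A\<lparr>mult := \<lambda>a b. b \<otimes>\<^bsub>A\<^esub> a\<rparr>"

definition star_module :: "('a, 'c) ring_scheme \<Rightarrow> ('a, 'b) module \<Rightarrow> ('a, 'b \<Rightarrow> 'a) module"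
  where "star_module A P = \<lparr>
    carrier = module_hom A P (regular_module A),
    mult = undefined,
    one = undefined,
    zero = zero_hom P (regular_module A),
    add = \<lambda>\<phi> \<psi>. \<lambda>x\<in>carrier P. \<phi> x \<oplus>\<^bsub>A\<^esub> \<psi> x,
    smult = \<lambda>a \<phi>. \<lambda>x\<in>carrier P. \<phi> x \<otimes>\<^bsub>A\<^esub> a\<rparr>"

text \<open>The cokernel of \<open>Hom\<^sub>A(f, A) : Hom\<^sub>A(P0, A) \<rightarrow> Hom\<^sub>A(P1, A)\<close>.\<close>
definition transpose_module ::
    "('a, 'c) ring_scheme \<Rightarrow> ('a, 'b) module \<Rightarrow> ('a, 'b) module \<Rightarrow> ('b \<Rightarrow> 'b) \<Rightarrow>
      ('a, ('b \<Rightarrow> 'a) set) module"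
  where "transpose_module A P1 P0 f =
    star_module A P1 /\<^sub>m ((\<lambda>\<phi>. compose (carrier P1) \<phi> f) ` carrier (star_module A P0))"

text \<open>
  A \<open>K\<close>-algebra \<open>A\<close> is a module record over \<open>K\<close>; an \<open>A\<close>-module becomes a \<open>K\<close>-space through
  \<open>c \<mapsto> c 1\<^sub>A\<close>.
\<close>
definition restrict_scalars :: "('k, 'a) module \<Rightarrow> ('a, 'b) module \<Rightarrow> ('k, 'b) module"
  where "restrict_scalars A N = with_smult N (\<lambda>c x. (c \<odot>\<^bsub>A\<^esub> \<one>\<^bsub>A\<^esub>) \<odot>\<^bsub>N\<^esub> x)"

text \<open>
  \<open>D = Hom\<^sub>K(-, K)\<close>, here from modules over the opposite ring of \<open>A\<close> (right \<open>A\<close>-modules)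
  to left \<open>A\<close>-modules.
\<close>
definition dual_module ::
    "('k, 'c) ring_scheme \<Rightarrow> ('k, 'a) module \<Rightarrow> ('a, 'b) module \<Rightarrow> ('a, 'b \<Rightarrow> 'k) module"
  where "dual_module K A N = \<lparr>
    carrier = module_hom K (restrict_scalars A N) (regular_module K),
    mult = undefined,
    one = undefined,
    zero = zero_hom (restrict_scalars A N) (regular_module K),
    add = \<lambda>\<phi> \<psi>. \<lambda>x\<in>carrier N. \<phi> x \<oplus>\<^bsub>K\<^esub> \<psi> x,
    smult = \<lambda>a \<phi>. \<lambda>x\<in>carrier N. \<phi> (a \<odot>\<^bsub>N\<^esub> x)\<rparr>"

text \<open>
  \<open>T = \<tau>M = D Tr M\<close>. As usual this depends on the choice of a minimal projective presentation
  of \<open>M\<close>, which is unique up to isomorphism, and so \<open>\<tau>M\<close> is determined up to isomorphism.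
\<close>
definition AR_translate ::
    "('k, 'c) ring_scheme \<Rightarrow> ('k, 'a) module \<Rightarrow> ('a, 'k) fmod \<Rightarrow>
      ('a, ((nat \<Rightarrow> 'k) \<Rightarrow> 'a) set \<Rightarrow> 'k) module \<Rightarrow> bool"
  where "AR_translate K A M T \<longleftrightarrow> (\<exists>P1 P0 f g.
    minimal_projective_presentation A P1 P0 M f g \<and>
    T = dual_module K A (transpose_module A P1 P0 f))"


section \<open>\<open>\<tau>\<close>-tilting finiteness\<close>

definition tau_rigid :: "('k, 'c) ring_scheme \<Rightarrow> ('k, 'a) module \<Rightarrow> ('a, 'k) fmod \<Rightarrow> bool"
  where "tau_rigid K A M \<longleftrightarrow> M \<in> mod_cat A \<and>
    (\<exists>T. AR_translate K A M T \<and> module_hom A M T = {zero_hom M T})"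

definition iso_rel :: "('a, 'c) ring_scheme \<Rightarrow> ('a, 'k) fmod rel"
  where "iso_rel A = {(M, N). M \<in> mod_cat A \<and> N \<in> mod_cat A \<and> module_iso A M N}"

definition tau_tilting_finite :: "('k, 'c) ring_scheme \<Rightarrow> ('k, 'a) module \<Rightarrow> bool"
  where "tau_tilting_finite K A \<longleftrightarrow>
    finite ({M. indecomposable A M \<and> tau_rigid K A M} // iso_rel A)"

definition minimal_tau_tilting_infinite :: "('k, 'c) ring_scheme \<Rightarrow> ('k, 'a) module \<Rightarrow> bool"
  where "minimal_tau_tilting_infinite K A \<longleftrightarrow> \<not> tau_tilting_finite K A \<and>
    (\<forall>J. ideal J A \<and> J \<noteq> {\<zero>\<^bsub>A\<^esub>} \<longrightarrow> tau_tilting_finite K (A /\<^sub>m J))"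


section \<open>Bound quivers and their algebras\<close>

text \<open>
  A quiver is a finite directed multigraph, loops allowed. A path is given by its starting vertex and
  the list of its arrows in the order in which they are traversed; this includes the trivial path
  \<open>(x, [])\<close> at every vertex \<open>x\<close>.
\<close>
definition quiver_paths :: "('v, 'e) pre_digraph \<Rightarrow> ('v \<times> 'e list) set"
  where "quiver_paths Q = {(u, p). \<exists>v. pre_digraph.awalk Q u p v}"

text \<open>
  Elements of the path algebra are finitely supported functions on paths. Paths are composed from
  right to left, so in \<open>f g\<close> the initial segment of a path is evaluated by \<open>g\<close>, and the
  remaining one by \<open>f\<close>.
\<close>
definition path_algebra ::
    "('k, 'c) ring_scheme \<Rightarrow> ('v, 'e) pre_digraph \<Rightarrow> ('k, 'v \<times> 'e list \<Rightarrow> 'k) module"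
  where "path_algebra K Q = \<lparr>
    carrier = {f. range f \<subseteq> carrier K \<and> finite {p. f p \<noteq> \<zero>\<^bsub>K\<^esub>} \<and>
                  {p. f p \<noteq> \<zero>\<^bsub>K\<^esub>} \<subseteq> quiver_paths Q},
    mult = \<lambda>f g (u, p). \<Oplus>\<^bsub>K\<^esub>i\<in>{..length p}.
              f (pre_digraph.awlast Q u (take i p), drop i p) \<otimes>\<^bsub>K\<^esub> g (u, take i p),
    one = \<lambda>(u, p). if u \<in> verts Q \<and> p = [] then \<one>\<^bsub>K\<^esub> else \<zero>\<^bsub>K\<^esub>,
    zero = \<lambda>_. \<zero>\<^bsub>K\<^esub>,
    add = \<lambda>f g p. f p \<oplus>\<^bsub>K\<^esub> g p,
    smult = \<lambda>c f p. c \<otimes>\<^bsub>K\<^esub> f p\<rparr>"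

definition arrow ::
    "('k, 'c) ring_scheme \<Rightarrow> ('v, 'e) pre_digraph \<Rightarrow> 'e \<Rightarrow> 'v \<times> 'e list \<Rightarrow> 'k"
  where "arrow K Q \<alpha> = (\<lambda>p. if p = (tail Q \<alpha>, [\<alpha>]) then \<one>\<^bsub>K\<^esub> else \<zero>\<^bsub>K\<^esub>)"

definition arrow_ideal ::
    "('k, 'c) ring_scheme \<Rightarrow> ('v, 'e) pre_digraph \<Rightarrow> ('v \<times> 'e list \<Rightarrow> 'k) set"
  where "arrow_ideal K Q = Idl\<^bsub>path_algebra K Q\<^esub> (arrow K Q ` arcs Q)"

definition ideal_power :: "('a, 'c) ring_scheme \<Rightarrow> 'a set \<Rightarrow> nat \<Rightarrow> 'a set"
  where "ideal_power A J m = (ideal_prod A J ^^ m) (carrier A)"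

definition admissible ::
    "('k, 'c) ring_scheme \<Rightarrow> ('v, 'e) pre_digraph \<Rightarrow> ('v \<times> 'e list \<Rightarrow> 'k) set \<Rightarrow> bool"
  where "admissible K Q I \<longleftrightarrow> ideal I (path_algebra K Q) \<and>
    (\<exists>m\<ge>2. ideal_power (path_algebra K Q) (arrow_ideal K Q) m \<subseteq> I) \<and>
    I \<subseteq> ideal_power (path_algebra K Q) (arrow_ideal K Q) 2"

text \<open>Connectedness of the algebra \<open>KQ/I\<close> is connectedness of \<open>Q\<close>, for \<open>I\<close> admissible.\<close>
definition bound_quiver ::
    "('k, 'c) ring_scheme \<Rightarrow> ('v, 'e) pre_digraph \<Rightarrow> ('v \<times> 'e list \<Rightarrow> 'k) set \<Rightarrow> bool"
  where "bound_quiver K Q I \<longleftrightarrow>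
    fin_digraph Q \<and> Digraph_Component.connected Q \<and> admissible K Q I"

definition bound_quiver_algebra ::
    "('k, 'c) ring_scheme \<Rightarrow> ('v, 'e) pre_digraph \<Rightarrow> ('v \<times> 'e list \<Rightarrow> 'k) set \<Rightarrow>
      ('k, ('v \<times> 'e list \<Rightarrow> 'k) set) module"
  where "bound_quiver_algebra K Q I = path_algebra K Q /\<^sub>m I"

definition is_node ::
    "('k, 'c) ring_scheme \<Rightarrow> ('v, 'e) pre_digraph \<Rightarrow> ('v \<times> 'e list \<Rightarrow> 'k) set \<Rightarrow> 'v \<Rightarrow> bool"
  where "is_node K Q I x \<longleftrightarrow> x \<in> verts Q \<and> out_arcs Q x \<noteq> {} \<and> in_arcs Q x \<noteq> {} \<and>
    (\<forall>\<alpha>\<in>in_arcs Q x. \<forall>\<beta>\<in>out_arcs Q x. arrow K Q \<beta> \<otimes>\<^bsub>path_algebra K Q\<^esub> arrow K Q \<alpha> \<in> I)"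

definition node_free ::
    "('k, 'c) ring_scheme \<Rightarrow> ('v, 'e) pre_digraph \<Rightarrow> ('v \<times> 'e list \<Rightarrow> 'k) set \<Rightarrow> bool"
  where "node_free K Q I \<longleftrightarrow> \<not> (\<exists>x. is_node K Q I x)"

end

theory Submission
  imports Defs "HOL-Library.Nat_Bijection" "HOL-Library.Countable_Set"
begin

text \<open>Let \<open>x\<close> be a node of the bound quiver, let \<open>\<Lambda>\<close> be its algebra with arrow ideal \<open>r\<close>, and let \<open>e\<close>
  be the trivial path and \<open>S\<close> the simple module at \<open>x\<close>. That \<open>x\<close> is a node means \<open>r e r = 0\<close>, and so
  \<open>J_in = e r\<close> and \<open>J_out = r e\<close> are two-sided ideals with square zero. They are nonzero because they
  contain the arrows ending and starting at \<open>x\<close>. It is shown that \<open>\<Lambda>\<close> is tau-tilting finite as soon as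
  \<open>\<Lambda>/J_in\<close> and \<open>\<Lambda>/J_out\<close> are.

  A module \<open>M\<close> with minimal projective presentation \<open>P1 \<rightarrow> P0 \<rightarrow> M\<close> is tau-rigid if and only if every
  homomorphism from \<open>P1\<close> to \<open>M\<close> factors through \<open>P0\<close> (lemmas \<open>tau_hom_eq_zero\<close> and
  \<open>factors_through_presentation\<close>). For such \<open>M\<close>, the module \<open>S\<close> cannot be a quotient both of \<open>M\<close> and of the
  kernel \<open>K1\<close> of \<open>P0 \<rightarrow> M\<close> (lemma \<open>top_avoidance_dichotomy\<close>).

  If \<open>S\<close> is not a quotient of \<open>M\<close>, then \<open>J_out\<close> annihilates \<open>M\<close> and \<open>P0\<close>. If \<open>S\<close> is not a quotient of \<open>K1\<close>,
  then every homomorphism from \<open>M\<close> to a module \<open>N/(J_in N)\<close> lifts to \<open>N\<close>: the obstruction is a homomorphism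
  from \<open>K1\<close> to \<open>J_in N\<close>, which is a sum of copies of \<open>S\<close>. In both cases, for the respective ideal
  \<open>J\<close>, the reduction of the minimal presentation modulo \<open>J\<close> is a minimal presentation of \<open>M/JM\<close>, which is
  therefore tau-rigid over \<open>\<Lambda>/J\<close> (lemma \<open>tau_rigid_reduction\<close>). Moreover, as \<open>J\<^sup>2 = 0\<close>, the lifting
  property shows that \<open>M/JM\<close> is indecomposable if \<open>M\<close> is, and that it determines \<open>M\<close> up to isomorphism
  (lemma \<open>finitely_many_classes\<close>). So there are only finitely many indecomposable tau-rigid
  \<open>\<Lambda>\<close>-modules.

  The argument is carried out for an algebra of arbitrary dimension with an idempotent \<open>e\<close> and
  an ideal \<open>r\<close> as above (locale \<open>node_algebra\<close>). Modules over \<open>\<Lambda>/J\<close> are realized on sets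
  of representatives, so that they stay in the type of the objects of the module category.\<close>

section \<open>Modules, submodules and homomorphisms\<close>

lemma left_moduleI:
  assumes "ring A" "abelian_group M"
    and "\<And>a x. a \<in> carrier A \<Longrightarrow> x \<in> carrier M \<Longrightarrow> a \<odot>\<^bsub>M\<^esub> x \<in> carrier M"
    and "\<And>a b x. a \<in> carrier A \<Longrightarrow> b \<in> carrier A \<Longrightarrow> x \<in> carrier M \<Longrightarrow>
      (a \<oplus>\<^bsub>A\<^esub> b) \<odot>\<^bsub>M\<^esub> x = a \<odot>\<^bsub>M\<^esub> x \<oplus>\<^bsub>M\<^esub> b \<odot>\<^bsub>M\<^esub> x"
    and "\<And>a x y. a \<in> carrier A \<Longrightarrow> x \<in> carrier M \<Longrightarrow> y \<in> carrier M \<Longrightarrow>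
      a \<odot>\<^bsub>M\<^esub> (x \<oplus>\<^bsub>M\<^esub> y) = a \<odot>\<^bsub>M\<^esub> x \<oplus>\<^bsub>M\<^esub> a \<odot>\<^bsub>M\<^esub> y"
    and "\<And>a b x. a \<in> carrier A \<Longrightarrow> b \<in> carrier A \<Longrightarrow> x \<in> carrier M \<Longrightarrow>
      (a \<otimes>\<^bsub>A\<^esub> b) \<odot>\<^bsub>M\<^esub> x = a \<odot>\<^bsub>M\<^esub> (b \<odot>\<^bsub>M\<^esub> x)"
    and "\<And>x. x \<in> carrier M \<Longrightarrow> \<one>\<^bsub>A\<^esub> \<odot>\<^bsub>M\<^esub> x = x"
  shows "left_module A M"
  using assms by (auto intro!: left_module.intro left_module_axioms.intro)

lemma left_module_ring: "left_module A M \<Longrightarrow> ring A"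
  by (simp add: left_module_def)

lemma left_module_group: "left_module A M \<Longrightarrow> abelian_group M"
  by (simp add: left_module_def)

context left_module
begin

lemma smult_l_null [simp]:
  assumes "x \<in> carrier M" shows "\<zero> \<odot>\<^bsub>M\<^esub> x = \<zero>\<^bsub>M\<^esub>"
proof -
  have "\<zero> \<odot>\<^bsub>M\<^esub> x \<oplus>\<^bsub>M\<^esub> \<zero> \<odot>\<^bsub>M\<^esub> x = \<zero> \<odot>\<^bsub>M\<^esub> x"
    using assms smult_l_distr[of \<zero> \<zero> x] by simp
  then show ?thesis using assms by (metis M.add.r_cancel_one' R.zero_closed smult_closed)
qed

lemma smult_r_null [simp]:
  assumes "a \<in> carrier R" shows "a \<odot>\<^bsub>M\<^esub> \<zero>\<^bsub>M\<^esub> = \<zero>\<^bsub>M\<^esub>"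
proof -
  have "a \<odot>\<^bsub>M\<^esub> \<zero>\<^bsub>M\<^esub> \<oplus>\<^bsub>M\<^esub> a \<odot>\<^bsub>M\<^esub> \<zero>\<^bsub>M\<^esub> = a \<odot>\<^bsub>M\<^esub> \<zero>\<^bsub>M\<^esub>"
    using assms smult_r_distr[of a "\<zero>\<^bsub>M\<^esub>" "\<zero>\<^bsub>M\<^esub>"] by simp
  then show ?thesis using assms by (metis M.add.r_cancel_one' M.zero_closed smult_closed)
qed

lemma smult_l_minus:
  assumes "a \<in> carrier R" "x \<in> carrier M"
  shows "(\<ominus> a) \<odot>\<^bsub>M\<^esub> x = \<ominus>\<^bsub>M\<^esub> (a \<odot>\<^bsub>M\<^esub> x)"
proof -
  have "(\<ominus> a) \<odot>\<^bsub>M\<^esub> x \<oplus>\<^bsub>M\<^esub> a \<odot>\<^bsub>M\<^esub> x = \<zero>\<^bsub>M\<^esub>"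
    using assms smult_l_distr[of "\<ominus> a" a x] by (simp add: R.l_neg)
  then show ?thesis using assms by (simp add: M.minus_equality)
qed

lemma smult_r_minus:
  assumes "a \<in> carrier R" "x \<in> carrier M"
  shows "a \<odot>\<^bsub>M\<^esub> (\<ominus>\<^bsub>M\<^esub> x) = \<ominus>\<^bsub>M\<^esub> (a \<odot>\<^bsub>M\<^esub> x)"
proof -
  have "a \<odot>\<^bsub>M\<^esub> (\<ominus>\<^bsub>M\<^esub> x) \<oplus>\<^bsub>M\<^esub> a \<odot>\<^bsub>M\<^esub> x = \<zero>\<^bsub>M\<^esub>"
    using assms smult_r_distr[of a "\<ominus>\<^bsub>M\<^esub> x" x] by (simp add: M.l_neg)
  then show ?thesis using assms by (simp add: M.minus_equality)
qed

lemma smult_r_diff: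
  assumes "a \<in> carrier R" "x \<in> carrier M" "y \<in> carrier M"
  shows "a \<odot>\<^bsub>M\<^esub> (x \<ominus>\<^bsub>M\<^esub> y) = a \<odot>\<^bsub>M\<^esub> x \<ominus>\<^bsub>M\<^esub> a \<odot>\<^bsub>M\<^esub> y"
  using assms by (simp add: a_minus_def smult_r_distr smult_r_minus)

lemma smult_l_diff:
  assumes "a \<in> carrier R" "b \<in> carrier R" "x \<in> carrier M"
  shows "(a \<ominus> b) \<odot>\<^bsub>M\<^esub> x = a \<odot>\<^bsub>M\<^esub> x \<ominus>\<^bsub>M\<^esub> b \<odot>\<^bsub>M\<^esub> x"
  using assms by (simp add: a_minus_def smult_l_distr smult_l_minus)

lemma diff_add_cancel: "x \<in> carrier M \<Longrightarrow> y \<in> carrier M \<Longrightarrow> (x \<ominus>\<^bsub>M\<^esub> y) \<oplus>\<^bsub>M\<^esub> y = x"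
  by (simp add: a_minus_def M.a_assoc M.l_neg)

lemma add_diff_cancel: "x \<in> carrier M \<Longrightarrow> y \<in> carrier M \<Longrightarrow> (x \<oplus>\<^bsub>M\<^esub> y) \<ominus>\<^bsub>M\<^esub> y = x"
  by (simp add: a_minus_def M.a_assoc M.r_neg)

lemma diff_eq_zero_iff: "x \<in> carrier M \<Longrightarrow> y \<in> carrier M \<Longrightarrow> x \<ominus>\<^bsub>M\<^esub> y = \<zero>\<^bsub>M\<^esub> \<longleftrightarrow> x = y"
  using diff_add_cancel[of x y] by (auto simp: a_minus_def M.r_neg)

lemma submodule_iff:
  "submodule N R M \<longleftrightarrow> N \<subseteq> carrier M \<and> \<zero>\<^bsub>M\<^esub> \<in> N \<and> (\<forall>x\<in>N. \<forall>y\<in>N. x \<oplus>\<^bsub>M\<^esub> y \<in> N) \<and>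
    (\<forall>a\<in>carrier R. \<forall>x\<in>N. a \<odot>\<^bsub>M\<^esub> x \<in> N)"
proof
  assume "submodule N R M"
  then interpret N: submodule N R M .
  show "N \<subseteq> carrier M \<and> \<zero>\<^bsub>M\<^esub> \<in> N \<and> (\<forall>x\<in>N. \<forall>y\<in>N. x \<oplus>\<^bsub>M\<^esub> y \<in> N) \<and>
    (\<forall>a\<in>carrier R. \<forall>x\<in>N. a \<odot>\<^bsub>M\<^esub> x \<in> N)"
    using N.subset N.one_closed N.m_closed by auto
next
  assume *: "N \<subseteq> carrier M \<and> \<zero>\<^bsub>M\<^esub> \<in> N \<and> (\<forall>x\<in>N. \<forall>y\<in>N. x \<oplus>\<^bsub>M\<^esub> y \<in> N) \<and>
    (\<forall>a\<in>carrier R. \<forall>x\<in>N. a \<odot>\<^bsub>M\<^esub> x \<in> N)"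
  have "\<ominus>\<^bsub>M\<^esub> x \<in> N" if "x \<in> N" for x
  proof -
    have "(\<ominus> \<one>) \<odot>\<^bsub>M\<^esub> x \<in> N" using * that by blast
    moreover have "x \<in> carrier M" using * that by blast
    ultimately show ?thesis by (simp add: smult_l_minus)
  qed
  then show "submodule N R M"
    using * by (intro submodule.intro subgroup.intro submodule_axioms.intro)
      (auto simp: a_inv_def)
qed

lemma submodule_carrier: "submodule (carrier M) R M"
  by (simp add: submodule_iff)

lemma submodule_zero: "submodule {\<zero>\<^bsub>M\<^esub>} R M"
  by (simp add: submodule_iff)

lemma submodule_diff:
  assumes "submodule N R M" "x \<in> N" "y \<in> N" shows "x \<ominus>\<^bsub>M\<^esub> y \<in> N"
proof -
  have "x \<oplus>\<^bsub>M\<^esub> (\<ominus> \<one>) \<odot>\<^bsub>M\<^esub> y \<in> N" "y \<in> carrier M" using assms by (auto simp: submodule_iff)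
  then show ?thesis by (simp add: a_minus_def smult_l_minus)
qed

lemma left_module_submodule:
  assumes "submodule N R M" shows "left_module R (M\<lparr>carrier := N\<rparr>)"
proof (rule left_moduleI)
  have N: "N \<subseteq> carrier M" "\<And>x. x \<in> N \<Longrightarrow> x \<in> carrier M" using assms by (auto simp: submodule_iff)
  show "ring R" by (rule R.ring_axioms)
  show "abelian_group (M\<lparr>carrier := N\<rparr>)"
  proof (rule abelian_groupI)
    show "\<exists>y\<in>carrier (M\<lparr>carrier := N\<rparr>). y \<oplus>\<^bsub>M\<lparr>carrier := N\<rparr>\<^esub> x = \<zero>\<^bsub>M\<lparr>carrier := N\<rparr>\<^esub>"
      if "x \<in> carrier (M\<lparr>carrier := N\<rparr>)" for x
    proof -
      have "\<zero>\<^bsub>M\<^esub> \<ominus>\<^bsub>M\<^esub> x \<in> N" using that assms submodule_diff[of N "\<zero>\<^bsub>M\<^esub>" x] by (auto simp: submodule_iff)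
      then show ?thesis using that N
        by (intro bexI[of _ "\<zero>\<^bsub>M\<^esub> \<ominus>\<^bsub>M\<^esub> x"]) (auto simp: diff_add_cancel)
    qed
  qed (use assms in \<open>auto simp: submodule_iff subset_iff M.a_ac\<close>)
qed (use assms in \<open>auto simp: submodule_iff subset_iff smult_l_distr smult_r_distr smult_assoc1\<close>)

lemma submodule_of_submodule:
  assumes "submodule N R M"
  shows "submodule X R (M\<lparr>carrier := N\<rparr>) \<longleftrightarrow> submodule X R M \<and> X \<subseteq> N"
  using left_module.submodule_iff[OF left_module_submodule[OF assms], of X] assms
  by (auto simp: submodule_iff)

lemma submodule_Int: "submodule X R M \<Longrightarrow> submodule Y R M \<Longrightarrow> submodule (X \<inter> Y) R M"
  by (auto simp: submodule_iff)

end

lemma set_add_iff: "z \<in> X <+>\<^bsub>M\<^esub> Y \<longleftrightarrow> (\<exists>x\<in>X. \<exists>y\<in>Y. z = x \<oplus>\<^bsub>M\<^esub> y)"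
  by (auto simp: set_add_def')

lemma a_kernel_iff: "x \<in> a_kernel M N h \<longleftrightarrow> x \<in> carrier M \<and> h x = \<zero>\<^bsub>N\<^esub>"
  by (simp add: a_kernel_def kernel_def)

lemma (in left_module) set_add_eq_carrier:
  assumes "X \<subseteq> carrier M" "Y \<subseteq> carrier M"
  shows "X <+>\<^bsub>M\<^esub> Y = carrier M \<longleftrightarrow> (\<forall>z\<in>carrier M. \<exists>x\<in>X. \<exists>y\<in>Y. z = x \<oplus>\<^bsub>M\<^esub> y)"
  using assms by (auto simp: set_eq_iff set_add_iff)

lemma module_homI:
  assumes "\<And>x. x \<in> carrier M \<Longrightarrow> h x \<in> carrier N"
    and "\<And>x y. x \<in> carrier M \<Longrightarrow> y \<in> carrier M \<Longrightarrow> x \<oplus>\<^bsub>M\<^esub> y \<in> carrier M \<Longrightarrow> h (x \<oplus>\<^bsub>M\<^esub> y) = h x \<oplus>\<^bsub>N\<^esub> h y"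
    and "\<And>a x. a \<in> carrier A \<Longrightarrow> x \<in> carrier M \<Longrightarrow> a \<odot>\<^bsub>M\<^esub> x \<in> carrier M \<Longrightarrow> h (a \<odot>\<^bsub>M\<^esub> x) = a \<odot>\<^bsub>N\<^esub> h x"
    and "left_module A M"
  shows "restrict h (carrier M) \<in> module_hom A M N"
proof -
  interpret left_module A M by fact
  show ?thesis using assms by (auto simp: module_hom_def)
qed

lemma hom_closed: "h \<in> module_hom A M N \<Longrightarrow> x \<in> carrier M \<Longrightarrow> h x \<in> carrier N"
  by (auto simp: module_hom_def)

lemma hom_add: "h \<in> module_hom A M N \<Longrightarrow> x \<in> carrier M \<Longrightarrow> y \<in> carrier M \<Longrightarrow>
    h (x \<oplus>\<^bsub>M\<^esub> y) = h x \<oplus>\<^bsub>N\<^esub> h y"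
  by (auto simp: module_hom_def)

lemma hom_smult: "h \<in> module_hom A M N \<Longrightarrow> a \<in> carrier A \<Longrightarrow> x \<in> carrier M \<Longrightarrow>
    h (a \<odot>\<^bsub>M\<^esub> x) = a \<odot>\<^bsub>N\<^esub> h x"
  by (auto simp: module_hom_def)

lemma hom_ext: "h \<in> module_hom A M N \<Longrightarrow> h \<in> extensional (carrier M)"
  by (auto simp: module_hom_def PiE_def)

lemma hom_eqI:
  "h \<in> module_hom A M N \<Longrightarrow> h' \<in> module_hom A M N' \<Longrightarrow> (\<And>x. x \<in> carrier M \<Longrightarrow> h x = h' x) \<Longrightarrow> h = h'"
  by (meson extensionalityI hom_ext)

lemma hom_zero:
  assumes "left_module A M" "left_module A N" "h \<in> module_hom A M N"
  shows "h \<zero>\<^bsub>M\<^esub> = \<zero>\<^bsub>N\<^esub>"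
proof -
  interpret M: left_module A M by fact
  interpret N: left_module A N by fact
  have "h (\<zero>\<^bsub>A\<^esub> \<odot>\<^bsub>M\<^esub> \<zero>\<^bsub>M\<^esub>) = \<zero>\<^bsub>A\<^esub> \<odot>\<^bsub>N\<^esub> h \<zero>\<^bsub>M\<^esub>"
    using hom_smult[OF assms(3)] by blast
  then show ?thesis using hom_closed[OF assms(3)] by simp
qed

lemma hom_diff:
  assumes "left_module A M" "left_module A N" "h \<in> module_hom A M N" "x \<in> carrier M" "y \<in> carrier M"
  shows "h (x \<ominus>\<^bsub>M\<^esub> y) = h x \<ominus>\<^bsub>N\<^esub> h y"
proof -
  interpret M: left_module A M by fact
  interpret N: left_module A N by fact
  have "h (x \<ominus>\<^bsub>M\<^esub> y) \<oplus>\<^bsub>N\<^esub> h y = h x"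
    using assms hom_add[OF assms(3), of "x \<ominus>\<^bsub>M\<^esub> y" y] by (simp add: M.diff_add_cancel)
  then show ?thesis
    using assms hom_closed[OF assms(3)] N.add_diff_cancel[of "h (x \<ominus>\<^bsub>M\<^esub> y)" "h y"] by simp
qed

lemma hom_comp:
  assumes "h \<in> module_hom A M N" "g \<in> module_hom A N P" "left_module A M"
  shows "compose (carrier M) g h \<in> module_hom A M P"
  unfolding compose_def using assms
  by (intro module_homI) (auto simp: hom_closed hom_add hom_smult)

lemma hom_restrict_target:
  "h \<in> module_hom A M (N\<lparr>carrier := X\<rparr>) \<Longrightarrow> X \<subseteq> carrier N \<Longrightarrow> h \<in> module_hom A M N"
  by (auto simp: module_hom_def)

lemma hom_into_submodule:
  "h \<in> module_hom A M N \<Longrightarrow> (\<And>x. x \<in> carrier M \<Longrightarrow> h x \<in> X) \<Longrightarrow> h \<in> module_hom A M (N\<lparr>carrier := X\<rparr>)"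
  by (auto simp: module_hom_def PiE_def extensional_def)

lemma hom_vimage_submodule:
  assumes "left_module A M" "left_module A N" "h \<in> module_hom A M N" "submodule X A N"
  shows "submodule {x \<in> carrier M. h x \<in> X} A M"
proof -
  interpret M: left_module A M by fact
  interpret N: left_module A N by fact
  show ?thesis using assms(4) hom_zero[OF assms(1-3)]
    by (auto simp: M.submodule_iff N.submodule_iff hom_add[OF assms(3)] hom_smult[OF assms(3)])
qed

lemma hom_image_submodule:
  assumes "left_module A M" "left_module A N" "h \<in> module_hom A M N" "submodule X A M"
  shows "submodule (h ` X) A N"
proof -
  interpret M: left_module A M by fact
  interpret N: left_module A N by fact
  have X: "X \<subseteq> carrier M" "\<zero>\<^bsub>M\<^esub> \<in> X" using assms(4) by (auto simp: M.submodule_iff)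
  show ?thesis unfolding N.submodule_iff
  proof (intro conjI ballI)
    show "h ` X \<subseteq> carrier N" using X hom_closed[OF assms(3)] by auto
    show "\<zero>\<^bsub>N\<^esub> \<in> h ` X" using X hom_zero[OF assms(1-3)] by (metis imageI)
  next
    fix x y assume "x \<in> h ` X" "y \<in> h ` X"
    then obtain u v where uv: "u \<in> X" "v \<in> X" "x = h u" "y = h v" by blast
    then have "x \<oplus>\<^bsub>N\<^esub> y = h (u \<oplus>\<^bsub>M\<^esub> v)" using X hom_add[OF assms(3)] by (simp add: subsetD)
    then show "x \<oplus>\<^bsub>N\<^esub> y \<in> h ` X" using uv assms(4) by (auto simp: M.submodule_iff)
  next
    fix a x assume "a \<in> carrier A" "x \<in> h ` X"
    then obtain u where u: "u \<in> X" "x = h u" by blast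
    then have "a \<odot>\<^bsub>N\<^esub> x = h (a \<odot>\<^bsub>M\<^esub> u)"
      using X hom_smult[OF assms(3)] \<open>a \<in> carrier A\<close> by (simp add: subsetD)
    then show "a \<odot>\<^bsub>N\<^esub> x \<in> h ` X" using u assms(4) \<open>a \<in> carrier A\<close> by (auto simp: M.submodule_iff)
  qed
qed

lemma submodule_kernel:
  assumes "left_module A M" "left_module A N" "h \<in> module_hom A M N"
  shows "submodule (a_kernel M N h) A M"
  using hom_vimage_submodule[OF assms left_module.submodule_zero[OF assms(2)]]
  by (simp add: a_kernel_def kernel_def)

lemma fin_gen_image:
  assumes "left_module A M" "left_module A N" "h \<in> module_hom A M N" "h ` carrier M = carrier N"
    and "fin_gen A M"
  shows "fin_gen A N"
proof -
  obtain S where S: "finite S" "S \<subseteq> carrier M" "\<And>X. submodule X A M \<Longrightarrow> S \<subseteq> X \<Longrightarrow> X = carrier M"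
    using assms(5) by (auto simp: fin_gen_def)
  have "Y = carrier N" if Y: "submodule Y A N" "h ` S \<subseteq> Y" for Y
  proof -
    have "{x \<in> carrier M. h x \<in> Y} = carrier M"
      using S(3)[OF hom_vimage_submodule[OF assms(1-3) Y(1)]] S(2) Y(2) by blast
    then have "h ` carrier M \<subseteq> Y" by auto
    then show ?thesis using Y(1) assms(4) by (auto simp: left_module.submodule_iff[OF assms(2)])
  qed
  then show ?thesis using S assms(4) unfolding fin_gen_def by (intro exI[of _ "h ` S"]) (auto intro: hom_closed[OF assms(3)])
qed

lemma bij_hom_inv:
  assumes "left_module A M" "left_module A N" "h \<in> module_hom A M N" "bij_betw h (carrier M) (carrier N)"
  shows "restrict (inv_into (carrier M) h) (carrier N) \<in> module_hom A N M"
proof -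
  interpret M: left_module A M by fact
  interpret N: left_module A N by fact
  let ?g = "inv_into (carrier M) h"
  have g: "\<And>y. y \<in> carrier N \<Longrightarrow> ?g y \<in> carrier M" "\<And>y. y \<in> carrier N \<Longrightarrow> h (?g y) = y"
    "\<And>x. x \<in> carrier M \<Longrightarrow> ?g (h x) = x"
    using assms(4) by (auto simp: bij_betw_def inv_into_into f_inv_into_f inv_into_f_f)
  show ?thesis
  proof (rule module_homI)
    fix x y assume xy: "x \<in> carrier N" "y \<in> carrier N"
    have "h (?g x \<oplus>\<^bsub>M\<^esub> ?g y) = x \<oplus>\<^bsub>N\<^esub> y" using xy g by (simp add: hom_add[OF assms(3)])
    then show "?g (x \<oplus>\<^bsub>N\<^esub> y) = ?g x \<oplus>\<^bsub>M\<^esub> ?g y" using g xy by (metis M.add.m_closed)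
  next
    fix a x assume ax: "a \<in> carrier A" "x \<in> carrier N"
    have "h (a \<odot>\<^bsub>M\<^esub> ?g x) = a \<odot>\<^bsub>N\<^esub> x" using ax g by (simp add: hom_smult[OF assms(3)])
    then show "?g (a \<odot>\<^bsub>N\<^esub> x) = a \<odot>\<^bsub>M\<^esub> ?g x" using g ax by (metis M.smult_closed)
  qed (use g assms in auto)
qed

lemma module_iso_sym:
  assumes "left_module A M" "left_module A N" "module_iso A M N"
  shows "module_iso A N M"
proof -
  obtain h where h: "h \<in> module_hom A M N" "bij_betw h (carrier M) (carrier N)"
    using assms(3) by (auto simp: module_iso_def)
  have "bij_betw (restrict (inv_into (carrier M) h) (carrier N)) (carrier N) (carrier M)"
    using bij_betw_inv_into[OF h(2)] by (rule bij_betw_cong[THEN iffD1, rotated]) simp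
  then show ?thesis using bij_hom_inv[OF assms(1,2) h] unfolding module_iso_def by (rule bexI)
qed

lemma module_iso_trans:
  assumes "left_module A M" "module_iso A M N" "module_iso A N P"
  shows "module_iso A M P"
proof -
  obtain h g where h: "h \<in> module_hom A M N" "bij_betw h (carrier M) (carrier N)"
    and g: "g \<in> module_hom A N P" "bij_betw g (carrier N) (carrier P)"
    using assms(2,3) by (auto simp: module_iso_def)
  have "bij_betw (compose (carrier M) g h) (carrier M) (carrier P)"
    using bij_betw_trans[OF h(2) g(2)] by (simp add: compose_def cong: bij_betw_cong)
  then show ?thesis using hom_comp[OF h(1) g(1) assms(1)] by (auto simp: module_iso_def)
qed

lemma module_iso_refl:
  assumes "left_module A M" shows "module_iso A M M"
proof -
  have "restrict (\<lambda>x. x) (carrier M) \<in> module_hom A M M"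
    using assms by (intro module_homI) auto
  then show ?thesis unfolding module_iso_def
    by (metis (no_types, lifting) bij_betw_cong bij_betw_id_iff id_apply restrict_apply')
qed

lemma (in left_module) finsum_smult:
  "finite X \<Longrightarrow> a \<in> carrier R \<Longrightarrow> f \<in> X \<rightarrow> carrier M \<Longrightarrow>
    a \<odot>\<^bsub>M\<^esub> finsum M f X = finsum M (\<lambda>i. a \<odot>\<^bsub>M\<^esub> f i) X"
  by (induct set: finite) (auto simp: Pi_def smult_r_distr)

lemma additive_finsum:
  assumes "abelian_group G" "abelian_group H"
    and "\<And>x. x \<in> carrier G \<Longrightarrow> h x \<in> carrier H"
    and "\<And>x y. x \<in> carrier G \<Longrightarrow> y \<in> carrier G \<Longrightarrow> h (x \<oplus>\<^bsub>G\<^esub> y) = h x \<oplus>\<^bsub>H\<^esub> h y"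
    and "finite X" "\<And>i. i \<in> X \<Longrightarrow> f i \<in> carrier G"
  shows "h (finsum G f X) = finsum H (\<lambda>i. h (f i)) X"
proof -
  interpret G: abelian_group G by fact
  interpret H: abelian_group H by fact
  have 0: "h \<zero>\<^bsub>G\<^esub> = \<zero>\<^bsub>H\<^esub>"
    using assms(3)[of "\<zero>\<^bsub>G\<^esub>"] assms(4)[of "\<zero>\<^bsub>G\<^esub>" "\<zero>\<^bsub>G\<^esub>"]
    by (metis G.r_zero G.zero_closed H.add.r_cancel_one')
  show ?thesis using assms(5,6)
    by (induct set: finite) (auto simp: 0 Pi_def assms(3,4))
qed

lemma hom_finsum:
  assumes "left_module A M" "left_module A N" "h \<in> module_hom A M N"
    and "finite X" "\<And>i. i \<in> X \<Longrightarrow> f i \<in> carrier M"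
  shows "h (finsum M f X) = finsum N (\<lambda>i. h (f i)) X"
  using assms by (intro additive_finsum) (auto simp: left_module_group hom_closed hom_add)

lemma (in left_module) diff_zero: "x \<in> carrier M \<Longrightarrow> x \<ominus>\<^bsub>M\<^esub> \<zero>\<^bsub>M\<^esub> = x"
  by (metis M.zero_closed add_diff_cancel M.r_zero)

section \<open>Linear functionals\<close>

text \<open>No dimension is assumed to be finite, so the complement of the line through \<open>v\<close> comes from
  Zorn's lemma.\<close>
lemma linear_functional_exists:
  assumes K: "field K" and V: "left_module K V" and W: "submodule W K V" and v: "v \<in> carrier V" "v \<notin> W"
  obtains F where "\<And>x. x \<in> carrier V \<Longrightarrow> F x \<in> carrier K"
    and "\<And>x y. x \<in> carrier V \<Longrightarrow> y \<in> carrier V \<Longrightarrow> F (x \<oplus>\<^bsub>V\<^esub> y) = F x \<oplus>\<^bsub>K\<^esub> F y"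
    and "\<And>c x. c \<in> carrier K \<Longrightarrow> x \<in> carrier V \<Longrightarrow> F (c \<odot>\<^bsub>V\<^esub> x) = c \<otimes>\<^bsub>K\<^esub> F x"
    and "\<And>w. w \<in> W \<Longrightarrow> F w = \<zero>\<^bsub>K\<^esub>" and "F v = \<one>\<^bsub>K\<^esub>"
proof -
  interpret K: field K by fact
  interpret V: left_module K V by fact
  define S where "S = {U. submodule U K V \<and> W \<subseteq> U \<and> v \<notin> U}"
  have "\<exists>U\<in>S. \<forall>X\<in>S. U \<subseteq> X \<longrightarrow> X = U"
  proof (rule subset_Zorn_nonempty)
    show "S \<noteq> {}" using W v by (auto simp: S_def)
    fix C assume C: "C \<noteq> {}" "subset.chain S C"
    then have CS: "\<And>U. U \<in> C \<Longrightarrow> U \<in> S" and tot: "\<And>U U'. U \<in> C \<Longrightarrow> U' \<in> C \<Longrightarrow> U \<subseteq> U' \<or> U' \<subseteq> U"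
      by (auto simp: subset.chain_def)
    have CV: "\<And>U x. U \<in> C \<Longrightarrow> x \<in> U \<Longrightarrow> x \<in> carrier V" and C0: "\<And>U. U \<in> C \<Longrightarrow> \<zero>\<^bsub>V\<^esub> \<in> U"
      and Ca: "\<And>U x y. U \<in> C \<Longrightarrow> x \<in> U \<Longrightarrow> y \<in> U \<Longrightarrow> x \<oplus>\<^bsub>V\<^esub> y \<in> U"
      and Cs: "\<And>U c x. U \<in> C \<Longrightarrow> c \<in> carrier K \<Longrightarrow> x \<in> U \<Longrightarrow> c \<odot>\<^bsub>V\<^esub> x \<in> U"
      using CS unfolding S_def V.submodule_iff by blast+
    have "submodule (\<Union>C) K V" unfolding V.submodule_iff
    proof (intro conjI ballI)
      show "\<Union>C \<subseteq> carrier V" using CV by blast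
      show "\<zero>\<^bsub>V\<^esub> \<in> \<Union>C" using C0 C(1) by blast
    next
      fix x y assume "x \<in> \<Union>C" "y \<in> \<Union>C"
      then obtain U U' where "U \<in> C" "U' \<in> C" "x \<in> U" "y \<in> U'" by blast
      then obtain U'' where "U'' \<in> C" "x \<in> U''" "y \<in> U''" using tot[of U U'] by blast
      then show "x \<oplus>\<^bsub>V\<^esub> y \<in> \<Union>C" using Ca[of U'' x y] by blast
    next
      fix c x assume "c \<in> carrier K" "x \<in> \<Union>C"
      then show "c \<odot>\<^bsub>V\<^esub> x \<in> \<Union>C" using Cs by blast
    qed
    moreover have "W \<subseteq> \<Union>C" "v \<notin> \<Union>C" using CS C(1) unfolding S_def by blast+
    ultimately show "\<Union>C \<in> S" by (simp add: S_def)
  qed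
  then obtain U where U: "submodule U K V" "W \<subseteq> U" "v \<notin> U"
    and max: "\<And>X. submodule X K V \<Longrightarrow> U \<subseteq> X \<Longrightarrow> v \<notin> X \<Longrightarrow> X = U"
    by (auto simp: S_def)
  have Uc: "\<And>x. x \<in> U \<Longrightarrow> x \<in> carrier V" and U0: "\<zero>\<^bsub>V\<^esub> \<in> U"
    and Ua: "\<And>x y. x \<in> U \<Longrightarrow> y \<in> U \<Longrightarrow> x \<oplus>\<^bsub>V\<^esub> y \<in> U"
    and Us: "\<And>c x. c \<in> carrier K \<Longrightarrow> x \<in> U \<Longrightarrow> c \<odot>\<^bsub>V\<^esub> x \<in> U"
    using U(1) by (auto simp: V.submodule_iff)
  \<comment> \<open>As \<open>U\<close> is maximal among the subspaces without \<open>v\<close>, it is a complement of the line through \<open>v\<close>.\<close>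
  have ex: "\<exists>c\<in>carrier K. u \<ominus>\<^bsub>V\<^esub> c \<odot>\<^bsub>V\<^esub> v \<in> U" if u: "u \<in> carrier V" for u
  proof (cases "u \<in> U")
    case True
    then show ?thesis using v by (intro bexI[of _ "\<zero>\<^bsub>K\<^esub>"]) (simp_all add: V.diff_zero Uc)
  next
    case False
    define X where "X = {w \<in> carrier V. \<exists>c\<in>carrier K. w \<ominus>\<^bsub>V\<^esub> c \<odot>\<^bsub>V\<^esub> u \<in> U}"
    have "submodule X K V" unfolding V.submodule_iff
    proof (intro conjI ballI)
      show "X \<subseteq> carrier V" by (auto simp: X_def)
      show "\<zero>\<^bsub>V\<^esub> \<in> X" using u U0
        by (auto simp: X_def V.diff_zero intro!: bexI[of _ "\<zero>\<^bsub>K\<^esub>"])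
    next
      fix x y assume "x \<in> X" "y \<in> X"
      then obtain c d where cd: "x \<in> carrier V" "y \<in> carrier V" "c \<in> carrier K" "d \<in> carrier K"
        "x \<ominus>\<^bsub>V\<^esub> c \<odot>\<^bsub>V\<^esub> u \<in> U" "y \<ominus>\<^bsub>V\<^esub> d \<odot>\<^bsub>V\<^esub> u \<in> U"
        by (auto simp: X_def)
      have "(x \<oplus>\<^bsub>V\<^esub> y) \<ominus>\<^bsub>V\<^esub> (c \<oplus>\<^bsub>K\<^esub> d) \<odot>\<^bsub>V\<^esub> u = (x \<ominus>\<^bsub>V\<^esub> c \<odot>\<^bsub>V\<^esub> u) \<oplus>\<^bsub>V\<^esub> (y \<ominus>\<^bsub>V\<^esub> d \<odot>\<^bsub>V\<^esub> u)"
        using cd u by (simp add: a_minus_def V.smult_l_distr V.M.minus_add V.M.a_ac)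
      then show "x \<oplus>\<^bsub>V\<^esub> y \<in> X" using cd Ua by (auto simp: X_def intro!: bexI[of _ "c \<oplus>\<^bsub>K\<^esub> d"])
    next
      fix a x assume "a \<in> carrier K" "x \<in> X"
      then obtain c where c: "a \<in> carrier K" "x \<in> carrier V" "c \<in> carrier K" "x \<ominus>\<^bsub>V\<^esub> c \<odot>\<^bsub>V\<^esub> u \<in> U"
        by (auto simp: X_def)
      have "a \<odot>\<^bsub>V\<^esub> x \<ominus>\<^bsub>V\<^esub> (a \<otimes>\<^bsub>K\<^esub> c) \<odot>\<^bsub>V\<^esub> u = a \<odot>\<^bsub>V\<^esub> (x \<ominus>\<^bsub>V\<^esub> c \<odot>\<^bsub>V\<^esub> u)"
        using c u by (simp add: V.smult_r_diff V.smult_assoc1)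
      then show "a \<odot>\<^bsub>V\<^esub> x \<in> X" using c Us by (auto simp: X_def intro!: bexI[of _ "a \<otimes>\<^bsub>K\<^esub> c"])
    qed
    moreover have "U \<subseteq> X"
      using u by (auto simp: X_def Uc V.diff_zero intro!: bexI[of _ "\<zero>\<^bsub>K\<^esub>"])
    moreover have "u \<in> X"
      using u U0 V.diff_eq_zero_iff[of u u] by (auto simp: X_def intro!: bexI[of _ "\<one>\<^bsub>K\<^esub>"])
    ultimately have "v \<in> X" using max[of X] False by blast
    then obtain c where c: "c \<in> carrier K" "v \<ominus>\<^bsub>V\<^esub> c \<odot>\<^bsub>V\<^esub> u \<in> U" by (auto simp: X_def)
    have c0: "c \<noteq> \<zero>\<^bsub>K\<^esub>" using c U(3) u v by (auto simp: V.diff_zero)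
    let ?d = "inv\<^bsub>K\<^esub> c"
    have d: "?d \<in> carrier K" "?d \<otimes>\<^bsub>K\<^esub> c = \<one>\<^bsub>K\<^esub>" using c c0 K.field_Units by (auto simp: K.Units_l_inv)
    have "(\<ominus>\<^bsub>K\<^esub> ?d) \<odot>\<^bsub>V\<^esub> (v \<ominus>\<^bsub>V\<^esub> c \<odot>\<^bsub>V\<^esub> u) = u \<ominus>\<^bsub>V\<^esub> ?d \<odot>\<^bsub>V\<^esub> v"
    proof -
      have "(\<ominus>\<^bsub>K\<^esub> ?d) \<odot>\<^bsub>V\<^esub> (v \<ominus>\<^bsub>V\<^esub> c \<odot>\<^bsub>V\<^esub> u) = \<ominus>\<^bsub>V\<^esub> (?d \<odot>\<^bsub>V\<^esub> v \<ominus>\<^bsub>V\<^esub> (?d \<otimes>\<^bsub>K\<^esub> c) \<odot>\<^bsub>V\<^esub> u)"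
        using c(1) d(1) u v by (subst V.smult_l_minus) (simp_all add: V.smult_r_diff V.smult_assoc1)
      then show ?thesis using d u v by (simp add: a_minus_def V.M.minus_add V.M.a_comm)
    qed
    then show ?thesis using Us[OF _ c(2), of "\<ominus>\<^bsub>K\<^esub> ?d"] d by (intro bexI[of _ ?d]) auto
  qed
  have uniq: "c = d" if cd: "u \<in> carrier V" "c \<in> carrier K" "d \<in> carrier K"
    "u \<ominus>\<^bsub>V\<^esub> c \<odot>\<^bsub>V\<^esub> v \<in> U" "u \<ominus>\<^bsub>V\<^esub> d \<odot>\<^bsub>V\<^esub> v \<in> U" for u c d
  proof (rule ccontr)
    assume "c \<noteq> d"
    let ?e = "d \<ominus>\<^bsub>K\<^esub> c"
    have e: "?e \<in> carrier K" "?e \<noteq> \<zero>\<^bsub>K\<^esub>"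
    proof -
      have "?e \<oplus>\<^bsub>K\<^esub> c = d" using cd by (simp add: a_minus_def K.a_assoc K.l_neg)
      then show "?e \<noteq> \<zero>\<^bsub>K\<^esub>" using \<open>c \<noteq> d\<close> cd by auto
    qed (use cd in simp)
    have "?e \<odot>\<^bsub>V\<^esub> v = (u \<ominus>\<^bsub>V\<^esub> c \<odot>\<^bsub>V\<^esub> v) \<ominus>\<^bsub>V\<^esub> (u \<ominus>\<^bsub>V\<^esub> d \<odot>\<^bsub>V\<^esub> v)"
    proof -
      let ?x = "c \<odot>\<^bsub>V\<^esub> v" and ?y = "d \<odot>\<^bsub>V\<^esub> v"
      have xy: "?x \<in> carrier V" "?y \<in> carrier V" using cd v by auto
      have "(u \<ominus>\<^bsub>V\<^esub> ?x) \<ominus>\<^bsub>V\<^esub> (u \<ominus>\<^bsub>V\<^esub> ?y) = (u \<ominus>\<^bsub>V\<^esub> u) \<oplus>\<^bsub>V\<^esub> (?y \<ominus>\<^bsub>V\<^esub> ?x)"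
        using xy cd(1) by (simp add: a_minus_def V.M.minus_add V.M.a_ac)
      then show ?thesis using xy cd v by (simp add: V.smult_l_diff V.diff_eq_zero_iff)
    qed
    then have "?e \<odot>\<^bsub>V\<^esub> v \<in> U" using V.submodule_diff[OF U(1) cd(4,5)] by simp
    moreover have eU: "?e \<in> Units K" using e unfolding K.field_Units by blast
    ultimately have "inv\<^bsub>K\<^esub> ?e \<odot>\<^bsub>V\<^esub> (?e \<odot>\<^bsub>V\<^esub> v) \<in> U"
      using Us[OF K.Units_inv_closed[OF eU]] by blast
    moreover have "inv\<^bsub>K\<^esub> ?e \<odot>\<^bsub>V\<^esub> (?e \<odot>\<^bsub>V\<^esub> v) = v"
      using V.smult_assoc1[OF K.Units_inv_closed[OF eU] e(1) v(1)] K.Units_l_inv[OF eU] v(1) by simp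
    ultimately show False using U(3) by simp
  qed
  define F where "F u = (THE c. c \<in> carrier K \<and> u \<ominus>\<^bsub>V\<^esub> c \<odot>\<^bsub>V\<^esub> v \<in> U)" for u
  have F: "F u = c" if "u \<in> carrier V" "c \<in> carrier K" "u \<ominus>\<^bsub>V\<^esub> c \<odot>\<^bsub>V\<^esub> v \<in> U" for u c
    unfolding F_def using that uniq by (intro the_equality) auto
  have Fc: "F u \<in> carrier K \<and> u \<ominus>\<^bsub>V\<^esub> F u \<odot>\<^bsub>V\<^esub> v \<in> U" if "u \<in> carrier V" for u
    using ex[OF that] F[OF that] by auto
  show ?thesis
  proof
    show "F x \<in> carrier K" if "x \<in> carrier V" for x using Fc[OF that] by blast
    show "F w = \<zero>\<^bsub>K\<^esub>" if "w \<in> W" for w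
      using that U(2) v by (intro F) (auto simp: Uc V.diff_zero subset_iff)
    show "F v = \<one>\<^bsub>K\<^esub>" using v U0 V.diff_eq_zero_iff[of v v] by (intro F) simp_all
    show "F (x \<oplus>\<^bsub>V\<^esub> y) = F x \<oplus>\<^bsub>K\<^esub> F y" if xy: "x \<in> carrier V" "y \<in> carrier V" for x y
    proof (rule F)
      have "(x \<oplus>\<^bsub>V\<^esub> y) \<ominus>\<^bsub>V\<^esub> (F x \<oplus>\<^bsub>K\<^esub> F y) \<odot>\<^bsub>V\<^esub> v = (x \<ominus>\<^bsub>V\<^esub> F x \<odot>\<^bsub>V\<^esub> v) \<oplus>\<^bsub>V\<^esub> (y \<ominus>\<^bsub>V\<^esub> F y \<odot>\<^bsub>V\<^esub> v)"
        using xy Fc v by (simp add: a_minus_def V.smult_l_distr V.M.minus_add V.M.a_ac)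
      then show "(x \<oplus>\<^bsub>V\<^esub> y) \<ominus>\<^bsub>V\<^esub> (F x \<oplus>\<^bsub>K\<^esub> F y) \<odot>\<^bsub>V\<^esub> v \<in> U" using Ua Fc xy by auto
    qed (use xy Fc in auto)
    show "F (c \<odot>\<^bsub>V\<^esub> x) = c \<otimes>\<^bsub>K\<^esub> F x" if cx: "c \<in> carrier K" "x \<in> carrier V" for c x
    proof (rule F)
      have "c \<odot>\<^bsub>V\<^esub> x \<ominus>\<^bsub>V\<^esub> (c \<otimes>\<^bsub>K\<^esub> F x) \<odot>\<^bsub>V\<^esub> v = c \<odot>\<^bsub>V\<^esub> (x \<ominus>\<^bsub>V\<^esub> F x \<odot>\<^bsub>V\<^esub> v)"
        using cx Fc v by (simp add: V.smult_r_diff V.smult_assoc1)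
      then show "c \<odot>\<^bsub>V\<^esub> x \<ominus>\<^bsub>V\<^esub> (c \<otimes>\<^bsub>K\<^esub> F x) \<odot>\<^bsub>V\<^esub> v \<in> U" using Us Fc cx by auto
    qed (use cx Fc in auto)
  qed
qed



section \<open>Quotient modules on sets of representatives\<close>

text \<open>The module structure on \<open>q ` carrier M\<close> for which \<open>q\<close> is a homomorphism, if there is one. It makes
  it possible to form quotients and copies of modules inside a prescribed type: a quotient
  of an object of the module category lives on a set of representatives, in the same type.\<close>
definition image_module :: "('a, 'b) module \<Rightarrow> ('b \<Rightarrow> 'c) \<Rightarrow> ('a, 'c) module"
  where "image_module M q = \<lparr>
    carrier = q ` carrier M,
    mult = undefined,
    one = undefined,
    zero = q \<zero>\<^bsub>M\<^esub>,
    add = \<lambda>x y. q (inv_into (carrier M) q x \<oplus>\<^bsub>M\<^esub> inv_into (carrier M) q y),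
    smult = \<lambda>a x. q (a \<odot>\<^bsub>M\<^esub> inv_into (carrier M) q x)\<rparr>"

text \<open>The fibres of \<open>q\<close> are the cosets of \<open>N\<close>; then \<open>image_module M q\<close> is a copy of \<open>M/N\<close>.\<close>
locale module_quotient_map = left_module R M for R :: "('a, 'e) ring_scheme" and M :: "('a, 'b) module" (structure) +
  fixes N :: "'b set" and q :: "'b \<Rightarrow> 'd"
  assumes submod: "submodule N R M"
    and q_eq_iff: "x \<in> carrier M \<Longrightarrow> y \<in> carrier M \<Longrightarrow> q x = q y \<longleftrightarrow> x \<ominus> y \<in> N"
begin

abbreviation "MN \<equiv> image_module M q"

lemma carrier_image: "carrier MN = q ` carrier M"
  by (simp add: image_module_def)

lemma q_closed [simp, intro]: "x \<in> carrier M \<Longrightarrow> q x \<in> carrier MN"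
  by (simp add: carrier_image)

lemma q_zero: "q \<zero> = \<zero>\<^bsub>MN\<^esub>"
  by (simp add: image_module_def)

lemma q_inv: "x \<in> carrier M \<Longrightarrow> inv_into (carrier M) q (q x) \<in> carrier M \<and>
    inv_into (carrier M) q (q x) \<ominus> x \<in> N"
  by (metis f_inv_into_f imageI inv_into_into q_eq_iff)

lemma q_add:
  assumes "x \<in> carrier M" "y \<in> carrier M" shows "q (x \<oplus> y) = q x \<oplus>\<^bsub>MN\<^esub> q y"
proof -
  let ?x = "inv_into (carrier M) q (q x)" and ?y = "inv_into (carrier M) q (q y)"
  have *: "?x \<in> carrier M" "?y \<in> carrier M" "?x \<ominus> x \<in> N" "?y \<ominus> y \<in> N" using q_inv assms by auto
  have "(?x \<oplus> ?y) \<ominus> (x \<oplus> y) = (?x \<ominus> x) \<oplus> (?y \<ominus> y)"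
    using * assms by (simp add: a_minus_def M.minus_add M.a_ac)
  also have "\<dots> \<in> N" using * submod by (auto simp: submodule_iff)
  finally have "q (?x \<oplus> ?y) = q (x \<oplus> y)" using q_eq_iff * assms by simp
  then show ?thesis by (simp add: image_module_def)
qed

lemma q_smult:
  assumes "a \<in> carrier R" "x \<in> carrier M" shows "q (a \<odot> x) = a \<odot>\<^bsub>MN\<^esub> q x"
proof -
  let ?x = "inv_into (carrier M) q (q x)"
  have *: "?x \<in> carrier M" "?x \<ominus> x \<in> N" using q_inv assms by auto
  have "a \<odot> ?x \<ominus> a \<odot> x = a \<odot> (?x \<ominus> x)" using * assms by (simp add: smult_r_diff)
  also have "\<dots> \<in> N" using * submod assms by (auto simp: submodule_iff)
  finally have "q (a \<odot> ?x) = q (a \<odot> x)" using q_eq_iff * assms by simp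
  then show ?thesis by (simp add: image_module_def)
qed

lemma image_elim:
  assumes "y \<in> carrier MN" obtains x where "x \<in> carrier M" "y = q x"
  using assms by (auto simp: carrier_image)

lemma left_module_image: "left_module R MN"
proof (rule left_moduleI)
  show "ring R" by (rule R.ring_axioms)
  show "abelian_group MN"
  proof (rule abelian_groupI)
    fix x assume "x \<in> carrier MN"
    then obtain u where "u \<in> carrier M" "x = q u" by (rule image_elim)
    then show "\<exists>y\<in>carrier MN. y \<oplus>\<^bsub>MN\<^esub> x = \<zero>\<^bsub>MN\<^esub>"
      by (intro bexI[of _ "q (\<ominus> u)"]) (auto simp: q_add[symmetric] q_zero M.l_neg)
  qed (auto elim!: image_elim simp: q_add[symmetric] q_zero[symmetric] M.a_ac)
qed (auto elim!: image_elim simp: q_add[symmetric] q_smult[symmetric] smult_l_distr smult_r_distr smult_assoc1)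

lemma quotient_hom: "restrict q (carrier M) \<in> module_hom R M MN"
  by (rule module_homI) (auto simp: q_add q_smult left_module_axioms)

lemma quotient_hom_surj: "restrict q (carrier M) ` carrier M = carrier MN"
  by (auto simp: carrier_image)

lemma q_eq_zero_iff:
  assumes "x \<in> carrier M" shows "q x = \<zero>\<^bsub>MN\<^esub> \<longleftrightarrow> x \<in> N"
proof -
  show ?thesis using assms by (simp add: q_zero[symmetric] q_eq_iff diff_zero)
qed

lemma fin_gen_quotient: "fin_gen R M \<Longrightarrow> fin_gen R MN"
  by (rule fin_gen_image[OF left_module_axioms left_module_image quotient_hom quotient_hom_surj])

end

lemma module_quotient_map_inj:
  assumes "left_module R M" "inj_on q (carrier M)"
  shows "module_quotient_map R M {\<zero>\<^bsub>M\<^esub>} q"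
proof -
  interpret left_module R M by fact
  show ?thesis
  proof (intro module_quotient_map.intro module_quotient_map_axioms.intro assms(1))
    show "submodule {\<zero>\<^bsub>M\<^esub>} R M" by (rule submodule_zero)
    show "q x = q y \<longleftrightarrow> x \<ominus>\<^bsub>M\<^esub> y \<in> {\<zero>\<^bsub>M\<^esub>}" if "x \<in> carrier M" "y \<in> carrier M" for x y
      using assms that by (simp add: diff_eq_zero_iff inj_on_eq_iff)
  qed
qed

text \<open>A representative of the coset of \<open>x\<close>, the same for all elements of the coset.\<close>
definition coset_rep :: "('b, 'c) ring_scheme \<Rightarrow> 'b set \<Rightarrow> 'b \<Rightarrow> 'b"
  where "coset_rep M N x = (SOME y. y \<in> carrier M \<and> x \<ominus>\<^bsub>M\<^esub> y \<in> N)"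

lemma (in left_module) coset_rep:
  assumes "submodule N R M" "x \<in> carrier M"
  shows "coset_rep M N x \<in> carrier M \<and> x \<ominus>\<^bsub>M\<^esub> coset_rep M N x \<in> N"
  unfolding coset_rep_def using assms
  by (intro someI_ex[of "\<lambda>y. y \<in> carrier M \<and> x \<ominus>\<^bsub>M\<^esub> y \<in> N"] exI[of _ x])
    (auto simp: a_minus_def M.r_neg submodule_iff)

lemma (in left_module) diff_diff:
  assumes "x \<in> carrier M" "y \<in> carrier M" "z \<in> carrier M"
  shows "(x \<ominus>\<^bsub>M\<^esub> z) \<ominus>\<^bsub>M\<^esub> (y \<ominus>\<^bsub>M\<^esub> z) = x \<ominus>\<^bsub>M\<^esub> y"
proof -
  have "(x \<ominus>\<^bsub>M\<^esub> z) \<ominus>\<^bsub>M\<^esub> (y \<ominus>\<^bsub>M\<^esub> z) = (x \<ominus>\<^bsub>M\<^esub> y) \<oplus>\<^bsub>M\<^esub> (z \<ominus>\<^bsub>M\<^esub> z)"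
    using assms by (simp add: a_minus_def M.minus_add M.a_ac)
  then show ?thesis using assms by (simp add: diff_eq_zero_iff)
qed

lemma (in left_module) minus_diff:
  assumes "x \<in> carrier M" "y \<in> carrier M"
  shows "\<zero>\<^bsub>M\<^esub> \<ominus>\<^bsub>M\<^esub> (x \<ominus>\<^bsub>M\<^esub> y) = y \<ominus>\<^bsub>M\<^esub> x"
  using assms by (simp add: a_minus_def M.minus_add M.a_ac)

lemma (in left_module) submodule_diff_sym:
  assumes N: "submodule N R M" and "u \<in> carrier M" "w \<in> carrier M" "w \<ominus>\<^bsub>M\<^esub> u \<in> N"
  shows "u \<ominus>\<^bsub>M\<^esub> w \<in> N"
  using submodule_diff[OF N _ assms(4), of "\<zero>\<^bsub>M\<^esub>"] assms by (simp add: minus_diff submodule_iff)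

lemma (in left_module) submodule_diff_trans:
  assumes N: "submodule N R M" and "u \<in> carrier M" "w \<in> carrier M" "z \<in> carrier M"
    and "u \<ominus>\<^bsub>M\<^esub> w \<in> N" "w \<ominus>\<^bsub>M\<^esub> z \<in> N"
  shows "u \<ominus>\<^bsub>M\<^esub> z \<in> N"
  using submodule_diff[OF N assms(5) submodule_diff_sym[OF N assms(4,3,6)]] diff_diff[of u z w] assms by simp

lemma module_quotient_map_coset_rep:
  assumes M: "left_module R M" and N: "submodule N R M"
  shows "module_quotient_map R M N (coset_rep M N)"
proof -
  interpret left_module R M by fact
  show ?thesis
  proof (intro module_quotient_map.intro module_quotient_map_axioms.intro)
    fix x y assume xy: "x \<in> carrier M" "y \<in> carrier M"
    note sym = submodule_diff_sym[OF N] and trans = submodule_diff_trans[OF N]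
    let ?r = "coset_rep M N"
    show "?r x = ?r y \<longleftrightarrow> x \<ominus>\<^bsub>M\<^esub> y \<in> N"
    proof
      assume "?r x = ?r y"
      then show "x \<ominus>\<^bsub>M\<^esub> y \<in> N"
        using trans[of x "?r x" y] sym[of "?r x" y] coset_rep[OF N] xy by metis
    next
      assume "x \<ominus>\<^bsub>M\<^esub> y \<in> N"
      then have "(\<lambda>z. z \<in> carrier M \<and> x \<ominus>\<^bsub>M\<^esub> z \<in> N) = (\<lambda>z. z \<in> carrier M \<and> y \<ominus>\<^bsub>M\<^esub> z \<in> N)"
        using trans sym xy by blast
      then show "?r x = ?r y" by (simp add: coset_rep_def)
    qed
  qed (rule M, rule N)
qed

section \<open>Dual bases of projective modules\<close>

lemma regular_module_simps [simp]:
  "carrier (regular_module A) = carrier A"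
  "ring.zero (regular_module A) = ring.zero A"
  "ring.add (regular_module A) = ring.add A"
  "smult (regular_module A) = monoid.mult A"
  by (simp_all add: regular_module_def)

lemma left_module_regular:
  assumes "ring A" shows "left_module A (regular_module A)"
proof -
  interpret ring A by fact
  show ?thesis
  proof (rule left_moduleI)
    show "abelian_group (regular_module A)"
      using abelian_groupE[OF is_abelian_group] by (intro abelian_groupI) simp_all
  qed (auto simp: l_distr r_distr m_assoc assms)
qed

text \<open>The left module \<open>A\<^sup>n\<close>; its elements are extensional functions on \<open>{..<n}\<close>.\<close>
definition free_module :: "('a, 'c) ring_scheme \<Rightarrow> nat \<Rightarrow> ('a, nat \<Rightarrow> 'a) module"
  where "free_module A n = \<lparr>
    carrier = {..<n} \<rightarrow>\<^sub>E carrier A,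
    mult = undefined,
    one = undefined,
    zero = \<lambda>i\<in>{..<n}. \<zero>\<^bsub>A\<^esub>,
    add = \<lambda>x y. \<lambda>i\<in>{..<n}. x i \<oplus>\<^bsub>A\<^esub> y i,
    smult = \<lambda>a x. \<lambda>i\<in>{..<n}. a \<otimes>\<^bsub>A\<^esub> x i\<rparr>"

lemma free_module_simps:
  "x \<in> carrier (free_module A n) \<longleftrightarrow> (\<forall>i<n. x i \<in> carrier A) \<and> x \<in> extensional {..<n}"
  "i < n \<Longrightarrow> \<zero>\<^bsub>free_module A n\<^esub> i = \<zero>\<^bsub>A\<^esub>"
  "i < n \<Longrightarrow> (x \<oplus>\<^bsub>free_module A n\<^esub> y) i = x i \<oplus>\<^bsub>A\<^esub> y i"
  "i < n \<Longrightarrow> (a \<odot>\<^bsub>free_module A n\<^esub> x) i = a \<otimes>\<^bsub>A\<^esub> x i"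
  "\<zero>\<^bsub>free_module A n\<^esub> \<in> extensional {..<n}"
  "x \<oplus>\<^bsub>free_module A n\<^esub> y \<in> extensional {..<n}"
  "a \<odot>\<^bsub>free_module A n\<^esub> x \<in> extensional {..<n}"
  by (auto simp: free_module_def PiE_iff)

lemma left_module_free:
  assumes "ring A" shows "left_module A (free_module A n)"
proof -
  interpret ring A by fact
  let ?F = "free_module A n"
  have eqI: "x = y" if "x \<in> extensional {..<n}" "y \<in> extensional {..<n}" "\<And>i. i < n \<Longrightarrow> x i = y i"
    for x y :: "nat \<Rightarrow> 'a"
    using that by (intro extensionalityI) auto
  show ?thesis
  proof (rule left_moduleI)
    show "abelian_group ?F"
    proof (rule abelian_groupI)
      fix x assume x: "x \<in> carrier ?F"
      let ?y = "\<lambda>i\<in>{..<n}. \<ominus>\<^bsub>A\<^esub> x i"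
      have "?y \<in> carrier ?F" using x by (simp add: free_module_simps(1))
      moreover have "?y \<oplus>\<^bsub>?F\<^esub> x = \<zero>\<^bsub>?F\<^esub>"
        using x by (intro eqI) (simp_all add: free_module_simps l_neg)
      ultimately show "\<exists>y\<in>carrier ?F. y \<oplus>\<^bsub>?F\<^esub> x = \<zero>\<^bsub>?F\<^esub>" by blast
    next
      fix x y z assume "x \<in> carrier ?F" "y \<in> carrier ?F" "z \<in> carrier ?F"
      then show "x \<oplus>\<^bsub>?F\<^esub> y \<oplus>\<^bsub>?F\<^esub> z = x \<oplus>\<^bsub>?F\<^esub> (y \<oplus>\<^bsub>?F\<^esub> z)"
        by (intro eqI) (simp_all add: free_module_simps a_assoc)
    next
      fix x y assume "x \<in> carrier ?F" "y \<in> carrier ?F"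
      then show "x \<oplus>\<^bsub>?F\<^esub> y = y \<oplus>\<^bsub>?F\<^esub> x"
        by (intro eqI) (simp_all add: free_module_simps a_comm)
    next
      fix x assume "x \<in> carrier ?F"
      then show "\<zero>\<^bsub>?F\<^esub> \<oplus>\<^bsub>?F\<^esub> x = x"
        by (intro eqI) (simp_all add: free_module_simps)
    qed (simp_all add: free_module_simps)
  next
    fix a b x assume "a \<in> carrier A" "b \<in> carrier A" "x \<in> carrier ?F"
    then show "(a \<oplus>\<^bsub>A\<^esub> b) \<odot>\<^bsub>?F\<^esub> x = a \<odot>\<^bsub>?F\<^esub> x \<oplus>\<^bsub>?F\<^esub> b \<odot>\<^bsub>?F\<^esub> x"
      "(a \<otimes>\<^bsub>A\<^esub> b) \<odot>\<^bsub>?F\<^esub> x = a \<odot>\<^bsub>?F\<^esub> (b \<odot>\<^bsub>?F\<^esub> x)"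
      by (intro eqI; simp add: free_module_simps l_distr m_assoc)+
  next
    fix a x y assume "a \<in> carrier A" "x \<in> carrier ?F" "y \<in> carrier ?F"
    then show "a \<odot>\<^bsub>?F\<^esub> (x \<oplus>\<^bsub>?F\<^esub> y) = a \<odot>\<^bsub>?F\<^esub> x \<oplus>\<^bsub>?F\<^esub> a \<odot>\<^bsub>?F\<^esub> y"
      by (intro eqI) (simp_all add: free_module_simps r_distr)
  next
    fix x assume "x \<in> carrier ?F"
    then show "\<one>\<^bsub>A\<^esub> \<odot>\<^bsub>?F\<^esub> x = x" by (intro eqI) (simp_all add: free_module_simps)
  qed (simp_all add: free_module_simps assms)
qed

lemma fin_gen_free:
  assumes "ring A" shows "fin_gen A (free_module A n)"
proof -
  interpret ring A by fact
  let ?F = "free_module A n"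
  interpret F: left_module A ?F using left_module_free[OF assms] .
  define u where "u k = (\<lambda>i\<in>{..<n}. if i = k then \<one>\<^bsub>A\<^esub> else \<zero>\<^bsub>A\<^esub>)" for k :: nat
  have "N = carrier ?F" if N: "submodule N A ?F" "u ` {..<n} \<subseteq> N" for N
  proof
    show "N \<subseteq> carrier ?F" using N by (simp add: F.submodule_iff)
    show "carrier ?F \<subseteq> N"
    proof
      fix x assume x: "x \<in> carrier ?F"
      have xi: "\<And>i. i < n \<Longrightarrow> x i \<in> carrier A" using x by (auto simp: free_module_def)
      have "(\<lambda>i\<in>{..<n}. if i < k then x i else \<zero>\<^bsub>A\<^esub>) \<in> N" if "k \<le> n" for k
        using that
      proof (induction k)
        case 0
        have "\<zero>\<^bsub>?F\<^esub> \<in> N" using N by (simp add: F.submodule_iff)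
        moreover have "\<zero>\<^bsub>?F\<^esub> = (\<lambda>i\<in>{..<n}. if i < 0 then x i else \<zero>\<^bsub>A\<^esub>)"
          by (simp add: free_module_def)
        ultimately show ?case by metis
      next
        case (Suc k)
        have 1: "(\<lambda>i\<in>{..<n}. if i < k then x i else \<zero>\<^bsub>A\<^esub>) \<in> N" using Suc(1)[OF Suc_leD[OF Suc(2)]] .
        have 2: "u k \<in> N" "x k \<in> carrier A"
          using N(2) xi Suc(2) by auto
        then have "(\<lambda>i\<in>{..<n}. if i < k then x i else \<zero>\<^bsub>A\<^esub>) \<oplus>\<^bsub>?F\<^esub> (x k \<odot>\<^bsub>?F\<^esub> u k) \<in> N"
          using N(1) 1 2 unfolding F.submodule_iff by blast
        moreover have "(\<lambda>i\<in>{..<n}. if i < k then x i else \<zero>\<^bsub>A\<^esub>) \<oplus>\<^bsub>?F\<^esub> (x k \<odot>\<^bsub>?F\<^esub> u k)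
            = (\<lambda>i\<in>{..<n}. if i < Suc k then x i else \<zero>\<^bsub>A\<^esub>)"
          using xi Suc(2) by (auto simp: free_module_def u_def fun_eq_iff less_Suc_eq)
        ultimately show ?case by (simp only:)
      qed
      from this[of n] have "(\<lambda>i\<in>{..<n}. if i < n then x i else \<zero>\<^bsub>A\<^esub>) \<in> N" by simp
      moreover have "(\<lambda>i\<in>{..<n}. if i < n then x i else \<zero>\<^bsub>A\<^esub>) = x"
        using x by (intro extensionalityI[of _ "{..<n}"]) (auto simp: free_module_simps(1))
      ultimately show "x \<in> N" by simp
    qed
  qed
  moreover have "u ` {..<n} \<subseteq> carrier ?F" by (auto simp: u_def free_module_simps(1))
  ultimately show ?thesis unfolding fin_gen_def by (intro exI[of _ "u ` {..<n}"]) auto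
qed

lemma free_module_to_hom:
  assumes M: "left_module A M" and p: "\<And>i. i < n \<Longrightarrow> p i \<in> carrier M"
  shows "(\<lambda>x\<in>carrier (free_module A n). finsum M (\<lambda>i. x i \<odot>\<^bsub>M\<^esub> p i) {..<n})
    \<in> module_hom A (free_module A n) M"
proof -
  interpret M: left_module A M by fact
  have x: "\<And>x i. x \<in> carrier (free_module A n) \<Longrightarrow> i < n \<Longrightarrow> x i \<in> carrier A"
    by (auto simp: free_module_def)
  have c: "\<And>x. x \<in> carrier (free_module A n) \<Longrightarrow> (\<lambda>i. x i \<odot>\<^bsub>M\<^esub> p i) \<in> {..<n} \<rightarrow> carrier M"
    using x p by auto
  show ?thesis
  proof (rule module_homI)
    fix x assume "x \<in> carrier (free_module A n)"
    then show "finsum M (\<lambda>i. x i \<odot>\<^bsub>M\<^esub> p i) {..<n} \<in> carrier M"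
      using c by (intro M.M.finsum_closed) auto
  next
    fix x y assume xy: "x \<in> carrier (free_module A n)" "y \<in> carrier (free_module A n)"
    have "finsum M (\<lambda>i. (x \<oplus>\<^bsub>free_module A n\<^esub> y) i \<odot>\<^bsub>M\<^esub> p i) {..<n}
        = finsum M (\<lambda>i. x i \<odot>\<^bsub>M\<^esub> p i \<oplus>\<^bsub>M\<^esub> y i \<odot>\<^bsub>M\<^esub> p i) {..<n}"
      using x xy p by (intro M.M.finsum_cong') (auto simp: free_module_def M.smult_l_distr)
    also have "\<dots> = finsum M (\<lambda>i. x i \<odot>\<^bsub>M\<^esub> p i) {..<n} \<oplus>\<^bsub>M\<^esub> finsum M (\<lambda>i. y i \<odot>\<^bsub>M\<^esub> p i) {..<n}"
      using xy c by (intro M.M.finsum_addf) auto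
    finally show "finsum M (\<lambda>i. (x \<oplus>\<^bsub>free_module A n\<^esub> y) i \<odot>\<^bsub>M\<^esub> p i) {..<n} = \<dots>" .
  next
    fix a x assume ax: "a \<in> carrier A" "x \<in> carrier (free_module A n)"
    have "finsum M (\<lambda>i. (a \<odot>\<^bsub>free_module A n\<^esub> x) i \<odot>\<^bsub>M\<^esub> p i) {..<n}
        = finsum M (\<lambda>i. a \<odot>\<^bsub>M\<^esub> (x i \<odot>\<^bsub>M\<^esub> p i)) {..<n}"
      using x ax p by (intro M.M.finsum_cong') (auto simp: free_module_def M.smult_assoc1)
    also have "\<dots> = a \<odot>\<^bsub>M\<^esub> finsum M (\<lambda>i. x i \<odot>\<^bsub>M\<^esub> p i) {..<n}"
      using ax c by (simp add: M.finsum_smult)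
    finally show "finsum M (\<lambda>i. (a \<odot>\<^bsub>free_module A n\<^esub> x) i \<odot>\<^bsub>M\<^esub> p i) {..<n} = \<dots>" .
  qed (rule left_module_free[OF left_module_ring[OF M]])
qed

text \<open>Elements \<open>p\<^sub>i\<close> of \<open>P\<close> and \<open>\<phi>\<^sub>i\<close> of \<open>Hom\<^sub>A(P, A)\<close> with \<open>x = \<Sum> \<phi>\<^sub>i(x) p\<^sub>i\<close> for all \<open>x\<close> in \<open>P\<close>.\<close>
definition dual_basis ::
    "('a, 'c) ring_scheme \<Rightarrow> ('a, 'b) module \<Rightarrow> nat \<Rightarrow> (nat \<Rightarrow> 'b) \<Rightarrow> (nat \<Rightarrow> 'b \<Rightarrow> 'a) \<Rightarrow> bool"
  where "dual_basis A P n p \<phi> \<longleftrightarrow>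
    (\<forall>i<n. p i \<in> carrier P \<and> \<phi> i \<in> module_hom A P (regular_module A)) \<and>
    (\<forall>x\<in>carrier P. finsum P (\<lambda>i. \<phi> i x \<odot>\<^bsub>P\<^esub> p i) {..<n} = x)"

text \<open>Projectivity is only a lifting property against modules with elements in the type
  \<^typ>\<open>nat \<Rightarrow> 'k\<close>. The injection \<open>\<iota>\<close> makes it applicable to a surjection \<open>A\<^sup>n \<rightarrow> P\<close>.\<close>
lemma dual_basis_exists:
  fixes P :: "('a, 'k) fmod" and \<iota> :: "'a \<Rightarrow> nat \<Rightarrow> 'k"
  assumes \<iota>: "inj_on \<iota> (carrier A)" and proj: "projective A P"
  shows "\<exists>n p \<phi>. dual_basis A P n p \<phi>"
proof -
  have P: "left_module A P" "fin_gen A P" using proj by (auto simp: projective_def mod_cat_def)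
  have A: "ring A" by (rule left_module_ring[OF P(1)])
  interpret P: left_module A P by (rule P)
  obtain S where S: "finite S" "S \<subseteq> carrier P" "\<And>X. submodule X A P \<Longrightarrow> S \<subseteq> X \<Longrightarrow> X = carrier P"
    using P(2) by (auto simp: fin_gen_def)
  obtain n p where pS: "S = p ` {i::nat. i < n}" using finite_imp_nat_seg_image_inj_on[OF S(1)] by blast
  have p: "\<And>i. i < n \<Longrightarrow> p i \<in> carrier P" using S(2) pS by auto
  let ?F = "free_module A n"
  define e where "e = (\<lambda>x\<in>carrier ?F. finsum P (\<lambda>i. x i \<odot>\<^bsub>P\<^esub> p i) {..<n})"
  have e: "e \<in> module_hom A ?F P" unfolding e_def using free_module_to_hom[OF P(1) p] .
  note F = left_module_free[OF A, of n]
  interpret F: left_module A ?F by (rule F)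
  have "e ` carrier ?F = carrier P"
  proof (rule S(3))
    show "submodule (e ` carrier ?F) A P"
      by (rule hom_image_submodule[OF F P(1) e F.submodule_carrier])
    show "S \<subseteq> e ` carrier ?F"
    proof
      fix s assume "s \<in> S"
      then obtain k where k: "k < n" "s = p k" using pS by auto
      let ?u = "\<lambda>i\<in>{..<n}. if i = k then \<one>\<^bsub>A\<^esub> else \<zero>\<^bsub>A\<^esub>"
      have u: "?u \<in> carrier ?F" by (auto simp: free_module_def)
      have "e ?u = finsum P (\<lambda>i. if k = i then p i else \<zero>\<^bsub>P\<^esub>) {..<n}"
        using u p by (simp add: e_def) (intro P.M.finsum_cong', auto)
      also have "\<dots> = p k" using k p by (intro P.M.finsum_singleton) auto
      finally show "s \<in> e ` carrier ?F" using u k by (metis imageI)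
    qed
  qed
  note esurj = this
  \<comment> \<open>A copy of the free module among the objects of the module category.\<close>
  define j where "j x = (\<lambda>m. \<iota> (x (fst (prod_decode m))) (snd (prod_decode m)))" for x :: "nat \<Rightarrow> 'a"
  have j: "inj_on j (carrier ?F)"
  proof (rule inj_onI)
    fix x y assume xy: "x \<in> carrier ?F" "y \<in> carrier ?F" "j x = j y"
    have "x i = y i" if "i < n" for i
    proof -
      have "\<iota> (x i) l = \<iota> (y i) l" for l using fun_cong[OF xy(3), of "prod_encode (i, l)"] by (simp add: j_def)
      then have "\<iota> (x i) = \<iota> (y i)" by (rule ext)
      then show ?thesis using xy(1,2) that by (auto simp: free_module_simps(1) intro: inj_onD[OF \<iota>])
    qed
    then show "x = y" using xy(1,2) by (intro extensionalityI[of _ "{..<n}"]) (auto simp: free_module_simps(1))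
  qed
  interpret q: module_quotient_map A ?F "{\<zero>\<^bsub>?F\<^esub>}" j by (rule module_quotient_map_inj[OF F j])
  let ?F' = "image_module ?F j"
  let ?j = "restrict j (carrier ?F)"
  have bij: "bij_betw ?j (carrier ?F) (carrier ?F')"
    using j by (auto simp: bij_betw_def inj_on_def q.carrier_image)
  define i where "i = restrict (inv_into (carrier ?F) ?j) (carrier ?F')"
  have i: "i \<in> module_hom A ?F' ?F"
    unfolding i_def by (rule bij_hom_inv[OF F q.left_module_image q.quotient_hom bij])
  have F'cat: "?F' \<in> mod_cat A"
    using q.left_module_image q.fin_gen_quotient[OF fin_gen_free[OF A]] by (simp add: mod_cat_def)
  have i_surj: "i ` carrier ?F' = carrier ?F"
    using bij_betw_inv_into[OF bij] by (auto simp: i_def bij_betw_def image_def)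
  let ?e = "compose (carrier ?F') e i"
  have e': "?e \<in> module_hom A ?F' P" by (rule hom_comp[OF i e q.left_module_image])
  have e'_surj: "?e ` carrier ?F' = carrier P"
  proof -
    have "?e ` carrier ?F' = e ` i ` carrier ?F'" by (auto simp: compose_def image_def)
    then show ?thesis using i_surj esurj by simp
  qed
  have id: "restrict (\<lambda>x. x) (carrier P) \<in> module_hom A P P" by (rule module_homI) (auto simp: P)
  obtain s where s: "s \<in> module_hom A P ?F'" "compose (carrier P) ?e s = restrict (\<lambda>x. x) (carrier P)"
    using proj F'cat e' e'_surj id unfolding projective_def by blast
  define \<phi> where "\<phi> k = (\<lambda>x\<in>carrier P. i (s x) k)" for k
  have is': "compose (carrier P) i s \<in> module_hom A P ?F" by (rule hom_comp[OF s(1) i P(1)])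
  have "dual_basis A P n p \<phi>" unfolding dual_basis_def
  proof (intro conjI allI impI ballI)
    fix k assume k: "k < n"
    show "p k \<in> carrier P" using p k .
    show "\<phi> k \<in> module_hom A P (regular_module A)" unfolding \<phi>_def
      by (intro module_homI)
        (use hom_closed[OF is'] hom_add[OF is'] hom_smult[OF is'] k P in \<open>auto simp: compose_def free_module_def\<close>)
  next
    fix x assume x: "x \<in> carrier P"
    have "e (i (s x)) = x" using fun_cong[OF s(2), of x] x hom_closed[OF s(1) x] by (simp add: compose_def)
    moreover have "e (i (s x)) = finsum P (\<lambda>k. i (s x) k \<odot>\<^bsub>P\<^esub> p k) {..<n}"
      using hom_closed[OF i hom_closed[OF s(1) x]] by (simp add: e_def)
    ultimately show "finsum P (\<lambda>k. \<phi> k x \<odot>\<^bsub>P\<^esub> p k) {..<n} = x" using x by (simp add: \<phi>_def)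
  qed
  then show ?thesis by blast
qed

section \<open>Quotients of modules and algebras by cosets\<close>

text \<open>The operations on cosets, in the form in which they are used both for submodules of a module
  and for ideals of an algebra.\<close>
locale module_with_submodule = left_module R M
  for R :: "('a, 'e) ring_scheme" and M :: "('a, 'b) module" (structure) +
  fixes N :: "'b set"
  assumes submod: "submodule N R M"
begin

abbreviation "Q \<equiv> M /\<^sub>m N"

lemma mem_coset_iff:
  assumes "x \<in> carrier M" shows "y \<in> N +> x \<longleftrightarrow> y \<in> carrier M \<and> y \<ominus> x \<in> N"
proof
  assume "y \<in> N +> x"
  then obtain n where "n \<in> N" "y = n \<oplus> x" by (auto simp: a_r_coset_def')
  then show "y \<in> carrier M \<and> y \<ominus> x \<in> N"
    using assms submod by (auto simp: submodule_iff subset_iff add_diff_cancel)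
next
  assume y: "y \<in> carrier M \<and> y \<ominus> x \<in> N"
  then have "y = (y \<ominus> x) \<oplus> x" using assms by (simp add: diff_add_cancel)
  then show "y \<in> N +> x" using y by (auto simp: a_r_coset_def')
qed

lemma coset_self: "x \<in> carrier M \<Longrightarrow> x \<in> N +> x"
  using submod diff_eq_zero_iff[of x x] by (simp add: mem_coset_iff submodule_iff)

lemma coset_eq_iff:
  assumes "x \<in> carrier M" "y \<in> carrier M" shows "N +> x = N +> y \<longleftrightarrow> x \<ominus> y \<in> N"
proof
  assume "N +> x = N +> y"
  moreover have "x \<in> N +> x" using assms(1) by (rule coset_self)
  ultimately show "x \<ominus> y \<in> N" using assms by (simp add: mem_coset_iff)
next
  assume *: "x \<ominus> y \<in> N"
  show "N +> x = N +> y"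
  proof (rule Set.set_eqI)
    fix z
    show "z \<in> N +> x \<longleftrightarrow> z \<in> N +> y"
      using assms submodule_diff_trans[OF submod, of z x y] * submodule_diff_sym[OF submod, of y x]
        submodule_diff_trans[OF submod, of z y x] by (auto simp: mem_coset_iff)
  qed
qed

lemma carrier_quot: "carrier Q = (\<lambda>x. N +> x) ` carrier M"
  by (auto simp: quot_module_def FactRing_def A_RCOSETS_def')

lemma coset_closed [simp, intro]: "x \<in> carrier M \<Longrightarrow> N +> x \<in> carrier Q"
  by (simp add: carrier_quot)

lemma quot_elim:
  assumes "X \<in> carrier Q" obtains x where "x \<in> carrier M" "X = N +> x"
  using assms by (auto simp: carrier_quot)

lemma quot_zero: "\<zero>\<^bsub>Q\<^esub> = N"
  by (simp add: quot_module_def FactRing_def)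

lemma coset_zero: "N +> \<zero> = N"
  using submod by (simp add: submodule_iff)

lemma coset_eq_self_iff: "x \<in> carrier M \<Longrightarrow> N +> x = N \<longleftrightarrow> x \<in> N"
  using coset_eq_iff[of x \<zero>] coset_zero by (simp add: diff_zero)

lemma quot_add:
  assumes "x \<in> carrier M" "y \<in> carrier M" shows "(N +> x) \<oplus>\<^bsub>Q\<^esub> (N +> y) = N +> (x \<oplus> y)"
proof -
  interpret S: submodule N R M by (rule submod)
  have "abelian_subgroup N M"
    by (rule abelian_subgroupI3) (auto intro: additive_subgroup.intro S.subgroup_axioms M.abelian_group_axioms)
  then show ?thesis
    using abelian_subgroup.a_rcos_sum[of N M x y] assms by (simp add: quot_module_def FactRing_def)
qed

lemma quot_smult:
  assumes "a \<in> carrier R" "x \<in> carrier M" shows "a \<odot>\<^bsub>Q\<^esub> (N +> x) = N +> (a \<odot> x)"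
proof -
  have "N +> (a \<odot> y) = N +> (a \<odot> x)" if "y \<in> N +> x" for y
  proof -
    have y: "y \<in> carrier M" "y \<ominus> x \<in> N" using that assms by (auto simp: mem_coset_iff)
    then have "a \<odot> (y \<ominus> x) \<in> N" using submod assms by (auto simp: submodule_iff)
    then show ?thesis using y assms by (simp add: coset_eq_iff smult_r_diff)
  qed
  moreover have "x \<in> N +> x" using assms(2) by (rule coset_self)
  ultimately have "(\<Union>y\<in>N +> x. N +> (a \<odot> y)) = N +> (a \<odot> x)" by blast
  then show ?thesis by (simp add: quot_module_def)
qed

end

section \<open>Groups of homomorphisms\<close>

text \<open>The underlying abelian group of \<open>G\<close> is \<open>Hom\<^sub>A(M, N)\<close> with pointwise addition. The other fields of
  the record are arbitrary, so that one treatment covers \<open>Hom\<^sub>A(M, N)\<close> as a \<open>K\<close>-space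
  and \<open>Hom\<^sub>A(P, A)\<close> as a right \<open>A\<close>-module.\<close>
definition is_hom_group ::
    "('a, 'c) ring_scheme \<Rightarrow> ('a, 'b) module \<Rightarrow> ('a, 'd) module \<Rightarrow> ('b \<Rightarrow> 'd, 'm) ring_scheme \<Rightarrow> bool"
  where "is_hom_group A M N G \<longleftrightarrow> carrier G = module_hom A M N \<and> \<zero>\<^bsub>G\<^esub> = zero_hom M N \<and>
    add G = (\<lambda>\<phi> \<psi>. \<lambda>x\<in>carrier M. \<phi> x \<oplus>\<^bsub>N\<^esub> \<psi> x)"

lemma zero_hom_in:
  assumes "left_module A M" "left_module A N" shows "zero_hom M N \<in> module_hom A M N"
proof -
  interpret N: left_module A N by fact
  show ?thesis unfolding zero_hom_def using assms(1) by (intro module_homI) auto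
qed

text \<open>The map \<open>s\<close> is for instance multiplication by a central element, or right
  multiplication on \<open>A\<close>.\<close>
lemma hom_pointwise:
  assumes "left_module A M" "\<phi> \<in> module_hom A M N"
    and "\<And>y. y \<in> carrier N \<Longrightarrow> s y \<in> carrier N'"
    and "\<And>y z. y \<in> carrier N \<Longrightarrow> z \<in> carrier N \<Longrightarrow> s (y \<oplus>\<^bsub>N\<^esub> z) = s y \<oplus>\<^bsub>N'\<^esub> s z"
    and "\<And>a y. a \<in> carrier A \<Longrightarrow> y \<in> carrier N \<Longrightarrow> s (a \<odot>\<^bsub>N\<^esub> y) = a \<odot>\<^bsub>N'\<^esub> s y"
  shows "(\<lambda>x\<in>carrier M. s (\<phi> x)) \<in> module_hom A M N'"
  using assms(1,3-5) hom_closed[OF assms(2)] hom_add[OF assms(2)] hom_smult[OF assms(2)]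
  by (intro module_homI) auto

lemma hom_add_in:
  assumes "left_module A M" "left_module A N" "\<phi> \<in> module_hom A M N" "\<psi> \<in> module_hom A M N"
  shows "(\<lambda>x\<in>carrier M. \<phi> x \<oplus>\<^bsub>N\<^esub> \<psi> x) \<in> module_hom A M N"
proof -
  interpret N: left_module A N by fact
  note c = hom_closed[OF assms(3)] hom_closed[OF assms(4)]
  show ?thesis
  proof (rule module_homI)
    fix x y assume xy: "x \<in> carrier M" "y \<in> carrier M"
    show "\<phi> (x \<oplus>\<^bsub>M\<^esub> y) \<oplus>\<^bsub>N\<^esub> \<psi> (x \<oplus>\<^bsub>M\<^esub> y) = \<phi> x \<oplus>\<^bsub>N\<^esub> \<psi> x \<oplus>\<^bsub>N\<^esub> (\<phi> y \<oplus>\<^bsub>N\<^esub> \<psi> y)"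
      using xy c by (simp add: hom_add[OF assms(3)] hom_add[OF assms(4)] N.M.a_ac)
  qed (use assms c in \<open>auto simp: hom_smult[OF assms(3)] hom_smult[OF assms(4)] N.smult_r_distr\<close>)
qed

lemma hom_group_abelian:
  assumes "left_module A M" "left_module A N" "is_hom_group A M N G"
  shows "abelian_group G"
proof -
  interpret M: left_module A M by fact
  interpret N: left_module A N by fact
  have G: "carrier G = module_hom A M N" "\<zero>\<^bsub>G\<^esub> = zero_hom M N"
    "\<And>\<phi> \<psi>. \<phi> \<oplus>\<^bsub>G\<^esub> \<psi> = (\<lambda>x\<in>carrier M. \<phi> x \<oplus>\<^bsub>N\<^esub> \<psi> x)"
    using assms(3) by (auto simp: is_hom_group_def)
  note add_in = hom_add_in[OF assms(1,2)]
  show ?thesis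
  proof (rule abelian_groupI)
    fix \<phi> \<psi> \<chi> assume "\<phi> \<in> carrier G" "\<psi> \<in> carrier G" "\<chi> \<in> carrier G"
    then show "\<phi> \<oplus>\<^bsub>G\<^esub> \<psi> \<oplus>\<^bsub>G\<^esub> \<chi> = \<phi> \<oplus>\<^bsub>G\<^esub> (\<psi> \<oplus>\<^bsub>G\<^esub> \<chi>)"
      unfolding G by (intro restrict_ext) (auto simp: hom_closed N.M.a_assoc)
  next
    fix \<phi> \<psi> assume "\<phi> \<in> carrier G" "\<psi> \<in> carrier G"
    then show "\<phi> \<oplus>\<^bsub>G\<^esub> \<psi> \<in> carrier G" "\<phi> \<oplus>\<^bsub>G\<^esub> \<psi> = \<psi> \<oplus>\<^bsub>G\<^esub> \<phi>"
      unfolding G by (auto intro!: add_in restrict_ext simp: hom_closed N.M.a_comm)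
  next
    fix \<phi> assume \<phi>: "\<phi> \<in> carrier G"
    let ?n = "\<lambda>x\<in>carrier M. \<ominus>\<^bsub>N\<^esub> \<phi> x"
    have n: "?n \<in> module_hom A M N"
      using \<phi> G by (intro hom_pointwise[OF assms(1)]) (auto simp: N.M.minus_add N.smult_r_minus)
    show "\<exists>\<psi>\<in>carrier G. \<psi> \<oplus>\<^bsub>G\<^esub> \<phi> = \<zero>\<^bsub>G\<^esub>"
      using n \<phi> unfolding G zero_hom_def
      by (intro bexI[of _ ?n]) (auto intro!: restrict_ext simp: hom_closed N.M.l_neg)
    have "zero_hom M N \<oplus>\<^bsub>G\<^esub> \<phi> \<in> module_hom A M N"
      using \<phi> zero_hom_in[OF assms(1,2)] add_in unfolding G by blast
    then show "\<zero>\<^bsub>G\<^esub> \<oplus>\<^bsub>G\<^esub> \<phi> = \<phi>"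
      using \<phi> unfolding G by (intro hom_eqI) (auto simp: hom_closed zero_hom_def)
  qed (simp add: G zero_hom_in[OF assms(1,2)])
qed

lemma hom_group_finsum:
  assumes "left_module A M" "left_module A N" "is_hom_group A M N G" "finite X"
    and "\<And>i. i \<in> X \<Longrightarrow> \<phi> i \<in> module_hom A M N" "x \<in> carrier M"
  shows "finsum G \<phi> X x = finsum N (\<lambda>i. \<phi> i x) X"
  using assms
  by (intro additive_finsum[of G N "\<lambda>\<phi>. \<phi> x"])
    (auto simp: hom_group_abelian left_module_group is_hom_group_def hom_closed)

text \<open>The \<open>K\<close>-space \<open>Hom\<^sub>A(M, N)\<close> for a \<open>K\<close>-algebra \<open>A\<close>; the scalar \<open>c\<close> acts through \<open>c 1\<^sub>A\<close>.\<close>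
definition hom_space :: "('k, 'a) module \<Rightarrow> ('a, 'b) module \<Rightarrow> ('a, 'd) module \<Rightarrow> ('k, 'b \<Rightarrow> 'd) module"
  where "hom_space A M N = \<lparr>
    carrier = module_hom A M N,
    mult = undefined,
    one = undefined,
    zero = zero_hom M N,
    add = \<lambda>\<phi> \<psi>. \<lambda>x\<in>carrier M. \<phi> x \<oplus>\<^bsub>N\<^esub> \<psi> x,
    smult = \<lambda>c \<phi>. \<lambda>x\<in>carrier M. (c \<odot>\<^bsub>A\<^esub> \<one>\<^bsub>A\<^esub>) \<odot>\<^bsub>N\<^esub> \<phi> x\<rparr>"

lemma hom_group_hom_space: "is_hom_group A M N (hom_space A M N)"
  by (simp add: is_hom_group_def hom_space_def)

lemma hom_group_star: "is_hom_group A P (regular_module A) (star_module A P)"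
  by (simp add: is_hom_group_def star_module_def)

section \<open>Algebras over a field\<close>

text \<open>An associative unital algebra over a field, of arbitrary dimension.\<close>
locale k_algebra =
  fixes K :: "('k, 'c) ring_scheme" and A :: "('k, 'a) module"
  assumes field: "field K" and vector_space: "left_module K A" and alg_ring: "ring A"
    and smult_mult_left: "c \<in> carrier K \<Longrightarrow> a \<in> carrier A \<Longrightarrow> b \<in> carrier A \<Longrightarrow>
      (c \<odot>\<^bsub>A\<^esub> a) \<otimes>\<^bsub>A\<^esub> b = c \<odot>\<^bsub>A\<^esub> (a \<otimes>\<^bsub>A\<^esub> b)"
    and smult_mult_right: "c \<in> carrier K \<Longrightarrow> a \<in> carrier A \<Longrightarrow> b \<in> carrier A \<Longrightarrow>
      a \<otimes>\<^bsub>A\<^esub> (c \<odot>\<^bsub>A\<^esub> b) = c \<odot>\<^bsub>A\<^esub> (a \<otimes>\<^bsub>A\<^esub> b)"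
begin

text \<open>The image of a scalar in the centre of the algebra.\<close>
definition scalar where "scalar c = c \<odot>\<^bsub>A\<^esub> \<one>\<^bsub>A\<^esub>"

lemma scalar_closed [simp]: "c \<in> carrier K \<Longrightarrow> scalar c \<in> carrier A"
  unfolding scalar_def by (meson alg_ring left_module.smult_closed monoid.one_closed ring.is_monoid vector_space)

lemma scalar_add:
  assumes "c \<in> carrier K" "d \<in> carrier K"
  shows "scalar (c \<oplus>\<^bsub>K\<^esub> d) = scalar c \<oplus>\<^bsub>A\<^esub> scalar d"
proof -
  interpret A: ring A by (rule alg_ring)
  show ?thesis using assms left_module.smult_l_distr[OF vector_space] by (simp add: scalar_def)
qed

lemma scalar_mult_eq:
  assumes "c \<in> carrier K" "a \<in> carrier A"
  shows "scalar c \<otimes>\<^bsub>A\<^esub> a = c \<odot>\<^bsub>A\<^esub> a" "a \<otimes>\<^bsub>A\<^esub> scalar c = c \<odot>\<^bsub>A\<^esub> a"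
proof -
  interpret A: ring A by (rule alg_ring)
  show "scalar c \<otimes>\<^bsub>A\<^esub> a = c \<odot>\<^bsub>A\<^esub> a" "a \<otimes>\<^bsub>A\<^esub> scalar c = c \<odot>\<^bsub>A\<^esub> a"
    using assms smult_mult_left[of c "\<one>\<^bsub>A\<^esub>" a] smult_mult_right[of c a "\<one>\<^bsub>A\<^esub>"]
    by (simp_all add: scalar_def)
qed

lemma scalar_mult:
  assumes "c \<in> carrier K" "d \<in> carrier K"
  shows "scalar (c \<otimes>\<^bsub>K\<^esub> d) = scalar c \<otimes>\<^bsub>A\<^esub> scalar d"
proof -
  interpret A: ring A by (rule alg_ring)
  show ?thesis
    using scalar_mult_eq(1)[OF assms(1) scalar_closed[OF assms(2)]]
      left_module.smult_assoc1[OF vector_space assms A.one_closed] by (simp add: scalar_def)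
qed

lemma scalar_one: "scalar \<one>\<^bsub>K\<^esub> = \<one>\<^bsub>A\<^esub>"
proof -
  interpret A: ring A by (rule alg_ring)
  show ?thesis using left_module.smult_one[OF vector_space] by (simp add: scalar_def)
qed

lemma left_module_hom_space:
  assumes "left_module A M" "left_module A N" shows "left_module K (hom_space A M N)"
proof -
  interpret N: left_module A N by fact
  interpret K: field K by (rule field)
  let ?H = "hom_space A M N"
  have s: "c \<odot>\<^bsub>?H\<^esub> \<phi> = (\<lambda>x\<in>carrier M. scalar c \<odot>\<^bsub>N\<^esub> \<phi> x)" for c \<phi>
    by (simp add: hom_space_def scalar_def)
  have a: "\<phi> \<oplus>\<^bsub>?H\<^esub> \<psi> = (\<lambda>x\<in>carrier M. \<phi> x \<oplus>\<^bsub>N\<^esub> \<psi> x)" for \<phi> \<psi>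
    by (simp add: hom_space_def)
  have c: "carrier ?H = module_hom A M N" by (simp add: hom_space_def)
  show ?thesis
  proof (rule left_moduleI)
    show "abelian_group ?H" by (rule hom_group_abelian[OF assms hom_group_hom_space])
  next
    fix k \<phi> assume k: "k \<in> carrier K" "\<phi> \<in> carrier ?H"
    show "k \<odot>\<^bsub>?H\<^esub> \<phi> \<in> carrier ?H" unfolding s c
    proof (rule hom_pointwise[OF assms(1), where s = "\<lambda>y. scalar k \<odot>\<^bsub>N\<^esub> y"])
      show "scalar k \<odot>\<^bsub>N\<^esub> (b \<odot>\<^bsub>N\<^esub> y) = b \<odot>\<^bsub>N\<^esub> (scalar k \<odot>\<^bsub>N\<^esub> y)" if "b \<in> carrier A" "y \<in> carrier N" for b y
        using k that by (simp add: N.smult_assoc1[symmetric] scalar_mult_eq)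
    qed (use k c in \<open>auto simp: N.smult_r_distr\<close>)
  next
    fix k l \<phi> assume k: "k \<in> carrier K" "l \<in> carrier K" "\<phi> \<in> carrier ?H"
    then show "(k \<oplus>\<^bsub>K\<^esub> l) \<odot>\<^bsub>?H\<^esub> \<phi> = k \<odot>\<^bsub>?H\<^esub> \<phi> \<oplus>\<^bsub>?H\<^esub> l \<odot>\<^bsub>?H\<^esub> \<phi>"
      "(k \<otimes>\<^bsub>K\<^esub> l) \<odot>\<^bsub>?H\<^esub> \<phi> = k \<odot>\<^bsub>?H\<^esub> (l \<odot>\<^bsub>?H\<^esub> \<phi>)"
      unfolding s a c by (auto intro!: restrict_ext simp: scalar_add scalar_mult hom_closed N.smult_l_distr N.smult_assoc1)
  next
    fix k \<phi> \<psi> assume k: "k \<in> carrier K" "\<phi> \<in> carrier ?H" "\<psi> \<in> carrier ?H"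
    then show "k \<odot>\<^bsub>?H\<^esub> (\<phi> \<oplus>\<^bsub>?H\<^esub> \<psi>) = k \<odot>\<^bsub>?H\<^esub> \<phi> \<oplus>\<^bsub>?H\<^esub> k \<odot>\<^bsub>?H\<^esub> \<psi>"
      unfolding s a c by (auto intro!: restrict_ext simp: hom_closed N.smult_r_distr)
  next
    fix \<phi> assume k: "\<phi> \<in> carrier ?H"
    have "(\<lambda>x\<in>carrier M. \<phi> x) = \<phi>" using k unfolding c by (rule extensional_restrict[OF hom_ext])
    then show "\<one>\<^bsub>K\<^esub> \<odot>\<^bsub>?H\<^esub> \<phi> = \<phi>"
      unfolding s using k c by (simp add: scalar_one hom_closed cong: restrict_cong)
  qed (rule K.ring_axioms)
qed

lemma left_module_star:
  assumes "left_module A P" shows "left_module (opposite_ring A) (star_module A P)"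
proof -
  interpret A: ring A by (rule alg_ring)
  note reg = left_module_regular[OF alg_ring]
  let ?H = "star_module A P"
  have o: "carrier (opposite_ring A) = carrier A" "\<one>\<^bsub>opposite_ring A\<^esub> = \<one>\<^bsub>A\<^esub>" "\<zero>\<^bsub>opposite_ring A\<^esub> = \<zero>\<^bsub>A\<^esub>"
    "add (opposite_ring A) = add A" "\<And>x y. x \<otimes>\<^bsub>opposite_ring A\<^esub> y = y \<otimes>\<^bsub>A\<^esub> x"
    by (simp_all add: opposite_ring_def)
  have s: "c \<odot>\<^bsub>?H\<^esub> \<phi> = (\<lambda>x\<in>carrier P. \<phi> x \<otimes>\<^bsub>A\<^esub> c)" for c \<phi>
    by (simp add: star_module_def)
  have a: "\<phi> \<oplus>\<^bsub>?H\<^esub> \<psi> = (\<lambda>x\<in>carrier P. \<phi> x \<oplus>\<^bsub>A\<^esub> \<psi> x)" for \<phi> \<psi>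
    by (simp add: star_module_def)
  have c: "carrier ?H = module_hom A P (regular_module A)" by (simp add: star_module_def)
  have cl: "\<And>\<phi> x. \<phi> \<in> module_hom A P (regular_module A) \<Longrightarrow> x \<in> carrier P \<Longrightarrow> \<phi> x \<in> carrier A"
    using hom_closed by fastforce
  show ?thesis
  proof (rule left_moduleI)
    show "ring (opposite_ring A)"
    proof (rule ringI)
      show "abelian_group (opposite_ring A)"
        using abelian_groupE[OF A.is_abelian_group] by (intro abelian_groupI) (simp_all add: o)
      show "Group.monoid (opposite_ring A)"
        by (rule monoidI) (simp_all add: o A.m_assoc)
    qed (simp_all add: o A.l_distr A.r_distr)
  next
    show "abelian_group ?H" by (rule hom_group_abelian[OF assms reg hom_group_star])
  next
    fix k \<phi> assume k: "k \<in> carrier (opposite_ring A)" "\<phi> \<in> carrier ?H"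
    then show "k \<odot>\<^bsub>?H\<^esub> \<phi> \<in> carrier ?H" unfolding s c
      by (intro hom_pointwise[OF assms(1)]) (auto simp: o A.l_distr A.m_assoc)
  next
    fix k l \<phi> assume k: "k \<in> carrier (opposite_ring A)" "l \<in> carrier (opposite_ring A)" "\<phi> \<in> carrier ?H"
    then show "(k \<oplus>\<^bsub>opposite_ring A\<^esub> l) \<odot>\<^bsub>?H\<^esub> \<phi> = k \<odot>\<^bsub>?H\<^esub> \<phi> \<oplus>\<^bsub>?H\<^esub> l \<odot>\<^bsub>?H\<^esub> \<phi>"
      "(k \<otimes>\<^bsub>opposite_ring A\<^esub> l) \<odot>\<^bsub>?H\<^esub> \<phi> = k \<odot>\<^bsub>?H\<^esub> (l \<odot>\<^bsub>?H\<^esub> \<phi>)"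
      unfolding s a c o by (auto intro!: restrict_ext simp: cl A.r_distr A.m_assoc)
  next
    fix k \<phi> \<psi> assume k: "k \<in> carrier (opposite_ring A)" "\<phi> \<in> carrier ?H" "\<psi> \<in> carrier ?H"
    then show "k \<odot>\<^bsub>?H\<^esub> (\<phi> \<oplus>\<^bsub>?H\<^esub> \<psi>) = k \<odot>\<^bsub>?H\<^esub> \<phi> \<oplus>\<^bsub>?H\<^esub> k \<odot>\<^bsub>?H\<^esub> \<psi>"
      unfolding s a c o by (auto intro!: restrict_ext simp: cl A.l_distr)
  next
    fix \<phi> assume k: "\<phi> \<in> carrier ?H"
    have "(\<lambda>x\<in>carrier P. \<phi> x) = \<phi>" using k unfolding c by (rule extensional_restrict[OF hom_ext])
    then show "\<one>\<^bsub>opposite_ring A\<^esub> \<odot>\<^bsub>?H\<^esub> \<phi> = \<phi>"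
      unfolding s o using k c by (simp add: cl cong: restrict_cong)
  qed
qed

end

section \<open>Homomorphisms into the Auslander-Reiten translate\<close>

text \<open>The homomorphism \<open>x \<mapsto> \<phi>(x) m\<close>, which corresponds to \<open>\<phi> \<otimes> m\<close> under \<open>Hom\<^sub>A(P, A) \<otimes>\<^sub>A M \<rightarrow> Hom\<^sub>A(P, M)\<close>.\<close>
definition rank_one :: "('a, 'b) module \<Rightarrow> ('a, 'd) module \<Rightarrow> ('b \<Rightarrow> 'a) \<Rightarrow> 'd \<Rightarrow> 'b \<Rightarrow> 'd"
  where "rank_one P M \<phi> m = (\<lambda>x\<in>carrier P. \<phi> x \<odot>\<^bsub>M\<^esub> m)"

lemma rank_one_hom:
  assumes "left_module A P" "left_module A M" "\<phi> \<in> module_hom A P (regular_module A)" "m \<in> carrier M"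
  shows "rank_one P M \<phi> m \<in> module_hom A P M"
proof -
  interpret M: left_module A M by fact
  show ?thesis unfolding rank_one_def
    by (rule hom_pointwise[OF assms(1,3)]) (auto simp: assms M.smult_l_distr M.smult_assoc1)
qed

lemma dual_basisD:
  assumes "dual_basis A P n p \<phi>"
  shows "\<And>i. i < n \<Longrightarrow> p i \<in> carrier P" "\<And>i. i < n \<Longrightarrow> \<phi> i \<in> module_hom A P (regular_module A)"
    "\<And>x. x \<in> carrier P \<Longrightarrow> finsum P (\<lambda>i. \<phi> i x \<odot>\<^bsub>P\<^esub> p i) {..<n} = x"
    "\<And>i x. i < n \<Longrightarrow> x \<in> carrier P \<Longrightarrow> \<phi> i x \<in> carrier A"
  using assms hom_closed[of _ A P "regular_module A"] by (auto simp: dual_basis_def)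

lemma hom_dual_basis:
  assumes "left_module A P" "left_module A M" "dual_basis A P n p \<phi>" "\<psi> \<in> module_hom A P M" "x \<in> carrier P"
  shows "\<psi> x = finsum M (\<lambda>i. \<phi> i x \<odot>\<^bsub>M\<^esub> \<psi> (p i)) {..<n}"
proof -
  interpret P: left_module A P by fact
  interpret M: left_module A M by fact
  note d = dual_basisD[OF assms(3)]
  have "\<psi> x = \<psi> (finsum P (\<lambda>i. \<phi> i x \<odot>\<^bsub>P\<^esub> p i) {..<n})" using d(3)[OF assms(5)] by simp
  also have "\<dots> = finsum M (\<lambda>i. \<psi> (\<phi> i x \<odot>\<^bsub>P\<^esub> p i)) {..<n}"
    using assms d by (intro hom_finsum) auto
  also have "\<dots> = finsum M (\<lambda>i. \<phi> i x \<odot>\<^bsub>M\<^esub> \<psi> (p i)) {..<n}"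
    using d assms hom_closed[OF assms(4)] by (intro M.M.finsum_cong') (auto simp: hom_smult[OF assms(4)])
  finally show ?thesis .
qed

lemma (in k_algebra) star_dual_basis:
  assumes "left_module A P" "dual_basis A P n p \<phi>" "\<psi> \<in> module_hom A P (regular_module A)"
  shows "\<psi> = finsum (star_module A P) (\<lambda>i. \<psi> (p i) \<odot>\<^bsub>star_module A P\<^esub> \<phi> i) {..<n}"
proof -
  note reg = left_module_regular[OF alg_ring]
  interpret A: ring A by (rule alg_ring)
  interpret S: left_module "opposite_ring A" "star_module A P" by (rule left_module_star[OF assms(1)])
  note d = dual_basisD[OF assms(2)]
  have c: "carrier (star_module A P) = module_hom A P (regular_module A)"
    "carrier (opposite_ring A) = carrier A" by (simp_all add: star_module_def opposite_ring_def)
  have pA: "\<And>i. i < n \<Longrightarrow> \<psi> (p i) \<in> carrier A" using hom_closed[OF assms(3)] d by simp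
  have t: "\<And>i. i < n \<Longrightarrow> \<psi> (p i) \<odot>\<^bsub>star_module A P\<^esub> \<phi> i \<in> module_hom A P (regular_module A)"
    using S.smult_closed d pA unfolding c by blast
  have "finsum (star_module A P) (\<lambda>i. \<psi> (p i) \<odot>\<^bsub>star_module A P\<^esub> \<phi> i) {..<n} \<in> carrier (star_module A P)"
    by (rule S.M.finsum_closed) (use t in \<open>auto simp: c\<close>)
  then have "finsum (star_module A P) (\<lambda>i. \<psi> (p i) \<odot>\<^bsub>star_module A P\<^esub> \<phi> i) {..<n}
    \<in> module_hom A P (regular_module A)" by (simp only: c)
  then show ?thesis
  proof (rule hom_eqI[OF assms(3)])
    fix x assume x: "x \<in> carrier P"
    have "\<psi> x = finsum (regular_module A) (\<lambda>i. \<phi> i x \<odot>\<^bsub>regular_module A\<^esub> \<psi> (p i)) {..<n}"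
      by (rule hom_dual_basis[OF assms(1) reg assms(2,3) x])
    also have "\<dots> = finsum (regular_module A) (\<lambda>i. (\<psi> (p i) \<odot>\<^bsub>star_module A P\<^esub> \<phi> i) x) {..<n}"
      using x by (simp add: star_module_def)
    also have "\<dots> = finsum (star_module A P) (\<lambda>i. \<psi> (p i) \<odot>\<^bsub>star_module A P\<^esub> \<phi> i) {..<n} x"
      using t x by (intro hom_group_finsum[OF assms(1) reg hom_group_star, symmetric]) auto
    finally show "\<psi> x = \<dots>" .
  qed
qed

lemma (in abelian_monoid) finsum_swap:
  assumes "finite X" "finite Y" "\<And>i j. i \<in> X \<Longrightarrow> j \<in> Y \<Longrightarrow> f i j \<in> carrier G"
  shows "finsum G (\<lambda>i. finsum G (f i) Y) X = finsum G (\<lambda>j. finsum G (\<lambda>i. f i j) X) Y"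
  using assms(1,3)
proof (induct set: finite)
  case empty
  then show ?case by simp
next
  case (insert i X)
  have "finsum G (\<lambda>j. finsum G (\<lambda>i. f i j) (insert i X)) Y
      = finsum G (\<lambda>j. f i j \<oplus> finsum G (\<lambda>i. f i j) X) Y"
    using insert by (intro finsum_cong') (auto simp: Pi_def)
  also have "\<dots> = finsum G (f i) Y \<oplus> finsum G (\<lambda>j. finsum G (\<lambda>i. f i j) X) Y"
    using insert by (intro finsum_addf) auto
  finally show ?case using insert by (simp add: Pi_def)
qed

text \<open>A map \<open>f : P1 \<rightarrow> P0\<close> between modules with dual bases, such as the first map of a projective
  presentation. Below, \<open>C\<close> is the cokernel of \<open>Hom\<^sub>A(f, A)\<close>, and \<open>D\<close> is its dual;
  for a minimal presentation these are the transpose and the Auslander-Reiten translate. The next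
  lemmas show that \<open>Hom\<^sub>A(M, D)\<close>
  vanishes if and only if every homomorphism from \<open>P1\<close> to \<open>M\<close> factors through \<open>f\<close>. Indeed, as
  \<open>Hom\<^sub>A(P1, M)\<close> is \<open>Hom\<^sub>A(P1, A) \<otimes>\<^sub>A M\<close>, a homomorphism from \<open>M\<close> to \<open>D\<close> amounts to a linear functional on
  \<open>Hom\<^sub>A(P1, M)\<close> that vanishes on the image of \<open>Hom\<^sub>A(P0, M)\<close>. Tensor products are avoided by means of
  the dual bases.\<close>
locale presentation_map = k_algebra K A
  for K :: "('k, 'c) ring_scheme" and A :: "('k, 'a) module" +
  fixes P1 P0 :: "('a, 'b) module" and f :: "'b \<Rightarrow> 'b" and n1 p1 \<phi>1 n0 p0 \<phi>0
  assumes P1: "left_module A P1" and P0: "left_module A P0" and f: "f \<in> module_hom A P1 P0"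
    and db1: "dual_basis A P1 n1 p1 \<phi>1" and db0: "dual_basis A P0 n0 p0 \<phi>0"
begin

abbreviation "S1 \<equiv> star_module A P1"
abbreviation "S0 \<equiv> star_module A P0"
abbreviation "Fim \<equiv> (\<lambda>\<phi>. compose (carrier P1) \<phi> f) ` carrier S0"
abbreviation "C \<equiv> transpose_module A P1 P0 f"
abbreviation "D \<equiv> dual_module K A C"

lemma star_simps:
  "carrier S1 = module_hom A P1 (regular_module A)"
  "carrier S0 = module_hom A P0 (regular_module A)"
  "\<phi> \<oplus>\<^bsub>S1\<^esub> \<psi> = (\<lambda>x\<in>carrier P1. \<phi> x \<oplus>\<^bsub>A\<^esub> \<psi> x)"
  "a \<odot>\<^bsub>S1\<^esub> \<phi> = (\<lambda>x\<in>carrier P1. \<phi> x \<otimes>\<^bsub>A\<^esub> a)"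
  "carrier (opposite_ring A) = carrier A"
  by (simp_all add: star_module_def opposite_ring_def)

lemma Im_submodule: "submodule Fim (opposite_ring A) S1"
proof -
  interpret A: ring A by (rule alg_ring)
  interpret S1: left_module "opposite_ring A" S1 by (rule left_module_star[OF P1])
  interpret S0: left_module "opposite_ring A" S0 by (rule left_module_star[OF P0])
  have h: "(\<lambda>\<phi>\<in>carrier S0. compose (carrier P1) \<phi> f) \<in> module_hom (opposite_ring A) S0 S1"
  proof (rule module_homI)
    fix \<phi> assume "\<phi> \<in> carrier S0"
    then show "compose (carrier P1) \<phi> f \<in> carrier S1" using hom_comp[OF f _ P1] by (simp add: star_simps)
  next
    show "left_module (opposite_ring A) S0" by (rule S0.left_module_axioms)
  qed (auto simp: compose_def fun_eq_iff star_module_def opposite_ring_def hom_closed[OF f])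
  have "(\<lambda>\<phi>\<in>carrier S0. compose (carrier P1) \<phi> f) ` carrier S0 = Fim" by (rule image_cong) auto
  then show ?thesis
    using hom_image_submodule[OF S0.left_module_axioms S1.left_module_axioms h S0.submodule_carrier] by simp
qed

lemma quotient_by_Im: "module_with_submodule (opposite_ring A) S1 Fim"
  by (intro module_with_submodule.intro module_with_submodule_axioms.intro left_module_star P1 Im_submodule)

sublocale q: module_with_submodule "opposite_ring A" S1 Fim
  by (rule quotient_by_Im)

lemma C_eq: "C = S1 /\<^sub>m Fim"
  by (simp add: transpose_module_def)

lemma dual_simps:
  "h \<in> carrier D \<longleftrightarrow> h \<in> module_hom K (restrict_scalars A C) (regular_module K)"
  "h \<oplus>\<^bsub>D\<^esub> h' = (\<lambda>x\<in>carrier C. h x \<oplus>\<^bsub>K\<^esub> h' x)"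
  "\<zero>\<^bsub>D\<^esub> = (\<lambda>x\<in>carrier C. \<zero>\<^bsub>K\<^esub>)"
  "a \<odot>\<^bsub>D\<^esub> h = (\<lambda>x\<in>carrier C. h (a \<odot>\<^bsub>C\<^esub> x))"
  by (simp_all add: dual_module_def zero_hom_def restrict_scalars_def)

lemma tau_hom_eq_zero:
  assumes M: "left_module A M"
    and surj: "\<And>\<psi>. \<psi> \<in> module_hom A P1 M \<Longrightarrow> \<exists>\<chi>\<in>module_hom A P0 M. \<psi> = compose (carrier P1) \<chi> f"
    and h: "h \<in> module_hom A M D"
  shows "h = zero_hom M D"
proof -
  interpret K: field K by (rule field)
  interpret A: ring A by (rule alg_ring)
  interpret M: left_module A M by (rule M)
  note reg = left_module_regular[OF alg_ring]
  note d1 = dual_basisD[OF db1] and d0 = dual_basisD[OF db0]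
  \<comment> \<open>The balanced form \<open>M \<times> Hom\<^sub>A(P1, A) \<rightarrow> K\<close> that corresponds to \<open>h\<close>.\<close>
  define G where "G m \<phi> = h m (Fim +>\<^bsub>S1\<^esub> \<phi>)" for m \<phi>
  have hm: "h m \<in> module_hom K (restrict_scalars A C) (regular_module K)" if "m \<in> carrier M" for m
    using hom_closed[OF h that] by (simp add: dual_simps)
  have G_closed: "G m \<phi> \<in> carrier K" if "m \<in> carrier M" "\<phi> \<in> carrier S1" for m \<phi>
    using hom_closed[OF hm[OF that(1)], of "Fim +>\<^bsub>S1\<^esub> \<phi>"] that(2) by (simp add: G_def C_eq restrict_scalars_def)
  have G_add: "G m (\<phi> \<oplus>\<^bsub>S1\<^esub> \<psi>) = G m \<phi> \<oplus>\<^bsub>K\<^esub> G m \<psi>"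
    if "m \<in> carrier M" "\<phi> \<in> carrier S1" "\<psi> \<in> carrier S1" for m \<phi> \<psi>
    using hom_add[OF hm[OF that(1)], of "Fim +>\<^bsub>S1\<^esub> \<phi>" "Fim +>\<^bsub>S1\<^esub> \<psi>"] that
    by (simp add: G_def C_eq restrict_scalars_def q.quot_add)
  have G_add_left: "G (m \<oplus>\<^bsub>M\<^esub> m') \<phi> = G m \<phi> \<oplus>\<^bsub>K\<^esub> G m' \<phi>"
    if "m \<in> carrier M" "m' \<in> carrier M" "\<phi> \<in> carrier S1" for m m' \<phi>
    using hom_add[OF h that(1,2), unfolded dual_simps] that(3) by (simp add: G_def C_eq)
  have G_bal: "G (a \<odot>\<^bsub>M\<^esub> m) \<phi> = G m (a \<odot>\<^bsub>S1\<^esub> \<phi>)"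
    if "a \<in> carrier A" "m \<in> carrier M" "\<phi> \<in> carrier S1" for a m \<phi>
    using hom_smult[OF h that(1,2), unfolded dual_simps] that q.quot_smult[of a \<phi>]
    by (simp add: G_def C_eq star_simps(5))
  have G_Im: "G m \<phi> = \<zero>\<^bsub>K\<^esub>" if m: "m \<in> carrier M" and \<phi>: "\<phi> \<in> Fim" for m \<phi>
  proof -
    have "Fim +>\<^bsub>S1\<^esub> \<phi> = Fim +>\<^bsub>S1\<^esub> \<zero>\<^bsub>S1\<^esub>"
    proof -
      have "Fim \<subseteq> carrier S1" using Im_submodule unfolding q.submodule_iff by (rule conjunct1)
      then show ?thesis using q.coset_eq_self_iff[of \<phi>] \<phi> unfolding q.coset_zero by (simp only: subsetD)
    qed
    moreover have "G m \<zero>\<^bsub>S1\<^esub> = G m \<zero>\<^bsub>S1\<^esub> \<oplus>\<^bsub>K\<^esub> G m \<zero>\<^bsub>S1\<^esub>"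
      using G_add[OF m, of "\<zero>\<^bsub>S1\<^esub>" "\<zero>\<^bsub>S1\<^esub>"] by simp
    then have "G m \<zero>\<^bsub>S1\<^esub> = \<zero>\<^bsub>K\<^esub>"
      using G_closed[OF m, of "\<zero>\<^bsub>S1\<^esub>"] by (metis K.add.r_cancel_one' q.M.zero_closed)
    ultimately show ?thesis by (simp add: G_def)
  qed
  \<comment> \<open>The form is determined by its values on the dual basis of \<open>P1\<close>.\<close>
  have expand: "G m \<phi> = finsum K (\<lambda>i. G (\<phi> (p1 i) \<odot>\<^bsub>M\<^esub> m) (\<phi>1 i)) {..<n1}"
    if m: "m \<in> carrier M" and \<phi>: "\<phi> \<in> carrier S1" for m \<phi>
  proof -
    have \<phi>p: "\<And>i. i < n1 \<Longrightarrow> \<phi> (p1 i) \<in> carrier A"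
      using \<phi> d1 hom_closed[of \<phi> A P1 "regular_module A"] by (simp add: star_simps)
    have cl: "\<And>i. i < n1 \<Longrightarrow> \<phi> (p1 i) \<odot>\<^bsub>S1\<^esub> \<phi>1 i \<in> carrier S1"
      using \<phi>p d1 by (intro q.smult_closed) (auto simp: star_simps)
    have "G m \<phi> = G m (finsum S1 (\<lambda>i. \<phi> (p1 i) \<odot>\<^bsub>S1\<^esub> \<phi>1 i) {..<n1})"
      using star_dual_basis[OF P1 db1, of \<phi>] \<phi> by (simp add: star_simps)
    also have "\<dots> = finsum K (\<lambda>i. G m (\<phi> (p1 i) \<odot>\<^bsub>S1\<^esub> \<phi>1 i)) {..<n1}"
      using cl m by (intro additive_finsum[of S1 K "G m"]) (auto simp: G_closed G_add q.M.abelian_group_axioms K.abelian_group_axioms)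
    also have "\<dots> = finsum K (\<lambda>i. G (\<phi> (p1 i) \<odot>\<^bsub>M\<^esub> m) (\<phi>1 i)) {..<n1}"
      using \<phi>p m d1 by (intro K.finsum_cong') (auto intro!: G_closed simp: G_bal[symmetric] star_simps(1))
    finally show ?thesis .
  qed
  have zero: "G m \<phi> = \<zero>\<^bsub>K\<^esub>" if m: "m \<in> carrier M" and \<phi>: "\<phi> \<in> carrier S1" for m \<phi>
  proof -
    obtain \<chi> where \<chi>: "\<chi> \<in> module_hom A P0 M" and \<chi>f: "rank_one P1 M \<phi> m = compose (carrier P1) \<chi> f"
      using surj[OF rank_one_hom[OF P1 M, of \<phi> m]] m \<phi> by (auto simp: star_simps)
    have e: "\<phi> x \<odot>\<^bsub>M\<^esub> m = \<chi> (f x)" if "x \<in> carrier P1" for x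
      using fun_cong[OF \<chi>f, of x] that by (simp add: rank_one_def compose_def)
    define \<theta> where "\<theta> j = compose (carrier P1) (\<phi>0 j) f" for j
    have \<theta>: "\<And>j. j < n0 \<Longrightarrow> \<theta> j \<in> Fim" using d0 by (auto simp: \<theta>_def star_simps)
    then have \<theta>S: "\<And>j. j < n0 \<Longrightarrow> \<theta> j \<in> carrier S1" using Im_submodule by (auto simp: q.submodule_iff)
    have q: "\<And>j. j < n0 \<Longrightarrow> \<chi> (p0 j) \<in> carrier M" using hom_closed[OF \<chi>] d0 by auto
    have cl: "\<theta> j (p1 i) \<in> carrier A" if "i < n1" "j < n0" for i j
      using \<theta>S[OF that(2)] d1(1)[OF that(1)] hom_closed[of "\<theta> j" A P1 "regular_module A"] by (simp add: star_simps)
    have G_cl: "G (\<theta> j (p1 i) \<odot>\<^bsub>M\<^esub> \<chi> (p0 j)) (\<phi>1 i) \<in> carrier K" if "i < n1" "j < n0" for i j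
      using that cl q d1 by (intro G_closed) (auto simp: star_simps)
    have "G (\<phi> (p1 i) \<odot>\<^bsub>M\<^esub> m) (\<phi>1 i) = finsum K (\<lambda>j. G (\<theta> j (p1 i) \<odot>\<^bsub>M\<^esub> \<chi> (p0 j)) (\<phi>1 i)) {..<n0}"
      if i: "i < n1" for i
    proof -
      have "\<phi> (p1 i) \<odot>\<^bsub>M\<^esub> m = finsum M (\<lambda>j. \<phi>0 j (f (p1 i)) \<odot>\<^bsub>M\<^esub> \<chi> (p0 j)) {..<n0}"
        using e[of "p1 i"] hom_dual_basis[OF P0 M db0 \<chi>, of "f (p1 i)"] d1(1)[OF i] hom_closed[OF f] by simp
      also have "\<dots> = finsum M (\<lambda>j. \<theta> j (p1 i) \<odot>\<^bsub>M\<^esub> \<chi> (p0 j)) {..<n0}"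
        using d1(1)[OF i] by (simp add: \<theta>_def compose_def)
      finally show ?thesis
        using additive_finsum[of M K "\<lambda>x. G x (\<phi>1 i)" "{..<n0}" "\<lambda>j. \<theta> j (p1 i) \<odot>\<^bsub>M\<^esub> \<chi> (p0 j)"]
          d1(2)[OF i] cl[OF i] q
        by (simp add: G_closed G_add_left star_simps M.M.abelian_group_axioms K.abelian_group_axioms)
    qed
    then have "G m \<phi> = finsum K (\<lambda>i. finsum K (\<lambda>j. G (\<theta> j (p1 i) \<odot>\<^bsub>M\<^esub> \<chi> (p0 j)) (\<phi>1 i)) {..<n0}) {..<n1}"
      unfolding expand[OF m \<phi>] using G_cl by (intro K.finsum_cong') auto
    also have "\<dots> = finsum K (\<lambda>j. finsum K (\<lambda>i. G (\<theta> j (p1 i) \<odot>\<^bsub>M\<^esub> \<chi> (p0 j)) (\<phi>1 i)) {..<n1}) {..<n0}"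
      using G_cl by (intro K.finsum_swap) auto
    also have "\<dots> = finsum K (\<lambda>j. \<zero>\<^bsub>K\<^esub>) {..<n0}"
      using expand[symmetric] q \<theta>S G_Im \<theta> by (intro K.finsum_cong') auto
    finally show ?thesis by simp
  qed
  show ?thesis
  proof (rule extensionalityI[of _ "carrier M"])
    show "h \<in> extensional (carrier M)" by (rule hom_ext[OF h])
    show "zero_hom M D \<in> extensional (carrier M)" by (simp add: zero_hom_def)
    fix m assume m: "m \<in> carrier M"
    have "h m = (\<lambda>x\<in>carrier C. \<zero>\<^bsub>K\<^esub>)"
    proof (rule extensionalityI[of _ "carrier C"])
      show "h m \<in> extensional (carrier C)" using hom_ext[OF hm[OF m]] by (simp add: restrict_scalars_def)
      fix X assume "X \<in> carrier C"
      then show "h m X = (\<lambda>x\<in>carrier C. \<zero>\<^bsub>K\<^esub>) X"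
        using zero[OF m] by (auto simp: C_eq G_def elim: q.quot_elim)
    qed simp
    then show "h m = zero_hom M D m" using m by (simp add: zero_hom_def dual_simps)
  qed
qed

lemma zero_hom_dual:
  assumes M: "left_module A M" shows "zero_hom M D \<in> module_hom A M D"
proof -
  interpret K: field K by (rule field)
  interpret M: left_module A M by (rule M)
  have C_add: "X \<oplus>\<^bsub>C\<^esub> Y \<in> carrier C" if "X \<in> carrier C" "Y \<in> carrier C" for X Y
    using that unfolding C_eq by (auto simp: q.quot_add elim!: q.quot_elim)
  have C_smult: "a \<odot>\<^bsub>C\<^esub> X \<in> carrier C" if "a \<in> carrier A" "X \<in> carrier C" for a X
    using that q.quot_smult[of a] unfolding C_eq by (auto simp: star_simps(5) elim!: q.quot_elim)
  have "\<zero>\<^bsub>D\<^esub> \<in> carrier D"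
    unfolding dual_simps using C_add C_smult
    by (auto simp: module_hom_def restrict_scalars_def scalar_def[symmetric])
  moreover have "\<zero>\<^bsub>D\<^esub> \<oplus>\<^bsub>D\<^esub> \<zero>\<^bsub>D\<^esub> = \<zero>\<^bsub>D\<^esub>" unfolding dual_simps by auto
  moreover have "a \<odot>\<^bsub>D\<^esub> \<zero>\<^bsub>D\<^esub> = \<zero>\<^bsub>D\<^esub>" if "a \<in> carrier A" for a
    unfolding dual_simps using C_smult[OF that] by auto
  ultimately show ?thesis by (auto simp: module_hom_def zero_hom_def)
qed

lemma factors_through_presentation:
  assumes M: "left_module A M" and hom: "module_hom A M D = {zero_hom M D}"
    and \<psi>: "\<psi> \<in> module_hom A P1 M"
  shows "\<exists>\<chi>\<in>module_hom A P0 M. \<psi> = compose (carrier P1) \<chi> f"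
proof (rule ccontr)
  assume contra: "\<not> ?thesis"
  interpret K: field K by (rule field)
  interpret A: ring A by (rule alg_ring)
  interpret M: left_module A M by (rule M)
  note reg = left_module_regular[OF alg_ring]
  note d1 = dual_basisD[OF db1] and d0 = dual_basisD[OF db0]
  let ?H1 = "hom_space A P1 M" and ?H0 = "hom_space A P0 M"
  interpret H1: left_module K ?H1 by (rule left_module_hom_space[OF P1 M])
  interpret H0: left_module K ?H0 by (rule left_module_hom_space[OF P0 M])
  have cH: "carrier ?H1 = module_hom A P1 M" "carrier ?H0 = module_hom A P0 M" by (simp_all add: hom_space_def)
  let ?c = "\<lambda>\<chi>\<in>carrier ?H0. compose (carrier P1) \<chi> f"
  have c: "?c \<in> module_hom K ?H0 ?H1"
  proof (rule module_homI)
    fix \<chi> assume "\<chi> \<in> carrier ?H0"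
    then show "compose (carrier P1) \<chi> f \<in> carrier ?H1" using hom_comp[OF f _ P1] by (simp add: cH)
  next
    show "left_module K ?H0" by (rule H0.left_module_axioms)
  qed (auto simp: compose_def fun_eq_iff hom_space_def hom_closed[OF f])
  let ?W = "?c ` carrier ?H0"
  have W: "submodule ?W K ?H1"
    by (rule hom_image_submodule[OF H0.left_module_axioms H1.left_module_axioms c H0.submodule_carrier])
  have \<psi>W: "\<psi> \<in> carrier ?H1" "\<psi> \<notin> ?W" using \<psi> contra by (auto simp: cH)
  obtain F where F_cl: "\<And>x. x \<in> carrier ?H1 \<Longrightarrow> F x \<in> carrier K"
    and F_add: "\<And>x y. x \<in> carrier ?H1 \<Longrightarrow> y \<in> carrier ?H1 \<Longrightarrow> F (x \<oplus>\<^bsub>?H1\<^esub> y) = F x \<oplus>\<^bsub>K\<^esub> F y"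
    and F_smult: "\<And>c x. c \<in> carrier K \<Longrightarrow> x \<in> carrier ?H1 \<Longrightarrow> F (c \<odot>\<^bsub>?H1\<^esub> x) = c \<otimes>\<^bsub>K\<^esub> F x"
    and F_W: "\<And>w. w \<in> ?W \<Longrightarrow> F w = \<zero>\<^bsub>K\<^esub>" and F_\<psi>: "F \<psi> = \<one>\<^bsub>K\<^esub>"
    by (rule linear_functional_exists[OF field H1.left_module_axioms W \<psi>W]) blast
  let ?r = "\<lambda>\<phi> m. rank_one P1 M \<phi> m"
  have r: "?r \<phi> m \<in> carrier ?H1" if "\<phi> \<in> carrier S1" "m \<in> carrier M" for \<phi> m
    using rank_one_hom[OF P1 M] that by (simp add: cH star_simps)
  have \<phi>A: "\<phi> x \<in> carrier A" if "\<phi> \<in> carrier S1" "x \<in> carrier P1" for \<phi> x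
    using that hom_closed[of \<phi> A P1 "regular_module A"] by (simp add: star_simps)
  have r_add: "?r (\<phi> \<oplus>\<^bsub>S1\<^esub> \<phi>') m = ?r \<phi> m \<oplus>\<^bsub>?H1\<^esub> ?r \<phi>' m"
    if "\<phi> \<in> carrier S1" "\<phi>' \<in> carrier S1" "m \<in> carrier M" for \<phi> \<phi>' m
    using that by (auto simp: rank_one_def star_simps(3) hom_space_def fun_eq_iff \<phi>A M.smult_l_distr)
  have r_add': "?r \<phi> (m \<oplus>\<^bsub>M\<^esub> m') = ?r \<phi> m \<oplus>\<^bsub>?H1\<^esub> ?r \<phi> m'"
    if "\<phi> \<in> carrier S1" "m \<in> carrier M" "m' \<in> carrier M" for \<phi> m m'
    using that by (auto simp: rank_one_def hom_space_def fun_eq_iff \<phi>A M.smult_r_distr)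
  have r_bal: "?r (a \<odot>\<^bsub>S1\<^esub> \<phi>) m = ?r \<phi> (a \<odot>\<^bsub>M\<^esub> m)"
    if "\<phi> \<in> carrier S1" "m \<in> carrier M" "a \<in> carrier A" for \<phi> m a
    using that by (auto simp: rank_one_def star_simps(4) fun_eq_iff \<phi>A M.smult_assoc1)
  have r_Im: "F (?r \<phi> m) = \<zero>\<^bsub>K\<^esub>" if \<phi>: "\<phi> \<in> Fim" and m: "m \<in> carrier M" for \<phi> m
  proof (rule F_W)
    obtain \<phi>' where \<phi>': "\<phi>' \<in> carrier S0" "\<phi> = compose (carrier P1) \<phi>' f" using \<phi> by blast
    have "rank_one P0 M \<phi>' m \<in> carrier ?H0" using rank_one_hom[OF P0 M] \<phi>' m by (simp add: cH star_simps)
    moreover have "?r \<phi> m = ?c (rank_one P0 M \<phi>' m)"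
      using calculation by (auto simp: rank_one_def compose_def fun_eq_iff \<phi>' hom_closed[OF f])
    ultimately show "?r \<phi> m \<in> ?W" by blast
  qed
  \<comment> \<open>\<open>F\<close> vanishes on \<open>\<phi> \<otimes> m\<close> for \<open>\<phi>\<close> in the image of \<open>Hom\<^sub>A(f, A)\<close>, so it induces a map on \<open>C\<close>.\<close>
  define rep where "rep X = (SOME \<phi>. \<phi> \<in> carrier S1 \<and> X = Fim +>\<^bsub>S1\<^esub> \<phi>)" for X
  have F_rep: "F (?r (rep (Fim +>\<^bsub>S1\<^esub> \<phi>)) m) = F (?r \<phi> m)" if \<phi>: "\<phi> \<in> carrier S1" and m: "m \<in> carrier M" for \<phi> m
  proof -
    let ?\<phi> = "rep (Fim +>\<^bsub>S1\<^esub> \<phi>)"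
    have \<phi>': "?\<phi> \<in> carrier S1" "Fim +>\<^bsub>S1\<^esub> \<phi> = Fim +>\<^bsub>S1\<^esub> ?\<phi>"
      using someI[of "\<lambda>\<phi>'. \<phi>' \<in> carrier S1 \<and> Fim +>\<^bsub>S1\<^esub> \<phi> = Fim +>\<^bsub>S1\<^esub> \<phi>'" \<phi>] \<phi> by (auto simp: rep_def)
    let ?d = "?\<phi> \<ominus>\<^bsub>S1\<^esub> \<phi>"
    have d: "?d \<in> Fim" "?d \<in> carrier S1" using \<phi> \<phi>' q.coset_eq_iff[of ?\<phi> \<phi>] by auto
    have "?r ?\<phi> m = ?r ?d m \<oplus>\<^bsub>?H1\<^esub> ?r \<phi> m"
      using r_add[OF d(2) \<phi> m] q.diff_add_cancel[OF \<phi>'(1) \<phi>] by simp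
    then have "F (?r ?\<phi> m) = F (?r ?d m) \<oplus>\<^bsub>K\<^esub> F (?r \<phi> m)"
      using F_add[OF r[OF d(2) m] r[OF \<phi> m]] by simp
    then show ?thesis using r_Im[OF d(1) m] F_cl r[OF \<phi> m] by simp
  qed
  have rsc: "carrier (restrict_scalars A C) = carrier C" "add (restrict_scalars A C) = add C"
    "c \<odot>\<^bsub>restrict_scalars A C\<^esub> x = scalar c \<odot>\<^bsub>C\<^esub> x" for c x
    by (simp_all add: restrict_scalars_def scalar_def)
  define h where "h = (\<lambda>m\<in>carrier M. \<lambda>X\<in>carrier C. F (?r (rep X) m))"
  have h_eq: "h m (Fim +>\<^bsub>S1\<^esub> \<phi>) = F (?r \<phi> m)" if "\<phi> \<in> carrier S1" "m \<in> carrier M" for \<phi> m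
    using that F_rep by (simp add: h_def C_eq)
  have h_ext: "h m \<in> extensional (carrier C)" if "m \<in> carrier M" for m using that by (simp add: h_def)
  have hD: "h m \<in> carrier D" if m: "m \<in> carrier M" for m
  proof -
    have "h m X \<in> carrier K" if "X \<in> carrier C" for X
      using that m F_cl r h_eq by (auto simp: C_eq elim!: q.quot_elim)
    moreover have "h m (X \<oplus>\<^bsub>C\<^esub> Y) = h m X \<oplus>\<^bsub>K\<^esub> h m Y" if XY: "X \<in> carrier C" "Y \<in> carrier C" for X Y
    proof -
      obtain \<phi> \<phi>' where p: "\<phi> \<in> carrier S1" "\<phi>' \<in> carrier S1" "X = Fim +>\<^bsub>S1\<^esub> \<phi>" "Y = Fim +>\<^bsub>S1\<^esub> \<phi>'"
        using XY by (auto simp: C_eq elim!: q.quot_elim)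
      then show ?thesis
        using m q.quot_add[OF p(1,2)] h_eq[OF q.M.add.m_closed[OF p(1,2)] m]
        by (simp add: C_eq h_eq r_add F_add r)
    qed
    moreover have "h m (c \<odot>\<^bsub>restrict_scalars A C\<^esub> X) = c \<otimes>\<^bsub>K\<^esub> h m X"
      if X: "X \<in> carrier C" and c: "c \<in> carrier K" for c X
    proof -
      obtain \<phi> where p: "\<phi> \<in> carrier S1" "X = Fim +>\<^bsub>S1\<^esub> \<phi>" using X by (auto simp: C_eq elim!: q.quot_elim)
      have sp: "scalar c \<odot>\<^bsub>S1\<^esub> \<phi> \<in> carrier S1" using p c by (intro q.smult_closed) (auto simp: star_simps(5))
      have "?r (scalar c \<odot>\<^bsub>S1\<^esub> \<phi>) m = c \<odot>\<^bsub>?H1\<^esub> ?r \<phi> m"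
        using p(1) c m by (auto simp: rank_one_def star_simps(4) hom_space_def fun_eq_iff \<phi>A
            scalar_def[symmetric] M.smult_assoc1[symmetric] scalar_mult_eq)
      then show ?thesis
        using q.quot_smult[of "scalar c" \<phi>] h_eq[OF sp m] h_eq[OF p(1) m] F_smult[OF c r[OF p(1) m]] p(1) c
        unfolding rsc p(2) by (simp add: C_eq star_simps(5))
    qed
    ultimately show ?thesis using h_ext[OF m]
      unfolding dual_simps module_hom_def rsc by (auto simp: PiE_def)
  qed
  have "h \<in> module_hom A M D"
  proof -
    have "h (m \<oplus>\<^bsub>M\<^esub> m') = h m \<oplus>\<^bsub>D\<^esub> h m'" if m: "m \<in> carrier M" "m' \<in> carrier M" for m m'
    proof (rule extensionalityI[of _ "carrier C"])
      fix X assume X: "X \<in> carrier C"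
      then obtain \<phi> where p: "\<phi> \<in> carrier S1" "X = Fim +>\<^bsub>S1\<^esub> \<phi>" by (auto simp: C_eq elim!: q.quot_elim)
      show "h (m \<oplus>\<^bsub>M\<^esub> m') X = (h m \<oplus>\<^bsub>D\<^esub> h m') X"
        using X p m by (simp add: dual_simps h_eq r_add' F_add r)
    qed (use m h_ext in \<open>auto simp: dual_simps\<close>)
    moreover have "h (a \<odot>\<^bsub>M\<^esub> m) = a \<odot>\<^bsub>D\<^esub> h m" if m: "a \<in> carrier A" "m \<in> carrier M" for a m
    proof (rule extensionalityI[of _ "carrier C"])
      fix X assume X: "X \<in> carrier C"
      then obtain \<phi> where p: "\<phi> \<in> carrier S1" "X = Fim +>\<^bsub>S1\<^esub> \<phi>" by (auto simp: C_eq elim!: q.quot_elim)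
      have sp: "a \<odot>\<^bsub>S1\<^esub> \<phi> \<in> carrier S1" using p m by (intro q.smult_closed) (auto simp: star_simps(5))
      show "h (a \<odot>\<^bsub>M\<^esub> m) X = (a \<odot>\<^bsub>D\<^esub> h m) X"
        unfolding dual_simps
        using X p m h_eq[OF sp m(2)] q.quot_smult[of a \<phi>] r_bal[OF p(1) m(2,1)]
        by (simp add: h_eq C_eq star_simps(5))
    qed (use m h_ext in \<open>auto simp: dual_simps\<close>)
    moreover have "h \<in> extensional (carrier M)" by (simp add: h_def)
    ultimately show ?thesis using hD unfolding module_hom_def by (auto simp: PiE_def)
  qed
  then have h0: "h = zero_hom M D" using hom by blast
  have r0: "F (?r \<phi> m) = \<zero>\<^bsub>K\<^esub>" if "\<phi> \<in> carrier S1" "m \<in> carrier M" for \<phi> m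
    using h_eq[OF that] that unfolding h0 zero_hom_def dual_simps by (simp add: C_eq)
  have p: "\<And>i. i < n1 \<Longrightarrow> ?r (\<phi>1 i) (\<psi> (p1 i)) \<in> carrier ?H1"
    using r d1 hom_closed[OF \<psi>] by (simp add: star_simps)
  have "\<psi> = finsum ?H1 (\<lambda>i. ?r (\<phi>1 i) (\<psi> (p1 i))) {..<n1}"
  proof (rule hom_eqI[OF \<psi>])
    have "finsum ?H1 (\<lambda>i. ?r (\<phi>1 i) (\<psi> (p1 i))) {..<n1} \<in> carrier ?H1"
      by (rule H1.M.finsum_closed) (use p in auto)
    then show "finsum ?H1 (\<lambda>i. ?r (\<phi>1 i) (\<psi> (p1 i))) {..<n1} \<in> module_hom A P1 M" by (simp add: cH)
    fix x assume x: "x \<in> carrier P1"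
    have "finsum ?H1 (\<lambda>i. ?r (\<phi>1 i) (\<psi> (p1 i))) {..<n1} x = finsum M (\<lambda>i. ?r (\<phi>1 i) (\<psi> (p1 i)) x) {..<n1}"
      using p x by (intro hom_group_finsum[OF P1 M hom_group_hom_space]) (auto simp: cH)
    also have "\<dots> = \<psi> x" using hom_dual_basis[OF P1 M db1 \<psi> x] x by (simp add: rank_one_def)
    finally show "\<psi> x = finsum ?H1 (\<lambda>i. ?r (\<phi>1 i) (\<psi> (p1 i))) {..<n1} x" by simp
  qed
  then have "F \<psi> = F (finsum ?H1 (\<lambda>i. ?r (\<phi>1 i) (\<psi> (p1 i))) {..<n1})" by simp
  also have "\<dots> = finsum K (\<lambda>i. F (?r (\<phi>1 i) (\<psi> (p1 i)))) {..<n1}"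
    using p by (intro additive_finsum[of ?H1 K F]) (auto simp: F_cl F_add H1.M.abelian_group_axioms K.abelian_group_axioms)
  also have "\<dots> = finsum K (\<lambda>i. \<zero>\<^bsub>K\<^esub>) {..<n1}"
    using r0 d1 hom_closed[OF \<psi>] by (intro K.finsum_cong') (auto simp: star_simps)
  finally show False using F_\<psi> by simp
qed

end

section \<open>Multiples of a module by an ideal\<close>

text \<open>The submodule \<open>JM\<close> of finite sums of products of an element of \<open>J\<close> and an element of \<open>M\<close>.\<close>
inductive_set ideal_smult :: "'a set \<Rightarrow> ('a, 'b, 'm) module_scheme \<Rightarrow> 'b set"
  for J and M where
    smult: "j \<in> J \<Longrightarrow> x \<in> carrier M \<Longrightarrow> j \<odot>\<^bsub>M\<^esub> x \<in> ideal_smult J M"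
  | add: "x \<in> ideal_smult J M \<Longrightarrow> y \<in> ideal_smult J M \<Longrightarrow> x \<oplus>\<^bsub>M\<^esub> y \<in> ideal_smult J M"

lemma ideal_smult_least:
  assumes "left_module A M" "submodule X A M" "\<And>j x. j \<in> J \<Longrightarrow> x \<in> carrier M \<Longrightarrow> j \<odot>\<^bsub>M\<^esub> x \<in> X"
  shows "ideal_smult J M \<subseteq> X"
proof
  fix y assume "y \<in> ideal_smult J M"
  then show "y \<in> X"
    by induct (use assms in \<open>auto simp: left_module.submodule_iff[OF assms(1)]\<close>)
qed

lemma ideal_smult_submodule:
  assumes M: "left_module A M" and J: "ideal J A"
  shows "submodule (ideal_smult J M) A M"
proof -
  interpret M: left_module A M by (rule M)
  interpret J: ideal J A by (rule J)
  have c: "x \<in> carrier M" if "x \<in> ideal_smult J M" for x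
    using that by induct (auto simp: J.a_Hcarr)
  have 0: "\<zero>\<^bsub>M\<^esub> \<in> ideal_smult J M"
    using ideal_smult.smult[of "\<zero>\<^bsub>A\<^esub>" J "\<zero>\<^bsub>M\<^esub>" M] J.additive_subgroup_axioms
    by (simp add: additive_subgroup.zero_closed)
  have s: "a \<odot>\<^bsub>M\<^esub> x \<in> ideal_smult J M" if a: "a \<in> carrier A" and x: "x \<in> ideal_smult J M" for a x
    using x
  proof induct
    case (smult j x)
    then show ?case
      using a ideal_smult.smult[of "a \<otimes>\<^bsub>A\<^esub> j" J x M] J.I_l_closed[of j a] by (simp add: M.smult_assoc1 J.a_Hcarr)
  next
    case (add x y)
    then show ?case using a c by (simp add: M.smult_r_distr ideal_smult.add)
  qed
  show ?thesis unfolding M.submodule_iff using c 0 s by (auto intro: ideal_smult.add)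
qed

lemma hom_ideal_smult_surj:
  assumes h: "h \<in> module_hom A M N" and M: "left_module A M" and J: "ideal J A"
    and surj: "h ` carrier M = carrier N" and y: "y \<in> ideal_smult J N"
  shows "\<exists>x\<in>ideal_smult J M. h x = y"
proof -
  interpret M: left_module A M by (rule M)
  interpret J: ideal J A by (rule J)
  have c: "\<And>x. x \<in> ideal_smult J M \<Longrightarrow> x \<in> carrier M"
    using ideal_smult_submodule[OF M J] by (auto simp: M.submodule_iff)
  show ?thesis using y
  proof induct
    case (smult j y)
    obtain x where "x \<in> carrier M" "h x = y" using surj smult(2) by (metis imageE)
    then show ?case using smult(1) hom_smult[OF h, of j x]
      by (intro bexI[of _ "j \<odot>\<^bsub>M\<^esub> x"]) (auto simp: J.a_Hcarr intro: ideal_smult.intros)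
  next
    case (add y z)
    from add(2,4) obtain u v where "u \<in> ideal_smult J M" "h u = y" "v \<in> ideal_smult J M" "h v = z"
      by blast
    then show ?case using hom_add[OF h, of u v] c
      by (intro bexI[of _ "u \<oplus>\<^bsub>M\<^esub> v"]) (auto intro: ideal_smult.intros)
  qed
qed

section \<open>Modules over a quotient algebra\<close>

lemma ring_with_smult:
  assumes "ring G" shows "ring (with_smult G s)"
proof -
  interpret ring G by fact
  show ?thesis
  proof (rule ringI)
    show "abelian_group (with_smult G s)"
      using abelian_groupE[OF is_abelian_group] by (intro abelian_groupI) simp_all
    show "Group.monoid (with_smult G s)"
      by (rule monoidI) (simp_all add: m_assoc)
  qed (simp_all add: l_distr r_distr)
qed

text \<open>A \<open>K\<close>-algebra \<open>A\<close> with an ideal \<open>J\<close>, and the quotient algebra \<open>B = A/J\<close>.\<close>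
locale quotient_algebra = k_algebra K A
  for K :: "('k, 'c) ring_scheme" and A :: "('k, 'a) module" +
  fixes J :: "'a set"
  assumes J: "ideal J A"
begin

abbreviation "B \<equiv> A /\<^sub>m J"

sublocale quot: module_with_submodule K A J
proof (intro module_with_submodule.intro module_with_submodule_axioms.intro vector_space)
  interpret J: ideal J A by (rule J)
  interpret V: left_module K A by (rule vector_space)
  have "c \<odot>\<^bsub>A\<^esub> j \<in> J" if "c \<in> carrier K" "j \<in> J" for c j
    using that J.I_l_closed[of j "scalar c"] scalar_mult_eq(1)[of c j] by (simp add: J.a_Hcarr)
  then show "submodule J K A"
    unfolding V.submodule_iff
    using J.a_subset J.additive_subgroup_axioms
    by (auto simp: additive_subgroup.zero_closed additive_subgroup.a_closed)
qed

lemma B_mult: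
  assumes "a \<in> carrier A" "b \<in> carrier A"
  shows "(J +>\<^bsub>A\<^esub> a) \<otimes>\<^bsub>B\<^esub> (J +>\<^bsub>A\<^esub> b) = J +>\<^bsub>A\<^esub> (a \<otimes>\<^bsub>A\<^esub> b)"
  using ideal.rcoset_mult_add[OF J assms] by (simp add: quot_module_def FactRing_def)

lemma B_one: "\<one>\<^bsub>B\<^esub> = J +>\<^bsub>A\<^esub> \<one>\<^bsub>A\<^esub>"
  by (simp add: quot_module_def FactRing_def)

lemma B_ring: "ring B"
  unfolding quot_module_def by (rule ring_with_smult[OF ideal.quotient_is_ring[OF J]])

lemma k_algebra_quotient: "k_algebra K B"
proof (intro k_algebra.intro)
  interpret A: ring A by (rule alg_ring)
  interpret K: field K by (rule field)
  interpret B: ring B by (rule B_ring)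
  show "field K" by (rule field)
  show "ring B" by (rule B_ring)
  show "left_module K B"
    by (rule left_moduleI)
      (auto elim!: quot.quot_elim intro!: quot.R.ring_axioms B.is_abelian_group simp: quot.quot_smult quot.quot_add
        quot.smult_l_distr quot.smult_r_distr quot.smult_assoc1)
  show "(c \<odot>\<^bsub>B\<^esub> a) \<otimes>\<^bsub>B\<^esub> b = c \<odot>\<^bsub>B\<^esub> (a \<otimes>\<^bsub>B\<^esub> b)"
    "a \<otimes>\<^bsub>B\<^esub> (c \<odot>\<^bsub>B\<^esub> b) = c \<odot>\<^bsub>B\<^esub> (a \<otimes>\<^bsub>B\<^esub> b)"
    if "c \<in> carrier K" "a \<in> carrier B" "b \<in> carrier B" for c a b
    using that by (auto elim!: quot.quot_elim simp: quot.quot_smult B_mult smult_mult_left smult_mult_right)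
qed

text \<open>\<open>N\<close> is the \<open>B\<close>-module \<open>N'\<close>, regarded as an \<open>A\<close>-module. All notions of the module category agree
  on corresponding modules, so that most of the work can be done over \<open>A\<close>.\<close>
definition corresponds :: "('a, 'b) module \<Rightarrow> ('a set, 'b) module \<Rightarrow> bool"
  where "corresponds N N' \<longleftrightarrow> carrier N' = carrier N \<and> \<zero>\<^bsub>N'\<^esub> = \<zero>\<^bsub>N\<^esub> \<and> add N' = add N \<and>
    (\<forall>a\<in>carrier A. \<forall>x\<in>carrier N. (J +>\<^bsub>A\<^esub> a) \<odot>\<^bsub>N'\<^esub> x = a \<odot>\<^bsub>N\<^esub> x)"

text \<open>\<open>N\<close> is an \<open>A\<close>-module with \<open>JN = 0\<close>.\<close>
definition annihilated :: "('a, 'b) module \<Rightarrow> bool"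
  where "annihilated N \<longleftrightarrow> left_module A N \<and> (\<forall>j\<in>J. \<forall>x\<in>carrier N. j \<odot>\<^bsub>N\<^esub> x = \<zero>\<^bsub>N\<^esub>)"

text \<open>Restriction of scalars along \<open>A \<rightarrow> B\<close>.\<close>
definition inflate :: "('a set, 'b) module \<Rightarrow> ('a, 'b) module"
  where "inflate N = with_smult N (\<lambda>a x. (J +>\<^bsub>A\<^esub> a) \<odot>\<^bsub>N\<^esub> x)"

text \<open>The \<open>B\<close>-module given by an \<open>A\<close>-module that \<open>J\<close> annihilates; a coset acts by any of its elements.\<close>
definition deflate :: "('a, 'b) module \<Rightarrow> ('a set, 'b) module"
  where "deflate N = with_smult N (\<lambda>X x. (SOME a. a \<in> X) \<odot>\<^bsub>N\<^esub> x)"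

lemma corresponds_inflate: "corresponds (inflate N) N"
  by (simp add: corresponds_def inflate_def)

lemma corresponds_deflate:
  assumes "annihilated N" shows "corresponds N (deflate N)"
proof -
  interpret N: left_module A N using assms by (simp add: annihilated_def)
  have "(SOME b. b \<in> J +>\<^bsub>A\<^esub> a) \<odot>\<^bsub>N\<^esub> x = a \<odot>\<^bsub>N\<^esub> x" if a: "a \<in> carrier A" and x: "x \<in> carrier N" for a x
  proof -
    let ?b = "SOME b. b \<in> J +>\<^bsub>A\<^esub> a"
    have "a \<in> J +>\<^bsub>A\<^esub> a" using a by (rule quot.coset_self)
    then have "?b \<in> J +>\<^bsub>A\<^esub> a" by (rule someI)
    then have b: "?b \<in> carrier A" "?b \<ominus>\<^bsub>A\<^esub> a \<in> J" using a by (auto simp: quot.mem_coset_iff)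
    then have "(?b \<ominus>\<^bsub>A\<^esub> a) \<odot>\<^bsub>N\<^esub> x = \<zero>\<^bsub>N\<^esub>" using assms x by (auto simp: annihilated_def)
    then have "?b \<odot>\<^bsub>N\<^esub> x \<ominus>\<^bsub>N\<^esub> a \<odot>\<^bsub>N\<^esub> x = \<zero>\<^bsub>N\<^esub>" using b(1) a x by (simp add: N.smult_l_diff)
    then show ?thesis using a b(1) x by (subst (asm) N.diff_eq_zero_iff) auto
  qed
  then show ?thesis by (simp add: corresponds_def deflate_def)
qed

lemma corresponds_left_module:
  assumes c: "corresponds N N'" and N: "left_module A N" shows "left_module B N'"
proof -
  interpret N: left_module A N by (rule N)
  show ?thesis
  proof (rule left_moduleI)
    show "abelian_group N'"
      using abelian_groupE[OF N.M.abelian_group_axioms] c by (intro abelian_groupI) (simp_all add: corresponds_def)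
  qed (use c in \<open>auto elim!: quot.quot_elim simp: corresponds_def B_ring B_one B_mult quot.quot_add
      N.smult_l_distr N.smult_r_distr N.smult_assoc1\<close>)
qed

lemma left_module_inflate:
  assumes N: "left_module B N" shows "annihilated (inflate N)"
proof -
  interpret N: left_module B N by (rule N)
  interpret A: ring A by (rule alg_ring)
  have "left_module A (inflate N)"
  proof (rule left_moduleI)
    show "abelian_group (inflate N)"
      using abelian_groupE[OF N.M.abelian_group_axioms] by (intro abelian_groupI) (simp_all add: inflate_def)
  qed (auto simp: inflate_def alg_ring N.smult_r_distr B_mult[symmetric] B_one[symmetric]
      N.smult_l_distr N.smult_assoc1 quot.quot_add[symmetric])
  moreover have "J +>\<^bsub>A\<^esub> j = \<zero>\<^bsub>B\<^esub>" if "j \<in> J" for j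
    using that quot.coset_eq_self_iff[of j] quot.submod quot.submodule_iff quot.quot_zero by auto
  ultimately show ?thesis by (simp add: annihilated_def inflate_def)
qed

lemma corresponds_hom:
  assumes "corresponds M M'" "corresponds N N'" "left_module A M"
  shows "module_hom B M' N' = module_hom A M N"
proof -
  have "(\<forall>X\<in>carrier B. \<forall>x\<in>carrier M. h (X \<odot>\<^bsub>M'\<^esub> x) = X \<odot>\<^bsub>N'\<^esub> h x) \<longleftrightarrow>
      (\<forall>a\<in>carrier A. \<forall>x\<in>carrier M. h (a \<odot>\<^bsub>M\<^esub> x) = a \<odot>\<^bsub>N\<^esub> h x)"
    if "h \<in> carrier M \<rightarrow> carrier N" for h
    using assms that unfolding quot.carrier_quot by (auto simp: corresponds_def Pi_def)
  moreover have "carrier M' = carrier M" "carrier N' = carrier N" "add M' = add M" "add N' = add N"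
    using assms by (auto simp: corresponds_def)
  ultimately show ?thesis by (auto simp: module_hom_def PiE_def)
qed

lemma corresponds_submodule:
  assumes c: "corresponds N N'" and N: "left_module A N"
  shows "submodule X B N' \<longleftrightarrow> submodule X A N"
proof -
  have "(\<forall>b\<in>carrier B. \<forall>x\<in>X. b \<odot>\<^bsub>N'\<^esub> x \<in> X) \<longleftrightarrow> (\<forall>a\<in>carrier A. \<forall>x\<in>X. a \<odot>\<^bsub>N\<^esub> x \<in> X)"
    if "X \<subseteq> carrier N"
    using c that unfolding quot.carrier_quot by (auto simp: corresponds_def subset_iff)
  then show ?thesis
    unfolding left_module.submodule_iff[OF corresponds_left_module[OF c N]] left_module.submodule_iff[OF N]
    using c by (auto simp: corresponds_def)
qed

lemma corresponds_fin_gen: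
  assumes "corresponds N N'" "left_module A N" shows "fin_gen B N' \<longleftrightarrow> fin_gen A N"
  using assms unfolding fin_gen_def corresponds_submodule[OF assms] by (simp add: corresponds_def)

lemma corresponds_superfluous:
  assumes "corresponds N N'" "left_module A N" shows "superfluous B N' X \<longleftrightarrow> superfluous A N X"
  using assms unfolding superfluous_def corresponds_submodule[OF assms]
  by (simp add: corresponds_def set_add_def')

lemma corresponds_restrict_carrier:
  "corresponds N N' \<Longrightarrow> X \<subseteq> carrier N \<Longrightarrow> corresponds (N\<lparr>carrier := X\<rparr>) (N'\<lparr>carrier := X\<rparr>)"
  by (auto simp: corresponds_def)

lemma corresponds_indecomposable:
  assumes "corresponds N N'" "left_module A N" shows "indecomposable B N' \<longleftrightarrow> indecomposable A N"
  using assms unfolding indecomposable_def corresponds_submodule[OF assms]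
  by (simp add: corresponds_def set_add_def')

lemma corresponds_mod_cat:
  assumes "corresponds N N'" "left_module A N" shows "N' \<in> mod_cat B \<longleftrightarrow> N \<in> mod_cat A"
  using assms by (auto simp: mod_cat_def corresponds_fin_gen corresponds_left_module)

section \<open>Reduction modulo an ideal\<close>

abbreviation reduce_map :: "('a, 'b) module \<Rightarrow> 'b \<Rightarrow> 'b" (\<open>\<rho>\<close>)
  where "\<rho> M \<equiv> coset_rep M (ideal_smult J M)"

text \<open>\<open>M/JM\<close> as an \<open>A\<close>-module, on a set of representatives. The map \<open>\<rho> M\<close> is the projection.\<close>
definition reduce :: "('a, 'b) module \<Rightarrow> ('a, 'b) module"
  where "reduce M = image_module M (\<rho> M)"

text \<open>\<open>M/JM\<close> as a module over \<open>B = A/J\<close>.\<close>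
definition reduction :: "('a, 'b) module \<Rightarrow> ('a set, 'b) module"
  where "reduction M = deflate (reduce M)"

lemma reduce_map:
  assumes "left_module A M" shows "module_quotient_map A M (ideal_smult J M) (\<rho> M)"
  by (rule module_quotient_map_coset_rep[OF assms ideal_smult_submodule[OF assms J]])

lemma reduce_facts:
  assumes M: "left_module A M"
  shows "left_module A (reduce M)"
    and "carrier (reduce M) = \<rho> M ` carrier M"
    and "restrict (\<rho> M) (carrier M) \<in> module_hom A M (reduce M)"
    and "x \<in> carrier M \<Longrightarrow> \<rho> M x \<in> carrier (reduce M)"
    and "x \<in> carrier M \<Longrightarrow> y \<in> carrier M \<Longrightarrow> \<rho> M (x \<oplus>\<^bsub>M\<^esub> y) = \<rho> M x \<oplus>\<^bsub>reduce M\<^esub> \<rho> M y"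
    and "a \<in> carrier A \<Longrightarrow> x \<in> carrier M \<Longrightarrow> \<rho> M (a \<odot>\<^bsub>M\<^esub> x) = a \<odot>\<^bsub>reduce M\<^esub> \<rho> M x"
    and "x \<in> carrier M \<Longrightarrow> \<rho> M x = \<zero>\<^bsub>reduce M\<^esub> \<longleftrightarrow> x \<in> ideal_smult J M"
    and "x \<in> carrier M \<Longrightarrow> y \<in> carrier M \<Longrightarrow> \<rho> M x = \<rho> M y \<longleftrightarrow> x \<ominus>\<^bsub>M\<^esub> y \<in> ideal_smult J M"
    and "annihilated (reduce M)"
    and "fin_gen A M \<Longrightarrow> fin_gen A (reduce M)"
proof -
  interpret q: module_quotient_map A M "ideal_smult J M" "\<rho> M" by (rule reduce_map[OF M])
  show lm: "left_module A (reduce M)" and "carrier (reduce M) = \<rho> M ` carrier M"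
    and "restrict (\<rho> M) (carrier M) \<in> module_hom A M (reduce M)"
    unfolding reduce_def by (rule q.left_module_image q.carrier_image q.quotient_hom)+
  show "x \<in> carrier M \<Longrightarrow> \<rho> M x \<in> carrier (reduce M)"
    and "x \<in> carrier M \<Longrightarrow> y \<in> carrier M \<Longrightarrow> \<rho> M (x \<oplus>\<^bsub>M\<^esub> y) = \<rho> M x \<oplus>\<^bsub>reduce M\<^esub> \<rho> M y"
    and sm: "\<And>a x. a \<in> carrier A \<Longrightarrow> x \<in> carrier M \<Longrightarrow> \<rho> M (a \<odot>\<^bsub>M\<^esub> x) = a \<odot>\<^bsub>reduce M\<^esub> \<rho> M x"
    and z: "\<And>x. x \<in> carrier M \<Longrightarrow> \<rho> M x = \<zero>\<^bsub>reduce M\<^esub> \<longleftrightarrow> x \<in> ideal_smult J M"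
    and "x \<in> carrier M \<Longrightarrow> y \<in> carrier M \<Longrightarrow> \<rho> M x = \<rho> M y \<longleftrightarrow> x \<ominus>\<^bsub>M\<^esub> y \<in> ideal_smult J M"
    and "fin_gen A M \<Longrightarrow> fin_gen A (reduce M)"
    unfolding reduce_def by (simp_all add: q.q_add q.q_smult q.q_eq_zero_iff q.q_eq_iff q.fin_gen_quotient)
  show "annihilated (reduce M)" unfolding annihilated_def
  proof (intro conjI ballI lm)
    fix j y assume j: "j \<in> J" and "y \<in> carrier (reduce M)"
    then obtain x where x: "x \<in> carrier M" "y = \<rho> M x" unfolding reduce_def by (auto elim: q.image_elim)
    have jA: "j \<in> carrier A" using j J by (meson ideal.Icarr)
    show "j \<odot>\<^bsub>reduce M\<^esub> y = \<zero>\<^bsub>reduce M\<^esub>"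
      using sm[OF jA x(1)] z[of "j \<odot>\<^bsub>M\<^esub> x"] ideal_smult.smult[OF j x(1)] x jA by simp
  qed
qed

lemma corresponds_reduction: "left_module A M \<Longrightarrow> corresponds (reduce M) (reduction M)"
  unfolding reduction_def by (intro corresponds_deflate reduce_facts)

lemma left_module_reduction: "left_module A M \<Longrightarrow> left_module B (reduction M)"
  by (rule corresponds_left_module[OF corresponds_reduction reduce_facts(1)])

lemma reduce_elim:
  assumes "left_module A M" "y \<in> carrier (reduce M)" obtains x where "x \<in> carrier M" "y = \<rho> M x"
  using assms reduce_facts(2)[OF assms(1)] by blast

lemma hom_descends:
  assumes M: "left_module A M" and N: "annihilated N" and h: "h \<in> module_hom A M N"
  obtains h' where "h' \<in> module_hom A (reduce M) N" "\<And>x. x \<in> carrier M \<Longrightarrow> h' (\<rho> M x) = h x"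
proof -
  interpret M: left_module A M by (rule M)
  have Nm: "left_module A N" using N by (simp add: annihilated_def)
  interpret N: left_module A N by (rule Nm)
  note r = reduce_facts[OF M]
  interpret q: module_quotient_map A M "ideal_smult J M" "\<rho> M" by (rule reduce_map[OF M])
  let ?s = "inv_into (carrier M) (\<rho> M)"
  have zero: "ideal_smult J M \<subseteq> {x \<in> carrier M. h x \<in> {\<zero>\<^bsub>N\<^esub>}}"
  proof (rule ideal_smult_least[OF M hom_vimage_submodule[OF M Nm h N.submodule_zero]])
    fix j x assume "j \<in> J" "x \<in> carrier M"
    moreover then have "j \<in> carrier A" using J by (meson ideal.Icarr)
    ultimately show "j \<odot>\<^bsub>M\<^esub> x \<in> {x \<in> carrier M. h x \<in> {\<zero>\<^bsub>N\<^esub>}}"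
      using N hom_closed[OF h] by (simp add: hom_smult[OF h] annihilated_def)
  qed
  have eq: "h (?s (\<rho> M x)) = h x" if x: "x \<in> carrier M" for x
  proof -
    have "h (?s (\<rho> M x) \<ominus>\<^bsub>M\<^esub> x) = \<zero>\<^bsub>N\<^esub>" "?s (\<rho> M x) \<in> carrier M" using q.q_inv[OF x] zero by auto
    then show ?thesis using hom_diff[OF M Nm h, of "?s (\<rho> M x)" x] x hom_closed[OF h]
      by (simp add: N.diff_eq_zero_iff)
  qed
  let ?h = "restrict (\<lambda>y. h (?s y)) (carrier (reduce M))"
  show ?thesis
  proof
    show "?h \<in> module_hom A (reduce M) N"
    proof (rule module_homI)
      fix x y assume "x \<in> carrier (reduce M)" "y \<in> carrier (reduce M)"
      then obtain u v where u: "u \<in> carrier M" "x = \<rho> M u" "v \<in> carrier M" "y = \<rho> M v"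
        by (auto elim!: reduce_elim[OF M])
      then show "h (?s (x \<oplus>\<^bsub>reduce M\<^esub> y)) = h (?s x) \<oplus>\<^bsub>N\<^esub> h (?s y)"
        by (simp add: eq hom_add[OF h] flip: r(5))
    next
      fix a x assume a: "a \<in> carrier A" and "x \<in> carrier (reduce M)"
      then obtain u where u: "u \<in> carrier M" "x = \<rho> M u" by (auto elim!: reduce_elim[OF M])
      then show "h (?s (a \<odot>\<^bsub>reduce M\<^esub> x)) = a \<odot>\<^bsub>N\<^esub> h (?s x)"
        using a by (simp add: eq hom_smult[OF h] flip: r(6))
    qed (auto elim!: reduce_elim[OF M] simp: eq hom_closed[OF h] r(1))
    show "?h (\<rho> M x) = h x" if "x \<in> carrier M" for x using eq[OF that] r(4)[OF that] by simp
  qed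
qed

end

context quotient_algebra
begin

lemma hom_to_corresponding:
  assumes "left_module A M" "corresponds N N'" "left_module A N"
  shows "module_hom B (reduction M) N' = module_hom A (reduce M) N"
  by (rule corresponds_hom[OF corresponds_reduction assms(2) reduce_facts(1)]) (rule assms)+

lemma reduction_simps:
  assumes "left_module A M"
  shows "carrier (reduction M) = carrier (reduce M)" "\<zero>\<^bsub>reduction M\<^esub> = \<zero>\<^bsub>reduce M\<^esub>"
    "add (reduction M) = add (reduce M)"
  using corresponds_reduction[OF assms] by (auto simp: corresponds_def)

lemma projective_reduction:
  fixes P :: "('a, 'l) fmod"
  assumes proj: "projective A P" shows "projective B (reduction P)"
proof -
  have P: "left_module A P" "fin_gen A P" using proj by (auto simp: projective_def mod_cat_def)
  note r = reduce_facts[OF P(1)]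
  have cat: "reduction P \<in> mod_cat B"
    using corresponds_mod_cat[OF corresponds_reduction[OF P(1)] r(1)] r(1,10) P(2) by (simp add: mod_cat_def)
  have "\<exists>h'\<in>module_hom B (reduction P) X. compose (carrier (reduction P)) g h' = h"
    if X: "X \<in> mod_cat B" and Y: "Y \<in> mod_cat B" and g: "g \<in> module_hom B X Y"
      and h: "h \<in> module_hom B (reduction P) Y" and surj: "g ` carrier X = carrier Y"
    for X Y :: "('a set, 'l) fmod" and g h
  proof -
    let ?X = "inflate X" and ?Y = "inflate Y"
    have aX: "annihilated ?X" and aY: "annihilated ?Y" using X Y left_module_inflate by (auto simp: mod_cat_def)
    then have lX: "left_module A ?X" and lY: "left_module A ?Y" by (auto simp: annihilated_def)
    have cX: "?X \<in> mod_cat A" and cY: "?Y \<in> mod_cat A"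
      using X Y corresponds_mod_cat[OF corresponds_inflate] lX lY by blast+
    have g': "g \<in> module_hom A ?X ?Y" using g corresponds_hom[OF corresponds_inflate[of X] corresponds_inflate[of Y] lX] by simp
    have h': "h \<in> module_hom A (reduce P) ?Y"
      using h hom_to_corresponding[OF P(1) corresponds_inflate lY] by simp
    have car: "carrier ?X = carrier X" "carrier ?Y = carrier Y" by (simp_all add: inflate_def)
    obtain k where k: "k \<in> module_hom A P ?X"
      and gk: "compose (carrier P) g k = compose (carrier P) h (restrict (\<rho> P) (carrier P))"
      using proj cX cY g' hom_comp[OF r(3) h' P(1)] surj unfolding projective_def car[symmetric] by blast
    obtain k' where k': "k' \<in> module_hom A (reduce P) ?X" "\<And>x. x \<in> carrier P \<Longrightarrow> k' (\<rho> P x) = k x"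
      using hom_descends[OF P(1) aX k] by blast
    have "compose (carrier (reduce P)) g k' = h"
    proof (rule hom_eqI[OF hom_comp[OF k'(1) g' r(1)] h'])
      fix y assume y: "y \<in> carrier (reduce P)"
      then obtain x where x: "x \<in> carrier P" "y = \<rho> P x" by (rule reduce_elim[OF P(1)])
      have "g (k x) = h (\<rho> P x)" using fun_cong[OF gk, of x] x(1) by (simp add: compose_def)
      then show "compose (carrier (reduce P)) g k' y = h y" using x y k' by (simp add: compose_def)
    qed
    then show ?thesis
      using k'(1) hom_to_corresponding[OF P(1) corresponds_inflate lX] reduction_simps[OF P(1)] by auto
  qed
  then show ?thesis using cat by (auto simp: projective_def)
qed

lemma preimage_split:
  assumes P: "left_module A P" and U: "submodule U A (reduce P)"
    and p: "p \<in> carrier P" and k: "k \<in> carrier P" and u: "u \<in> U" and eq: "\<rho> P p = \<rho> P k \<oplus>\<^bsub>reduce P\<^esub> u"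
  shows "\<exists>y\<in>{x \<in> carrier P. \<rho> P x \<in> U}. p = k \<oplus>\<^bsub>P\<^esub> y"
proof -
  note r = reduce_facts[OF P]
  interpret P: left_module A P by (rule P)
  interpret R: left_module A "reduce P" by (rule r(1))
  have uc: "u \<in> carrier (reduce P)" using U u unfolding R.submodule_iff by blast
  have d: "p \<ominus>\<^bsub>P\<^esub> k \<in> carrier P" using p k by simp
  have "\<rho> P (p \<ominus>\<^bsub>P\<^esub> k) \<oplus>\<^bsub>reduce P\<^esub> \<rho> P k = \<rho> P p"
    using r(5)[OF d k] P.diff_add_cancel[OF p k] by simp
  also have "\<dots> = u \<oplus>\<^bsub>reduce P\<^esub> \<rho> P k"
    unfolding eq by (rule R.M.a_comm[OF r(4)[OF k] uc])
  finally have "\<rho> P (p \<ominus>\<^bsub>P\<^esub> k) = u"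
    using R.add_diff_cancel[OF r(4)[OF d] r(4)[OF k]] R.add_diff_cancel[OF uc r(4)[OF k]] by metis
  then show ?thesis
    using u d P.diff_add_cancel[OF p k] P.M.a_comm[OF k d] by (intro bexI[of _ "p \<ominus>\<^bsub>P\<^esub> k"]) auto
qed

section \<open>Reduction of presentations and of tau-rigid modules\<close>

text \<open>The kernel of \<open>P0/JP0 \<rightarrow> M/JM\<close> is the image of the kernel \<open>K1\<close> of \<open>P0 \<rightarrow> M\<close>, hence the quotient of
  \<open>K1\<close> by \<open>K1 \<inter> JP0\<close>. If the latter is superfluous in \<open>K1\<close>, then \<open>P1 \<rightarrow> K1/(K1 \<inter> JP0)\<close> still has a
  superfluous kernel, and so the reduction of a minimal presentation is minimal.\<close>
lemma reduced_presentation: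
  fixes M P1 P0 :: "('a, 'l) fmod"
  assumes pres: "minimal_projective_presentation A P1 P0 M f g" and M: "left_module A M"
    and small: "superfluous A (P0\<lparr>carrier := a_kernel P0 M g\<rparr>) (a_kernel P0 M g \<inter> ideal_smult J P0)"
  obtains f' g' where
    "minimal_projective_presentation B (reduction P1) (reduction P0) (reduction M) f' g'"
    "\<And>x. x \<in> carrier P1 \<Longrightarrow> f' (\<rho> P1 x) = \<rho> P0 (f x)"
    "\<And>x. x \<in> carrier P0 \<Longrightarrow> g' (\<rho> P0 x) = \<rho> M (g x)"
proof -
  let ?K = "a_kernel P0 M g"
  let ?PK = "P0\<lparr>carrier := ?K\<rparr>"
  have proj: "projective A P0" "projective A P1" and g: "g \<in> module_hom A P0 M" "g ` carrier P0 = carrier M"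
    and sup0: "superfluous A P0 ?K" and f: "f \<in> module_hom A P1 ?PK" "f ` carrier P1 = ?K"
    and sup1: "superfluous A P1 (a_kernel P1 ?PK f)"
    using pres by (auto simp: minimal_projective_presentation_def projective_cover_def)
  have P0: "left_module A P0" and P1: "left_module A P1" using proj by (auto simp: projective_def mod_cat_def)
  interpret P0: left_module A P0 by (rule P0)
  interpret P1: left_module A P1 by (rule P1)
  interpret M: left_module A M by (rule M)
  have Ksub: "submodule ?K A P0" by (rule submodule_kernel[OF P0 M g(1)])
  then have K_c: "?K \<subseteq> carrier P0" by (simp add: P0.submodule_iff)
  have PK: "left_module A ?PK" by (rule P0.left_module_submodule[OF Ksub])
  have f0: "f \<in> module_hom A P1 P0" by (rule hom_restrict_target[OF f(1) K_c])
  note r0 = reduce_facts[OF P0] and r1 = reduce_facts[OF P1] and rM = reduce_facts[OF M]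
  have JP: "submodule (ideal_smult J P0) A P0" "submodule (ideal_smult J P1) A P1" "submodule (ideal_smult J M) A M"
    by (rule ideal_smult_submodule[OF _ J]; rule P0 P1 M)+
  obtain g' where g': "g' \<in> module_hom A (reduce P0) (reduce M)"
    and g'_eq0: "\<And>x. x \<in> carrier P0 \<Longrightarrow> g' (\<rho> P0 x) = compose (carrier P0) (restrict (\<rho> M) (carrier M)) g x"
    by (rule hom_descends[OF P0 rM(9) hom_comp[OF g(1) rM(3) P0]]) blast
  have g'_eq: "g' (\<rho> P0 x) = \<rho> M (g x)" if "x \<in> carrier P0" for x
    using g'_eq0[OF that] that hom_closed[OF g(1)] by (simp add: compose_def)
  have ker: "a_kernel (reduce P0) (reduce M) g' = \<rho> P0 ` ?K"
  proof (intro equalityI subsetI)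
    fix y assume "y \<in> \<rho> P0 ` ?K"
    then obtain k where k: "k \<in> ?K" "y = \<rho> P0 k" by blast
    then have "k \<in> carrier P0" "g k = \<zero>\<^bsub>M\<^esub>" by (auto simp: a_kernel_iff)
    then show "y \<in> a_kernel (reduce P0) (reduce M) g'"
      using k JP(3) r0(4) g'_eq[of k] rM(7)[of "\<zero>\<^bsub>M\<^esub>"] by (simp add: a_kernel_iff M.submodule_iff)
  next
    fix y assume "y \<in> a_kernel (reduce P0) (reduce M) g'"
    then obtain x where x: "x \<in> carrier P0" "y = \<rho> P0 x" "\<rho> M (g x) = \<zero>\<^bsub>reduce M\<^esub>"
      using g'_eq by (auto simp: a_kernel_iff elim!: reduce_elim[OF P0])
    then have "g x \<in> ideal_smult J M" using rM(7) hom_closed[OF g(1)] by blast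
    then obtain j where j: "j \<in> ideal_smult J P0" "g j = g x"
      using hom_ideal_smult_surj[OF g(1) P0 J g(2)] by blast
    have jc: "j \<in> carrier P0" using j JP(1) by (auto simp: P0.submodule_iff)
    have k: "x \<ominus>\<^bsub>P0\<^esub> j \<in> ?K"
      using x jc j(2) hom_diff[OF P0 M g(1) x(1) jc] M.diff_eq_zero_iff hom_closed[OF g(1)] by (simp add: a_kernel_iff)
    have "x \<ominus>\<^bsub>P0\<^esub> (x \<ominus>\<^bsub>P0\<^esub> j) = j"
      using x jc P0.add_diff_cancel[of j "x \<ominus>\<^bsub>P0\<^esub> j"] P0.diff_add_cancel[of x j] P0.M.a_comm[of j "x \<ominus>\<^bsub>P0\<^esub> j"] by simp
    then have "\<rho> P0 x = \<rho> P0 (x \<ominus>\<^bsub>P0\<^esub> j)" using x jc j(1) r0(8)[of x "x \<ominus>\<^bsub>P0\<^esub> j"] by simp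
    then show "y \<in> \<rho> P0 ` ?K" using k x(2) by blast
  qed
  have \<rho>h: "submodule {x \<in> carrier P. \<rho> P x \<in> U} A P \<and> ideal_smult J P \<subseteq> {x \<in> carrier P. \<rho> P x \<in> U}"
    if P: "left_module A P" and U: "submodule U A (reduce P)" for P :: "('a, 'l) fmod" and U
  proof -
    note r = reduce_facts[OF P]
    have "submodule {x \<in> carrier P. restrict (\<rho> P) (carrier P) x \<in> U} A P"
      by (rule hom_vimage_submodule[OF P r(1) r(3) U])
    moreover have "{x \<in> carrier P. restrict (\<rho> P) (carrier P) x \<in> U} = {x \<in> carrier P. \<rho> P x \<in> U}" by auto
    moreover have "ideal_smult J P \<subseteq> {x \<in> carrier P. \<rho> P x \<in> U}"
    proof
      fix j assume j: "j \<in> ideal_smult J P"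
      have jc: "j \<in> carrier P"
        using ideal_smult_submodule[OF P J] j unfolding left_module.submodule_iff[OF P] by blast
      have "\<zero>\<^bsub>reduce P\<^esub> \<in> U" using U unfolding left_module.submodule_iff[OF r(1)] by blast
      then show "j \<in> {x \<in> carrier P. \<rho> P x \<in> U}" using r(7)[OF jc] j jc by simp
    qed
    ultimately show ?thesis by simp
  qed
  have surj_r: "U = carrier (reduce P)"
    if P: "left_module A P" and U: "submodule U A (reduce P)" and eq: "{x \<in> carrier P. \<rho> P x \<in> U} = carrier P"
    for P :: "('a, 'l) fmod" and U
  proof
    show "U \<subseteq> carrier (reduce P)" using U unfolding left_module.submodule_iff[OF reduce_facts(1)[OF P]] by blast
    show "carrier (reduce P) \<subseteq> U" using eq by (auto elim!: reduce_elim[OF P])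
  qed
  have kersub: "submodule (a_kernel (reduce P0) (reduce M) g') A (reduce P0)"
    by (rule submodule_kernel[OF r0(1) rM(1) g'])
  interpret R0: left_module A "reduce P0" by (rule r0(1))
  interpret R1: left_module A "reduce P1" by (rule r1(1))
  have sup0': "superfluous A (reduce P0) (a_kernel (reduce P0) (reduce M) g')"
    unfolding superfluous_def
  proof (intro conjI allI impI kersub)
    fix U assume "submodule U A (reduce P0) \<and> a_kernel (reduce P0) (reduce M) g' <+>\<^bsub>reduce P0\<^esub> U = carrier (reduce P0)"
    then have U: "submodule U A (reduce P0)"
      and sum: "a_kernel (reduce P0) (reduce M) g' <+>\<^bsub>reduce P0\<^esub> U = carrier (reduce P0)" by auto
    let ?U = "{x \<in> carrier P0. \<rho> P0 x \<in> U}"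
    have U': "submodule ?U A P0" "ideal_smult J P0 \<subseteq> ?U" using \<rho>h[OF P0 U] by auto
    have "?K <+>\<^bsub>P0\<^esub> ?U = carrier P0"
    proof (subst P0.set_add_eq_carrier[OF K_c], blast, intro ballI)
      fix p assume p: "p \<in> carrier P0"
      then obtain k u where ku: "k \<in> ?K" "u \<in> U" "\<rho> P0 p = \<rho> P0 k \<oplus>\<^bsub>reduce P0\<^esub> u"
        using r0(4)[OF p] unfolding sum[symmetric] set_add_iff ker by blast
      have kc: "k \<in> carrier P0" using ku K_c by blast
      from preimage_split[OF P0 U p kc ku(2,3)] show "\<exists>x\<in>?K. \<exists>y\<in>?U. p = x \<oplus>\<^bsub>P0\<^esub> y"
        using ku(1) by blast
    qed
    then have "?U = carrier P0" using sup0 U'(1) unfolding superfluous_def by blast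
    then show "U = carrier (reduce P0)" by (rule surj_r[OF P0 U])
  qed
  obtain f' where f': "f' \<in> module_hom A (reduce P1) (reduce P0)"
    and f'_eq0: "\<And>x. x \<in> carrier P1 \<Longrightarrow> f' (\<rho> P1 x) = compose (carrier P1) (restrict (\<rho> P0) (carrier P0)) f x"
    by (rule hom_descends[OF P1 r0(9) hom_comp[OF f0 r0(3) P1]]) blast
  have f'_eq: "f' (\<rho> P1 x) = \<rho> P0 (f x)" if "x \<in> carrier P1" for x
    using f'_eq0[OF that] that hom_closed[OF f0] by (simp add: compose_def)
  let ?K' = "a_kernel (reduce P0) (reduce M) g'"
  let ?RK = "(reduce P0)\<lparr>carrier := ?K'\<rparr>"
  have RK: "left_module A ?RK" by (rule R0.left_module_submodule[OF kersub])
  have f'_img: "f' ` carrier (reduce P1) = ?K'"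
  proof -
    have "f' ` carrier (reduce P1) = (\<lambda>x. \<rho> P0 (f x)) ` carrier P1"
      unfolding r1(2) image_image using f'_eq by (intro image_cong) auto
    also have "\<dots> = \<rho> P0 ` f ` carrier P1" by (simp add: image_image)
    finally show ?thesis using f(2) ker by simp
  qed
  have f'': "f' \<in> module_hom A (reduce P1) ?RK"
    using f' f'_img by (intro hom_into_submodule) auto
  have sup1': "superfluous A (reduce P1) (a_kernel (reduce P1) ?RK f')"
    unfolding superfluous_def
  proof (intro conjI allI impI)
    show "submodule (a_kernel (reduce P1) ?RK f') A (reduce P1)"
      by (rule submodule_kernel[OF r1(1) RK f''])
    fix U assume "submodule U A (reduce P1) \<and> a_kernel (reduce P1) ?RK f' <+>\<^bsub>reduce P1\<^esub> U = carrier (reduce P1)"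
    then have U: "submodule U A (reduce P1)"
      and sum: "a_kernel (reduce P1) ?RK f' <+>\<^bsub>reduce P1\<^esub> U = carrier (reduce P1)" by auto
    let ?U = "{x \<in> carrier P1. \<rho> P1 x \<in> U}"
    have U': "submodule ?U A P1" "ideal_smult J P1 \<subseteq> ?U" using \<rho>h[OF P1 U] by auto
    have fU: "submodule (f ` ?U) A ?PK" by (rule hom_image_submodule[OF P1 PK f(1) U'(1)])
    have split: "\<exists>q\<in>carrier P1. \<exists>u\<in>?U. p = q \<oplus>\<^bsub>P1\<^esub> u \<and> f q \<in> ideal_smult J P0" if p: "p \<in> carrier P1" for p
    proof -
      obtain y u where yu: "y \<in> a_kernel (reduce P1) ?RK f'" "u \<in> U" "\<rho> P1 p = y \<oplus>\<^bsub>reduce P1\<^esub> u"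
        using r1(4)[OF p] unfolding sum[symmetric] set_add_iff by blast
      then obtain q where q: "q \<in> carrier P1" "y = \<rho> P1 q" "\<rho> P0 (f q) = \<zero>\<^bsub>reduce P0\<^esub>"
        using f'_eq by (auto simp: a_kernel_iff elim!: reduce_elim[OF P1])
      have fq: "f q \<in> ideal_smult J P0" using q(3) r0(7)[OF hom_closed[OF f0 q(1)]] by simp
      from preimage_split[OF P1 U p q(1) yu(2) yu(3)[unfolded q(2)]] show ?thesis using fq q(1) by blast
    qed
    have "(?K \<inter> ideal_smult J P0) <+>\<^bsub>?PK\<^esub> (f ` ?U) = carrier ?PK"
    proof (subst left_module.set_add_eq_carrier[OF PK])
      show "?K \<inter> ideal_smult J P0 \<subseteq> carrier ?PK" by simp
      show "f ` ?U \<subseteq> carrier ?PK" using hom_closed[OF f(1)] by auto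
      show "\<forall>z\<in>carrier ?PK. \<exists>x\<in>?K \<inter> ideal_smult J P0. \<exists>y\<in>f ` ?U. z = x \<oplus>\<^bsub>?PK\<^esub> y"
      proof
        fix z assume "z \<in> carrier ?PK"
        then obtain p where p: "p \<in> carrier P1" "z = f p" using f(2) by auto
        then obtain q u where "q \<in> carrier P1" "u \<in> ?U" "p = q \<oplus>\<^bsub>P1\<^esub> u" "f q \<in> ideal_smult J P0"
          using split by blast
        then show "\<exists>x\<in>?K \<inter> ideal_smult J P0. \<exists>y\<in>f ` ?U. z = x \<oplus>\<^bsub>?PK\<^esub> y"
          using p hom_add[OF f(1), of q u] f(2) by (intro bexI[of _ "f q"] bexI[of _ "f u"]) auto
      qed
    qed
    then have fU_all: "f ` ?U = ?K" using small fU unfolding superfluous_def by auto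
    have "a_kernel P1 ?PK f <+>\<^bsub>P1\<^esub> ?U = carrier P1"
    proof (subst P1.set_add_eq_carrier)
      show "a_kernel P1 ?PK f \<subseteq> carrier P1" by (auto simp: a_kernel_iff)
      show "\<forall>z\<in>carrier P1. \<exists>x\<in>a_kernel P1 ?PK f. \<exists>y\<in>?U. z = x \<oplus>\<^bsub>P1\<^esub> y"
      proof
        fix p assume p: "p \<in> carrier P1"
        then have "f p \<in> f ` ?U" using fU_all f(2) by blast
        then obtain u where u: "u \<in> ?U" "f u = f p" by force
        have "f (p \<ominus>\<^bsub>P1\<^esub> u) = \<zero>\<^bsub>P0\<^esub>"
          using u p hom_diff[OF P1 P0 f0, of p u] hom_closed[OF f0 p] by (simp add: P0.diff_eq_zero_iff)
        then show "\<exists>x\<in>a_kernel P1 ?PK f. \<exists>y\<in>?U. p = x \<oplus>\<^bsub>P1\<^esub> y"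
          using u p P1.diff_add_cancel[of p u]
          by (intro bexI[of _ "p \<ominus>\<^bsub>P1\<^esub> u"] bexI[of _ u]) (auto simp: a_kernel_iff)
      qed
    qed blast
    then have "?U = carrier P1" using sup1 U'(1) unfolding superfluous_def by blast
    then show "U = carrier (reduce P1)" by (rule surj_r[OF P1 U])
  qed
  have ker_eq: "a_kernel (reduction P0) (reduction M) g' = ?K'"
    by (auto simp: a_kernel_iff reduction_simps[OF P0] reduction_simps[OF M])
  have K'c: "?K' \<subseteq> carrier (reduce P0)" by (auto simp: a_kernel_iff)
  have cRK: "corresponds ?RK ((reduction P0)\<lparr>carrier := ?K'\<rparr>)"
    by (rule corresponds_restrict_carrier[OF corresponds_reduction[OF P0] K'c])
  have ker_eq': "a_kernel (reduction P1) ((reduction P0)\<lparr>carrier := ?K'\<rparr>) f' = a_kernel (reduce P1) ?RK f'"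
    by (auto simp: a_kernel_iff reduction_simps[OF P0] reduction_simps[OF P1])
  have g'_img: "g' ` carrier (reduce P0) = carrier (reduce M)"
  proof -
    have "g' ` carrier (reduce P0) = (\<lambda>x. \<rho> M (g x)) ` carrier P0"
      unfolding r0(2) image_image using g'_eq by (intro image_cong) auto
    also have "\<dots> = \<rho> M ` g ` carrier P0" by (simp add: image_image)
    finally show ?thesis using g(2) rM(2) by simp
  qed
  have "projective_cover B (reduction P0) (reduction M) g'"
    unfolding projective_cover_def ker_eq
    using projective_reduction[OF proj(1)] g' sup0' g'_img
      hom_to_corresponding[OF P0 corresponds_reduction[OF M] rM(1)]
      corresponds_superfluous[OF corresponds_reduction[OF P0] r0(1)]
    by (simp add: reduction_simps[OF P0] reduction_simps[OF M])
  moreover have "projective_cover B (reduction P1) ((reduction P0)\<lparr>carrier := ?K'\<rparr>) f'"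
    unfolding projective_cover_def ker_eq'
    using projective_reduction[OF proj(2)] f'' sup1' f'_img
      hom_to_corresponding[OF P1 cRK RK]
      corresponds_superfluous[OF corresponds_reduction[OF P1] r1(1)]
    by (simp add: reduction_simps[OF P1])
  ultimately have "minimal_projective_presentation B (reduction P1) (reduction P0) (reduction M) f' g'"
    unfolding minimal_projective_presentation_def ker_eq by blast
  then show ?thesis by (rule that) (fact f'_eq g'_eq)+
qed

lemma inj_on_quotient:
  assumes \<iota>: "inj_on \<iota> (carrier A)" shows "inj_on (\<lambda>X. \<iota> (SOME a. a \<in> X)) (carrier B)"
proof (rule inj_onI)
  fix X Y assume X: "X \<in> carrier B" and Y: "Y \<in> carrier B" and eq: "\<iota> (SOME a. a \<in> X) = \<iota> (SOME a. a \<in> Y)"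
  have rep: "(SOME a. a \<in> Z) \<in> carrier A \<and> Z = J +>\<^bsub>A\<^esub> (SOME a. a \<in> Z)" if Z: "Z \<in> carrier B" for Z
  proof -
    obtain a where a: "a \<in> carrier A" "Z = J +>\<^bsub>A\<^esub> a" using Z by (rule quot.quot_elim)
    have "a \<in> Z" using quot.coset_self[OF a(1)] a(2) by simp
    then have b: "(SOME a. a \<in> Z) \<in> Z" by (rule someI)
    then have bA: "(SOME a. a \<in> Z) \<in> carrier A" "(SOME a. a \<in> Z) \<ominus>\<^bsub>A\<^esub> a \<in> J" using a by (auto simp: quot.mem_coset_iff)
    then show ?thesis using quot.coset_eq_iff[of "SOME a. a \<in> Z" a] a by simp
  qed
  then have "(SOME a. a \<in> X) = (SOME a. a \<in> Y)" using X Y eq inj_onD[OF \<iota>] by blast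
  then show "X = Y" using rep[OF X] rep[OF Y] by simp
qed

text \<open>Under the hypothesis of \<open>reduced_presentation\<close>, the factorization property that characterizes
  tau-rigidity passes from \<open>M\<close> to \<open>M/JM\<close>: a homomorphism \<open>P1/JP1 \<rightarrow> M/JM\<close> lifts to \<open>P1 \<rightarrow> M\<close>, which
  factors through \<open>P0\<close>.\<close>
lemma tau_rigid_reduction:
  fixes M P1 P0 :: "('a, 'k) fmod" and \<iota> :: "'a \<Rightarrow> nat \<Rightarrow> 'k"
  assumes \<iota>: "inj_on \<iota> (carrier A)" and M: "M \<in> mod_cat A"
    and pres: "minimal_projective_presentation A P1 P0 M f g"
    and small: "superfluous A (P0\<lparr>carrier := a_kernel P0 M g\<rparr>) (a_kernel P0 M g \<inter> ideal_smult J P0)"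
    and factors: "\<And>\<psi>. \<psi> \<in> module_hom A P1 M \<Longrightarrow> \<exists>\<chi>\<in>module_hom A P0 M. \<psi> = compose (carrier P1) \<chi> f"
  shows "tau_rigid K B (reduction M)"
proof -
  have Mm: "left_module A M" and Mfg: "fin_gen A M" using M by (auto simp: mod_cat_def)
  obtain f' g' where pres': "minimal_projective_presentation B (reduction P1) (reduction P0) (reduction M) f' g'"
    and f'_eq: "\<And>x. x \<in> carrier P1 \<Longrightarrow> f' (\<rho> P1 x) = \<rho> P0 (f x)"
    by (rule reduced_presentation[OF pres Mm small]) blast
  have proj: "projective A P0" "projective A P1"
    and f: "f \<in> module_hom A P1 (P0\<lparr>carrier := a_kernel P0 M g\<rparr>)"
    using pres by (auto simp: minimal_projective_presentation_def projective_cover_def)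
  have proj': "projective B (reduction P0)" "projective B (reduction P1)"
    and f': "f' \<in> module_hom B (reduction P1) ((reduction P0)\<lparr>carrier := a_kernel (reduction P0) (reduction M) g'\<rparr>)"
    using pres' by (auto simp: minimal_projective_presentation_def projective_cover_def)
  have P0: "left_module A P0" and P1: "left_module A P1" using proj by (auto simp: projective_def mod_cat_def)
  have f0: "f \<in> module_hom A P1 P0" by (rule hom_restrict_target[OF f]) (auto simp: a_kernel_iff)
  have f'0: "f' \<in> module_hom B (reduction P1) (reduction P0)"
    by (rule hom_restrict_target[OF f']) (auto simp: a_kernel_iff)
  note r0 = reduce_facts[OF P0] and r1 = reduce_facts[OF P1] and rM = reduce_facts[OF Mm]
  from dual_basis_exists[OF inj_on_quotient[OF \<iota>] proj'(2)] dual_basis_exists[OF inj_on_quotient[OF \<iota>] proj'(1)]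
  obtain n1 p1 \<phi>1 n0 p0 \<phi>0 where "dual_basis B (reduction P1) n1 p1 \<phi>1" "dual_basis B (reduction P0) n0 p0 \<phi>0"
    by blast
  then interpret B: presentation_map K B "reduction P1" "reduction P0" f' n1 p1 \<phi>1 n0 p0 \<phi>0
    by (intro presentation_map.intro presentation_map_axioms.intro k_algebra_quotient left_module_reduction P0 P1 f'0)
  have "\<exists>\<chi>\<in>module_hom B (reduction P0) (reduction M). \<psi> = compose (carrier (reduction P1)) \<chi> f'"
    if \<psi>: "\<psi> \<in> module_hom B (reduction P1) (reduction M)" for \<psi>
  proof -
    have \<psi>': "\<psi> \<in> module_hom A (reduce P1) (reduce M)"
      using \<psi> hom_to_corresponding[OF P1 corresponds_reduction[OF Mm] rM(1)] by simp
    have redM_cat: "reduce M \<in> mod_cat A" using rM(1,10) Mfg by (simp add: mod_cat_def)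
    have surj: "restrict (\<rho> M) (carrier M) ` carrier M = carrier (reduce M)" by (auto simp: rM(2))
    obtain \<psi>1 where \<psi>1: "\<psi>1 \<in> module_hom A P1 M"
      "compose (carrier P1) (restrict (\<rho> M) (carrier M)) \<psi>1 = compose (carrier P1) \<psi> (restrict (\<rho> P1) (carrier P1))"
      using proj(2) M redM_cat rM(3) hom_comp[OF r1(3) \<psi>' P1] surj unfolding projective_def by blast
    obtain \<chi> where \<chi>: "\<chi> \<in> module_hom A P0 M" "\<psi>1 = compose (carrier P1) \<chi> f" using factors[OF \<psi>1(1)] by blast
    obtain \<chi>' where \<chi>': "\<chi>' \<in> module_hom A (reduce P0) (reduce M)"
      and \<chi>'_eq: "\<And>x. x \<in> carrier P0 \<Longrightarrow> \<chi>' (\<rho> P0 x) = compose (carrier P0) (restrict (\<rho> M) (carrier M)) \<chi> x"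
      by (rule hom_descends[OF P0 rM(9) hom_comp[OF \<chi>(1) rM(3) P0]]) blast
    have \<chi>'B: "\<chi>' \<in> module_hom B (reduction P0) (reduction M)"
      using \<chi>' hom_to_corresponding[OF P0 corresponds_reduction[OF Mm] rM(1)] by simp
    have "\<psi> = compose (carrier (reduction P1)) \<chi>' f'"
    proof (rule hom_eqI[OF \<psi> hom_comp[OF f'0 \<chi>'B left_module_reduction[OF P1]]])
      fix y assume y: "y \<in> carrier (reduction P1)"
      then obtain x where x: "x \<in> carrier P1" "y = \<rho> P1 x"
        unfolding reduction_simps[OF P1] by (rule reduce_elim[OF P1])
      have fx: "f x \<in> carrier P0" by (rule hom_closed[OF f0 x(1)])
      have "\<psi> y = \<rho> M (\<psi>1 x)"
        using fun_cong[OF \<psi>1(2), of x] x hom_closed[OF \<psi>1(1)] by (simp add: compose_def)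
      also have "\<dots> = \<rho> M (\<chi> (f x))" using \<chi>(2) x by (simp add: compose_def)
      also have "\<dots> = \<chi>' (\<rho> P0 (f x))" using \<chi>'_eq[OF fx] fx hom_closed[OF \<chi>(1) fx] by (simp add: compose_def)
      also have "\<dots> = \<chi>' (f' y)" using f'_eq x by simp
      finally show "\<psi> y = compose (carrier (reduction P1)) \<chi>' f' y" using y by (simp add: compose_def)
    qed
    then show ?thesis using \<chi>'B by blast
  qed
  then have "module_hom B (reduction M) B.D = {zero_hom (reduction M) B.D}"
    using B.tau_hom_eq_zero[OF left_module_reduction[OF Mm]] B.zero_hom_dual[OF left_module_reduction[OF Mm]] by blast
  moreover have "reduction M \<in> mod_cat B"
    using corresponds_mod_cat[OF corresponds_reduction[OF Mm] rM(1)] rM(1,10) Mfg by (simp add: mod_cat_def)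
  ultimately show ?thesis using pres' unfolding tau_rigid_def AR_translate_def by blast
qed

end

section \<open>Lifting along a square-zero ideal\<close>

lemma projection_onto_summand:
  assumes M: "left_module R M"
    and X: "submodule X R M" and Y: "submodule Y R M" and int: "X \<inter> Y = {\<zero>\<^bsub>M\<^esub>}"
    and sum: "X <+>\<^bsub>M\<^esub> Y = carrier M"
  obtains p where "p \<in> module_hom R M M" "\<And>x. x \<in> X \<Longrightarrow> p x = x" "\<And>y. y \<in> Y \<Longrightarrow> p y = \<zero>\<^bsub>M\<^esub>"
    "\<And>z. z \<in> carrier M \<Longrightarrow> p z \<in> X \<and> z \<ominus>\<^bsub>M\<^esub> p z \<in> Y"
proof -
  interpret left_module R M by (rule M)
  have Xc: "\<And>x. x \<in> X \<Longrightarrow> x \<in> carrier M" and Yc: "\<And>x. x \<in> Y \<Longrightarrow> x \<in> carrier M"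
    and X0: "\<zero>\<^bsub>M\<^esub> \<in> X" and Y0: "\<zero>\<^bsub>M\<^esub> \<in> Y"
    using X Y unfolding submodule_iff by blast+
  have uniq: "x = x'" if "x \<in> X" "x' \<in> X" "z \<ominus>\<^bsub>M\<^esub> x \<in> Y" "z \<ominus>\<^bsub>M\<^esub> x' \<in> Y" "z \<in> carrier M" for x x' z
  proof -
    have z: "z \<ominus>\<^bsub>M\<^esub> (z \<ominus>\<^bsub>M\<^esub> x) = x" if "z \<in> carrier M" "x \<in> carrier M" for x z
      using that add_diff_cancel[of x "z \<ominus>\<^bsub>M\<^esub> x"] diff_add_cancel[of z x] M.a_comm[of x "z \<ominus>\<^bsub>M\<^esub> x"] by simp
    have "(z \<ominus>\<^bsub>M\<^esub> x') \<ominus>\<^bsub>M\<^esub> (z \<ominus>\<^bsub>M\<^esub> x) = x \<ominus>\<^bsub>M\<^esub> x'"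
    proof -
      have "(z \<ominus>\<^bsub>M\<^esub> x') \<ominus>\<^bsub>M\<^esub> (z \<ominus>\<^bsub>M\<^esub> x) = (z \<ominus>\<^bsub>M\<^esub> (z \<ominus>\<^bsub>M\<^esub> x)) \<ominus>\<^bsub>M\<^esub> x'"
        using that Xc by (simp add: a_minus_def M.a_ac)
      then show ?thesis using z[of z x] that Xc by simp
    qed
    moreover have "(z \<ominus>\<^bsub>M\<^esub> x') \<ominus>\<^bsub>M\<^esub> (z \<ominus>\<^bsub>M\<^esub> x) \<in> Y" by (rule submodule_diff[OF Y that(4,3)])
    moreover have "x \<ominus>\<^bsub>M\<^esub> x' \<in> X" by (rule submodule_diff[OF X that(1,2)])
    ultimately have "x \<ominus>\<^bsub>M\<^esub> x' = \<zero>\<^bsub>M\<^esub>" using int by auto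
    then show ?thesis using that Xc diff_eq_zero_iff by blast
  qed
  have ex: "\<exists>x\<in>X. z \<ominus>\<^bsub>M\<^esub> x \<in> Y" if z: "z \<in> carrier M" for z
  proof -
    obtain x y where xy: "x \<in> X" "y \<in> Y" "z = x \<oplus>\<^bsub>M\<^esub> y" using z unfolding sum[symmetric] set_add_iff by blast
    then have "z \<ominus>\<^bsub>M\<^esub> x = y" using Xc Yc add_diff_cancel[of y x] M.a_comm[of x y] by simp
    then show ?thesis using xy by blast
  qed
  define p where "p = (\<lambda>z\<in>carrier M. THE x. x \<in> X \<and> z \<ominus>\<^bsub>M\<^esub> x \<in> Y)"
  have p: "p z = x" if "x \<in> X" "z \<ominus>\<^bsub>M\<^esub> x \<in> Y" "z \<in> carrier M" for x z
    unfolding p_def using that uniq by (simp, intro the_equality) blast+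
  have pX: "p z \<in> X \<and> z \<ominus>\<^bsub>M\<^esub> p z \<in> Y" if "z \<in> carrier M" for z using ex[OF that] p that by blast
  have p_ext: "p = restrict p (carrier M)" by (simp add: p_def)
  have "restrict p (carrier M) \<in> module_hom R M M"
  proof (rule module_homI)
    fix x y assume xy: "x \<in> carrier M" "y \<in> carrier M"
    then have c: "p x \<in> carrier M" "p y \<in> carrier M" using pX Xc by blast+
    show "p (x \<oplus>\<^bsub>M\<^esub> y) = p x \<oplus>\<^bsub>M\<^esub> p y"
    proof (rule p)
      have "(x \<oplus>\<^bsub>M\<^esub> y) \<ominus>\<^bsub>M\<^esub> (p x \<oplus>\<^bsub>M\<^esub> p y) = (x \<ominus>\<^bsub>M\<^esub> p x) \<oplus>\<^bsub>M\<^esub> (y \<ominus>\<^bsub>M\<^esub> p y)"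
        using xy c by (simp add: a_minus_def M.minus_add M.a_ac)
      then show "(x \<oplus>\<^bsub>M\<^esub> y) \<ominus>\<^bsub>M\<^esub> (p x \<oplus>\<^bsub>M\<^esub> p y) \<in> Y"
        using pX[OF xy(1)] pX[OF xy(2)] Y unfolding submodule_iff by simp
      show "p x \<oplus>\<^bsub>M\<^esub> p y \<in> X" using pX[OF xy(1)] pX[OF xy(2)] X unfolding submodule_iff by simp
    qed (use xy in simp)
  next
    fix a x assume ax: "a \<in> carrier R" "x \<in> carrier M"
    then have c: "p x \<in> carrier M" using pX Xc by blast
    show "p (a \<odot>\<^bsub>M\<^esub> x) = a \<odot>\<^bsub>M\<^esub> p x"
    proof (rule p)
      show "a \<odot>\<^bsub>M\<^esub> x \<ominus>\<^bsub>M\<^esub> a \<odot>\<^bsub>M\<^esub> p x \<in> Y"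
        using pX[OF ax(2)] Y ax(1) smult_r_diff[OF ax c] unfolding submodule_iff by metis
      show "a \<odot>\<^bsub>M\<^esub> p x \<in> X" using ax pX[OF ax(2)] X unfolding submodule_iff by simp
    qed (use ax in simp)
  qed (use pX Xc left_module_axioms in auto)
  then have "p \<in> module_hom R M M" using p_ext by simp
  moreover have "p x = x" if "x \<in> X" for x using that Xc Y0 diff_eq_zero_iff[of x x] by (intro p) auto
  moreover have "p y = \<zero>\<^bsub>M\<^esub>" if "y \<in> Y" for y using that Yc X0 diff_zero[of y] by (intro p) auto
  ultimately show ?thesis using that pX by blast
qed

context quotient_algebra
begin

text \<open>Every homomorphism from \<open>M\<close> to \<open>N/JN\<close> lifts to \<open>N\<close>.\<close>
definition lifts :: "('a, 'b) module \<Rightarrow> ('a, 'd) module \<Rightarrow> bool"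
  where "lifts M N \<longleftrightarrow> (\<forall>\<psi>\<in>module_hom A M (reduce N). \<exists>\<theta>\<in>module_hom A M N. \<forall>x\<in>carrier M. \<rho> N (\<theta> x) = \<psi> x)"

lemma square_zero_smult:
  assumes J2: "\<forall>i\<in>J. \<forall>j\<in>J. i \<otimes>\<^bsub>A\<^esub> j = \<zero>\<^bsub>A\<^esub>"
    and M: "left_module A M" and j: "j \<in> J" and y: "y \<in> ideal_smult J M"
  shows "j \<odot>\<^bsub>M\<^esub> y = \<zero>\<^bsub>M\<^esub>"
proof -
  interpret M: left_module A M by (rule M)
  have JA: "\<And>j. j \<in> J \<Longrightarrow> j \<in> carrier A" using J by (meson ideal.Icarr)
  have sub: "\<And>y. y \<in> ideal_smult J M \<Longrightarrow> y \<in> carrier M"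
    using ideal_smult_submodule[OF M J] unfolding M.submodule_iff by blast
  show ?thesis using y
  proof induct
    case (smult i x)
    then show ?case using j J2 M.smult_assoc1[of j i x] by (simp add: JA)
  next
    case (add x y)
    then show ?case using j sub by (simp add: M.smult_r_distr JA)
  qed
qed

lemma near_zero_on_multiples:
  assumes J2: "\<forall>i\<in>J. \<forall>j\<in>J. i \<otimes>\<^bsub>A\<^esub> j = \<zero>\<^bsub>A\<^esub>"
    and M: "left_module A M" and N: "left_module A N" and h: "h \<in> module_hom A M N"
    and hJ: "\<And>x. x \<in> carrier M \<Longrightarrow> h x \<in> ideal_smult J N" and y: "y \<in> ideal_smult J M"
  shows "h y = \<zero>\<^bsub>N\<^esub>"
proof -
  interpret N: left_module A N by (rule N)
  have "ideal_smult J M \<subseteq> {x \<in> carrier M. h x \<in> {\<zero>\<^bsub>N\<^esub>}}"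
  proof (rule ideal_smult_least[OF M hom_vimage_submodule[OF M N h N.submodule_zero]])
    fix j x assume jx: "j \<in> J" "x \<in> carrier M"
    then have "j \<in> carrier A" using J by (meson ideal.Icarr)
    then show "j \<odot>\<^bsub>M\<^esub> x \<in> {x \<in> carrier M. h x \<in> {\<zero>\<^bsub>N\<^esub>}}"
      using square_zero_smult[OF J2 N jx(1) hJ[OF jx(2)]] hom_smult[OF h _ jx(2)] jx(2)
        left_module.smult_closed[OF M] by simp
  qed
  then show ?thesis using y by blast
qed

lemma near_identity_on_multiples:
  assumes J2: "\<forall>i\<in>J. \<forall>j\<in>J. i \<otimes>\<^bsub>A\<^esub> j = \<zero>\<^bsub>A\<^esub>"
    and M: "left_module A M" and h: "h \<in> module_hom A M M"
    and hJ: "\<And>x. x \<in> carrier M \<Longrightarrow> \<rho> M (h x) = \<rho> M x" and y: "y \<in> ideal_smult J M"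
  shows "h y = y"
proof -
  interpret M: left_module A M by (rule M)
  note r = reduce_facts[OF M]
  have sub: "\<And>y. y \<in> ideal_smult J M \<Longrightarrow> y \<in> carrier M"
    using ideal_smult_submodule[OF M J] unfolding M.submodule_iff by blast
  show ?thesis using y
  proof induct
    case (smult j x)
    have jA: "j \<in> carrier A" using smult(1) J by (meson ideal.Icarr)
    have hx: "h x \<in> carrier M" by (rule hom_closed[OF h smult(2)])
    have "h x \<ominus>\<^bsub>M\<^esub> x \<in> ideal_smult J M" using hJ[OF smult(2)] r(8)[OF hx smult(2)] by simp
    then have "j \<odot>\<^bsub>M\<^esub> (h x \<ominus>\<^bsub>M\<^esub> x) = \<zero>\<^bsub>M\<^esub>" by (rule square_zero_smult[OF J2 M smult(1)])
    then have "j \<odot>\<^bsub>M\<^esub> h x = j \<odot>\<^bsub>M\<^esub> x"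
      using jA hx smult(2) M.diff_eq_zero_iff[of "j \<odot>\<^bsub>M\<^esub> h x" "j \<odot>\<^bsub>M\<^esub> x"] by (simp add: M.smult_r_diff)
    then show ?case using hom_smult[OF h jA smult(2)] by simp
  next
    case (add x y)
    then show ?case using hom_add[OF h, of x y] sub by simp
  qed
qed

text \<open>Lifts of mutually inverse isomorphisms between \<open>M/JM\<close> and \<open>N/JN\<close> compose to endomorphisms that
  differ from the identity by a map with square zero, so they are bijective.\<close>
lemma module_iso_of_reduction:
  assumes J2: "\<forall>i\<in>J. \<forall>j\<in>J. i \<otimes>\<^bsub>A\<^esub> j = \<zero>\<^bsub>A\<^esub>"
    and M: "left_module A M" and N: "left_module A N" and "lifts M N" "lifts N M"
    and iso: "module_iso B (reduction M) (reduction N)"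
  shows "module_iso A M N"
proof -
  interpret M: left_module A M by (rule M)
  interpret N: left_module A N by (rule N)
  note rM = reduce_facts[OF M] and rN = reduce_facts[OF N]
  obtain h where h: "h \<in> module_hom A (reduce M) (reduce N)" "bij_betw h (carrier (reduce M)) (carrier (reduce N))"
    using iso hom_to_corresponding[OF M corresponds_reduction[OF N] rN(1)]
    by (auto simp: module_iso_def reduction_simps[OF M] reduction_simps[OF N])
  define k where "k = restrict (inv_into (carrier (reduce M)) h) (carrier (reduce N))"
  have k: "k \<in> module_hom A (reduce N) (reduce M)" unfolding k_def by (rule bij_hom_inv[OF rM(1) rN(1) h])
  have kh: "k (h x) = x" if "x \<in> carrier (reduce M)" for x
    using that h(2) hom_closed[OF h(1) that] by (simp add: k_def bij_betw_inv_into_left)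
  have hk: "h (k x) = x" if "x \<in> carrier (reduce N)" for x
    using that h(2) by (simp add: k_def bij_betw_inv_into_right)
  obtain \<theta> where \<theta>: "\<theta> \<in> module_hom A M N" "\<And>x. x \<in> carrier M \<Longrightarrow> \<rho> N (\<theta> x) = h (\<rho> M x)"
    using \<open>lifts M N\<close> hom_comp[OF rM(3) h(1) M] unfolding lifts_def by (fastforce simp: compose_def)
  obtain \<eta> where \<eta>: "\<eta> \<in> module_hom A N M" "\<And>x. x \<in> carrier N \<Longrightarrow> \<rho> M (\<eta> x) = k (\<rho> N x)"
    using \<open>lifts N M\<close> hom_comp[OF rN(3) k N] unfolding lifts_def by (fastforce simp: compose_def)
  note c = hom_closed[OF \<theta>(1)] hom_closed[OF \<eta>(1)]
  have 1: "\<eta> (\<theta> x) = x" if "x \<in> ideal_smult J M" for x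
  proof -
    have "x \<in> carrier M" using that ideal_smult_submodule[OF M J] unfolding M.submodule_iff by blast
    then show ?thesis
      using near_identity_on_multiples[OF J2 M hom_comp[OF \<theta>(1) \<eta>(1) M] _ that] c \<theta>(2) \<eta>(2) kh rM(4)
      by (simp add: compose_def)
  qed
  have 2: "\<theta> (\<eta> x) = x" if "x \<in> ideal_smult J N" for x
  proof -
    have "x \<in> carrier N" using that ideal_smult_submodule[OF N J] unfolding N.submodule_iff by blast
    then show ?thesis
      using near_identity_on_multiples[OF J2 N hom_comp[OF \<eta>(1) \<theta>(1) N] _ that] c \<theta>(2) \<eta>(2) hk rN(4)
      by (simp add: compose_def)
  qed
  have "inj_on \<theta> (carrier M)"
  proof (rule inj_onI)
    fix x y assume xy: "x \<in> carrier M" "y \<in> carrier M" "\<theta> x = \<theta> y"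
    have "h (\<rho> M x) = h (\<rho> M y)" using \<theta>(2) xy by metis
    then have "\<rho> M x = \<rho> M y" using kh rM(4) xy by metis
    then have d: "x \<ominus>\<^bsub>M\<^esub> y \<in> ideal_smult J M" using rM(8) xy by blast
    have "\<theta> (x \<ominus>\<^bsub>M\<^esub> y) = \<zero>\<^bsub>N\<^esub>" using hom_diff[OF M N \<theta>(1) xy(1,2)] xy c N.diff_eq_zero_iff by simp
    then have "x \<ominus>\<^bsub>M\<^esub> y = \<zero>\<^bsub>M\<^esub>" using 1[OF d] hom_zero[OF N M \<eta>(1)] by simp
    then show "x = y" using xy M.diff_eq_zero_iff by blast
  qed
  moreover have "\<theta> ` carrier M = carrier N"
  proof (intro equalityI subsetI)
    fix y assume y: "y \<in> carrier N"
    let ?n = "y \<ominus>\<^bsub>N\<^esub> \<theta> (\<eta> y)"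
    have cl: "\<eta> y \<in> carrier M" "\<theta> (\<eta> y) \<in> carrier N" using y c by auto
    have "\<rho> N y = \<rho> N (\<theta> (\<eta> y))" using y cl \<theta>(2) \<eta>(2) hk rN(4) by simp
    then have n: "?n \<in> ideal_smult J N" using rN(8) y cl by blast
    have nc: "?n \<in> carrier N" using y cl by simp
    have "\<theta> (\<eta> ?n \<oplus>\<^bsub>M\<^esub> \<eta> y) = y"
      using hom_add[OF \<theta>(1), of "\<eta> ?n" "\<eta> y"] 2[OF n] c nc y cl N.diff_add_cancel by simp
    then show "y \<in> \<theta> ` carrier M" using c nc cl by (metis M.add.m_closed imageI)
  qed (use c in auto)
  ultimately show ?thesis using \<theta>(1) by (auto simp: module_iso_def bij_betw_def)
qed

text \<open>The lift \<open>e\<close> of a projection of \<open>M/JM\<close>, with \<open>c = 1 - e\<close>, satisfies \<open>(e c)\<^sup>2 = 0\<close>, and then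
  \<open>M\<close> is the direct sum of the kernels of \<open>e\<^sup>2\<close> and \<open>c\<^sup>2\<close>. This avoids lifting idempotents.\<close>
lemma indecomposable_reduction:
  assumes J2: "\<forall>i\<in>J. \<forall>j\<in>J. i \<otimes>\<^bsub>A\<^esub> j = \<zero>\<^bsub>A\<^esub>"
    and M: "left_module A M" and "lifts M M" and ind: "indecomposable A M"
  shows "indecomposable B (reduction M)"
proof -
  interpret M: left_module A M by (rule M)
  note r = reduce_facts[OF M]
  interpret R: left_module A "reduce M" by (rule r(1))
  let ?J = "ideal_smult J M"
  have Jsub: "submodule ?J A M" by (rule ideal_smult_submodule[OF M J])
  have Jc: "\<And>y. y \<in> ?J \<Longrightarrow> y \<in> carrier M" using Jsub unfolding M.submodule_iff by blast
  have "carrier (reduce M) \<noteq> {\<zero>\<^bsub>reduce M\<^esub>}"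
  proof
    assume triv: "carrier (reduce M) = {\<zero>\<^bsub>reduce M\<^esub>}"
    then have all: "x \<in> ?J" if "x \<in> carrier M" for x using r(7)[OF that] r(4)[OF that] by simp
    have "?J \<subseteq> {\<zero>\<^bsub>M\<^esub>}"
      using square_zero_smult[OF J2 M] all by (intro ideal_smult_least[OF M M.submodule_zero]) auto
    then have "carrier M = {\<zero>\<^bsub>M\<^esub>}" using all by auto
    then show False using ind by (simp add: indecomposable_def)
  qed
  moreover have "X = {\<zero>\<^bsub>reduce M\<^esub>} \<or> Y = {\<zero>\<^bsub>reduce M\<^esub>}"
    if X: "submodule X A (reduce M)" and Y: "submodule Y A (reduce M)"
      and int: "X \<inter> Y = {\<zero>\<^bsub>reduce M\<^esub>}" and sum: "X <+>\<^bsub>reduce M\<^esub> Y = carrier (reduce M)" for X Y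
  proof -
    obtain p where p: "p \<in> module_hom A (reduce M) (reduce M)" and pX: "\<And>x. x \<in> X \<Longrightarrow> p x = x"
      and pY: "\<And>y. y \<in> Y \<Longrightarrow> p y = \<zero>\<^bsub>reduce M\<^esub>"
      and pz: "\<And>z. z \<in> carrier (reduce M) \<Longrightarrow> p z \<in> X \<and> z \<ominus>\<^bsub>reduce M\<^esub> p z \<in> Y"
      by (rule projection_onto_summand[OF r(1) X Y int sum]) blast
    obtain e where e: "e \<in> module_hom A M M" and \<rho>e: "\<And>x. x \<in> carrier M \<Longrightarrow> \<rho> M (e x) = p (\<rho> M x)"
      using \<open>lifts M M\<close> hom_comp[OF r(3) p M] unfolding lifts_def by (fastforce simp: compose_def)
    have ec: "\<And>x. x \<in> carrier M \<Longrightarrow> e x \<in> carrier M" by (rule hom_closed[OF e])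
    define c where "c = (\<lambda>x\<in>carrier M. x \<ominus>\<^bsub>M\<^esub> e x)"
    have c_eq: "c x = x \<ominus>\<^bsub>M\<^esub> e x" if "x \<in> carrier M" for x using that by (simp add: c_def)
    have c: "c \<in> module_hom A M M" unfolding c_def
    proof (rule module_homI)
      fix x y assume "x \<in> carrier M" "y \<in> carrier M"
      then show "(x \<oplus>\<^bsub>M\<^esub> y) \<ominus>\<^bsub>M\<^esub> e (x \<oplus>\<^bsub>M\<^esub> y) = (x \<ominus>\<^bsub>M\<^esub> e x) \<oplus>\<^bsub>M\<^esub> (y \<ominus>\<^bsub>M\<^esub> e y)"
        using ec by (simp add: hom_add[OF e] a_minus_def M.M.minus_add M.M.a_ac)
    qed (auto simp: ec hom_smult[OF e] M.smult_r_diff M)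
    have cc: "\<And>x. x \<in> carrier M \<Longrightarrow> c x \<in> carrier M" by (rule hom_closed[OF c])
    have split: "e x \<oplus>\<^bsub>M\<^esub> c x = x" if "x \<in> carrier M" for x
      using that ec M.diff_add_cancel[of x "e x"] M.M.a_comm[of "e x" "c x"] cc by (simp add: c_eq)
    have comm: "c (e x) = e (c x)" if "x \<in> carrier M" for x
      using that ec hom_diff[OF M M e, of x "e x"] by (simp add: c_eq)
    have \<rho>c: "\<rho> M (c x) = \<rho> M x \<ominus>\<^bsub>reduce M\<^esub> p (\<rho> M x)" if "x \<in> carrier M" for x
      using hom_diff[OF M r(1) r(3), of x "e x"] that ec \<rho>e by (simp add: c_eq)
    have ecJ: "e (c x) \<in> ?J" if x: "x \<in> carrier M" for x
    proof -
      have "\<rho> M (e (c x)) = \<zero>\<^bsub>reduce M\<^esub>" using \<rho>e[OF cc[OF x]] \<rho>c[OF x] pY pz[OF r(4)[OF x]] by simp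
      then show ?thesis using r(7)[OF ec[OF cc[OF x]]] by simp
    qed
    have ec0: "e (c y) = \<zero>\<^bsub>M\<^esub>" if "y \<in> ?J" for y
      using near_zero_on_multiples[OF J2 M M hom_comp[OF c e M] _ that] ecJ Jc[OF that] by (simp add: compose_def)
    have eecc: "e (e (c (c x))) = \<zero>\<^bsub>M\<^esub>" and ccee: "c (c (e (e x))) = \<zero>\<^bsub>M\<^esub>" if "x \<in> carrier M" for x
      using ec0[OF ecJ[OF that]] comm ec cc that by simp_all
    note z = hom_zero[OF M M e] hom_zero[OF M M c]
    let ?X = "{x \<in> carrier M. e (e x) = \<zero>\<^bsub>M\<^esub>}" and ?Y = "{x \<in> carrier M. c (c x) = \<zero>\<^bsub>M\<^esub>}"
    have X': "submodule ?X A M"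
      using hom_vimage_submodule[OF M M hom_comp[OF e e M] M.submodule_zero] by (simp add: compose_def cong: conj_cong)
    have Y': "submodule ?Y A M"
      using hom_vimage_submodule[OF M M hom_comp[OF c c M] M.submodule_zero] by (simp add: compose_def cong: conj_cong)
    have "?X \<inter> ?Y = {\<zero>\<^bsub>M\<^esub>}"
    proof (intro equalityI subsetI)
      fix x assume "x \<in> ?X \<inter> ?Y"
      then have x: "x \<in> carrier M" "e (e x) = \<zero>\<^bsub>M\<^esub>" "c (c x) = \<zero>\<^bsub>M\<^esub>" by auto
      let ?y = "e (c x)"
      have y: "?y \<in> carrier M" using x ec cc by simp
      have "e x = ?y" using split[OF ec[OF x(1)]] x y comm by simp
      moreover have "c x = ?y" using split[OF cc[OF x(1)]] x y by simp
      ultimately have "e ?y = \<zero>\<^bsub>M\<^esub>" "c ?y = \<zero>\<^bsub>M\<^esub>" using x by simp_all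
      then have "?y = \<zero>\<^bsub>M\<^esub>" using split[OF y] by simp
      then show "x \<in> {\<zero>\<^bsub>M\<^esub>}" using split[OF x(1)] \<open>e x = ?y\<close> \<open>c x = ?y\<close> by simp
    qed (use z in auto)
    moreover have "?X <+>\<^bsub>M\<^esub> ?Y = carrier M"
    proof (subst M.set_add_eq_carrier, blast, blast, intro ballI)
      fix x assume x: "x \<in> carrier M"
      \<comment> \<open>\<open>1 = (e + c)\<^sup>2\<close>, and the mixed term is split once more by \<open>e + c\<close>.\<close>
      let ?y = "e (c x)"
      have y: "?y \<in> carrier M" "?y \<in> ?J" using x ec cc ecJ by auto
      let ?u = "c (c x) \<oplus>\<^bsub>M\<^esub> (c ?y \<oplus>\<^bsub>M\<^esub> c ?y)" and ?w = "e (e x) \<oplus>\<^bsub>M\<^esub> (e ?y \<oplus>\<^bsub>M\<^esub> e ?y)"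
      note cl = x y(1) ec cc
      have eec: "e (e (c w)) = \<zero>\<^bsub>M\<^esub>" and cce: "c (c (e w)) = \<zero>\<^bsub>M\<^esub>" if "w \<in> ?J" for w
        using ec0[OF that] Jc[OF that] comm z cc ec by simp_all
      have "?u \<in> ?X" using cl eec[OF y(2)] eecc[OF x] by (simp add: hom_add[OF e])
      moreover have "?w \<in> ?Y" using cl cce[OF y(2)] ccee[OF x] by (simp add: hom_add[OF c])
      moreover have "x = ?u \<oplus>\<^bsub>M\<^esub> ?w"
      proof -
        have "x = (e (e x) \<oplus>\<^bsub>M\<^esub> ?y) \<oplus>\<^bsub>M\<^esub> (?y \<oplus>\<^bsub>M\<^esub> c (c x))"
          using split[OF x] split[OF ec[OF x]] split[OF cc[OF x]] comm[OF x] by simp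
        also have "\<dots> = (e (e x) \<oplus>\<^bsub>M\<^esub> (e ?y \<oplus>\<^bsub>M\<^esub> c ?y)) \<oplus>\<^bsub>M\<^esub> ((e ?y \<oplus>\<^bsub>M\<^esub> c ?y) \<oplus>\<^bsub>M\<^esub> c (c x))"
          using split[OF y(1)] by simp
        also have "\<dots> = ?u \<oplus>\<^bsub>M\<^esub> ?w" using cl by (simp add: M.M.a_ac)
        finally show ?thesis .
      qed
      ultimately show "\<exists>u\<in>?X. \<exists>w\<in>?Y. x = u \<oplus>\<^bsub>M\<^esub> w" by blast
    qed
    ultimately consider "?X = {\<zero>\<^bsub>M\<^esub>}" | "?Y = {\<zero>\<^bsub>M\<^esub>}"
      using ind X' Y' unfolding indecomposable_def by blast
    then show ?thesis
    proof cases
      case 1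
      have "y = \<zero>\<^bsub>reduce M\<^esub>" if y: "y \<in> Y" for y
      proof -
        have yc: "y \<in> carrier (reduce M)" using y Y unfolding R.submodule_iff by blast
        obtain x where x: "x \<in> carrier M" "y = \<rho> M x" by (rule reduce_elim[OF M yc])
        have \<rho>cx: "\<rho> M (c x) = y" using \<rho>c[OF x(1)] x(2) pY[OF y] yc by (simp add: R.diff_zero)
        have "\<rho> M (c (c x)) = y" using \<rho>c[OF cc[OF x(1)]] \<rho>cx pY[OF y] yc by (simp add: R.diff_zero)
        moreover have "c (c x) \<in> ?X" using eecc x(1) cc by simp
        ultimately show ?thesis using 1 r(7)[of "\<zero>\<^bsub>M\<^esub>"] Jsub by (auto simp: M.submodule_iff)
      qed
      then show ?thesis using Y R.submodule_iff by blast
    next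
      case 2
      have "y = \<zero>\<^bsub>reduce M\<^esub>" if y: "y \<in> X" for y
      proof -
        have yc: "y \<in> carrier (reduce M)" using y X unfolding R.submodule_iff by blast
        obtain x where x: "x \<in> carrier M" "y = \<rho> M x" by (rule reduce_elim[OF M yc])
        have \<rho>ex: "\<rho> M (e x) = y" using \<rho>e[OF x(1)] x(2) pX[OF y] by simp
        have "\<rho> M (e (e x)) = y" using \<rho>e[OF ec[OF x(1)]] \<rho>ex pX[OF y] by simp
        moreover have "e (e x) \<in> ?Y" using ccee x(1) ec by simp
        ultimately show ?thesis using 2 r(7)[of "\<zero>\<^bsub>M\<^esub>"] Jsub by (auto simp: M.submodule_iff)
      qed
      then show ?thesis using X R.submodule_iff by blast
    qed
  qed
  ultimately have "indecomposable A (reduce M)" unfolding indecomposable_def by blast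
  then show ?thesis using corresponds_indecomposable[OF corresponds_reduction[OF M] r(1)] by simp
qed

end

lemma iso_rel_equiv:
  "(M, M) \<in> iso_rel A \<longleftrightarrow> M \<in> mod_cat A"
  "(M, N) \<in> iso_rel A \<Longrightarrow> (N, M) \<in> iso_rel A"
  "(M, N) \<in> iso_rel A \<Longrightarrow> (N, P) \<in> iso_rel A \<Longrightarrow> (M, P) \<in> iso_rel A"
  using module_iso_refl module_iso_sym module_iso_trans by (auto simp: iso_rel_def mod_cat_def)

text \<open>On a class of modules between which homomorphisms lift, \<open>M \<mapsto> M/JM\<close> is injective on isomorphism
  classes, and so finiteness over \<open>A/J\<close> bounds the class.\<close>
lemma (in quotient_algebra) finitely_many_classes:
  fixes C :: "('a, 'k) fmod set"
  assumes J2: "\<forall>i\<in>J. \<forall>j\<in>J. i \<otimes>\<^bsub>A\<^esub> j = \<zero>\<^bsub>A\<^esub>"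
    and fin: "tau_tilting_finite K B"
    and C: "\<And>M. M \<in> C \<Longrightarrow> M \<in> mod_cat A \<and> indecomposable A M \<and> tau_rigid K B (reduction M)"
    and lift: "\<And>M N. M \<in> C \<Longrightarrow> N \<in> C \<Longrightarrow> lifts M N"
  shows "finite ((\<lambda>M. iso_rel A `` {M}) ` C)"
proof -
  let ?F = "\<lambda>M. iso_rel B `` {reduction M}"
  have lm: "left_module A M" if "M \<in> C" for M using C[OF that] by (simp add: mod_cat_def)
  have "?F ` C \<subseteq> {M. indecomposable B M \<and> tau_rigid K B M} // iso_rel B"
  proof
    fix Z assume "Z \<in> ?F ` C"
    then obtain M where M: "M \<in> C" "Z = ?F M" by blast
    have "indecomposable B (reduction M)"
      using indecomposable_reduction[OF J2 lm[OF M(1)] lift[OF M(1) M(1)]] C[OF M(1)] by blast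
    then show "Z \<in> {M. indecomposable B M \<and> tau_rigid K B M} // iso_rel B"
      unfolding M(2) using C[OF M(1)] by (intro quotientI) blast
  qed
  then have finF: "finite (?F ` C)" using fin unfolding tau_tilting_finite_def by (rule finite_subset)
  have eq: "iso_rel A `` {M} = iso_rel A `` {N}" if MN: "M \<in> C" "N \<in> C" "?F M = ?F N" for M N
  proof -
    have "reduction N \<in> mod_cat B" using C[OF MN(2)] by (simp add: tau_rigid_def)
    then have "(reduction M, reduction N) \<in> iso_rel B" using MN(3) iso_rel_equiv(1) by blast
    then have "module_iso A M N"
      using module_iso_of_reduction[OF J2 lm[OF MN(1)] lm[OF MN(2)] lift lift] MN by (auto simp: iso_rel_def)
    then have "(M, N) \<in> iso_rel A" using C MN by (auto simp: iso_rel_def)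
    then show ?thesis using iso_rel_equiv(2,3) by blast
  qed
  have "(\<lambda>M. iso_rel A `` {M}) ` C \<subseteq> (\<lambda>X. iso_rel A `` {SOME M. M \<in> C \<and> ?F M = X}) ` ?F ` C"
  proof
    fix Z assume "Z \<in> (\<lambda>M. iso_rel A `` {M}) ` C"
    then obtain M where M: "M \<in> C" "Z = iso_rel A `` {M}" by blast
    let ?M = "SOME M'. M' \<in> C \<and> ?F M' = ?F M"
    have "?M \<in> C \<and> ?F ?M = ?F M" using M(1) by (intro someI[of "\<lambda>M'. M' \<in> C \<and> ?F M' = ?F M"]) simp
    then have "Z = iso_rel A `` {?M}" using eq[of M ?M] M by simp
    then show "Z \<in> (\<lambda>X. iso_rel A `` {SOME M. M \<in> C \<and> ?F M = X}) ` ?F ` C" using M(1) by blast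
  qed
  then show ?thesis by (rule finite_subset[OF _ finite_imageI[OF finF]])
qed

section \<open>Algebras with a node\<close>

text \<open>The features of the algebra of a bound quiver with a node \<open>x\<close> that matter: \<open>e\<close> is the trivial path
  at \<open>x\<close>, \<open>r\<close> is the arrow ideal, and \<open>\<epsilon>\<close> is the action of the algebra on the simple module at
  \<open>x\<close>. That \<open>x\<close> is a node means \<open>r e r = 0\<close>.\<close>
locale node_algebra = k_algebra K A
  for K :: "('k, 'c) ring_scheme" and A :: "('k, 'a) module" +
  fixes e :: 'a and r :: "'a set" and \<epsilon> :: "'a \<Rightarrow> 'k"
  assumes e_in: "e \<in> carrier A" and ee: "e \<otimes>\<^bsub>A\<^esub> e = e" and r: "ideal r A"
    and rer: "a \<in> r \<Longrightarrow> b \<in> r \<Longrightarrow> (a \<otimes>\<^bsub>A\<^esub> e) \<otimes>\<^bsub>A\<^esub> b = \<zero>\<^bsub>A\<^esub>"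
    and \<epsilon>_closed: "a \<in> carrier A \<Longrightarrow> \<epsilon> a \<in> carrier K"
    and \<epsilon>_add: "a \<in> carrier A \<Longrightarrow> b \<in> carrier A \<Longrightarrow> \<epsilon> (a \<oplus>\<^bsub>A\<^esub> b) = \<epsilon> a \<oplus>\<^bsub>K\<^esub> \<epsilon> b"
    and \<epsilon>_mult: "a \<in> carrier A \<Longrightarrow> b \<in> carrier A \<Longrightarrow> \<epsilon> (a \<otimes>\<^bsub>A\<^esub> b) = \<epsilon> a \<otimes>\<^bsub>K\<^esub> \<epsilon> b"
    and \<epsilon>_scalar: "c \<in> carrier K \<Longrightarrow> \<epsilon> (scalar c) = c"
    and e_left: "a \<in> carrier A \<Longrightarrow> e \<otimes>\<^bsub>A\<^esub> a \<ominus>\<^bsub>A\<^esub> scalar (\<epsilon> a) \<otimes>\<^bsub>A\<^esub> e \<in> r"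
    and e_right: "a \<in> carrier A \<Longrightarrow> a \<otimes>\<^bsub>A\<^esub> e \<ominus>\<^bsub>A\<^esub> scalar (\<epsilon> a) \<otimes>\<^bsub>A\<^esub> e \<in> r"
begin

sublocale K: field K by (rule field)
sublocale A: ring A by (rule alg_ring)
sublocale r: ideal r A by (rule r)

text \<open>For a bound quiver, \<open>J_in\<close> is generated by the arrows ending at the node, \<open>J_out\<close> by those
  starting there. Because of   \<open>r e r = 0\<close> the sets \<open>e r\<close> and \<open>r e\<close> are already two-sided ideals.\<close>
definition J_in where "J_in = (\<lambda>a. e \<otimes>\<^bsub>A\<^esub> a) ` r"
definition J_out where "J_out = (\<lambda>a. a \<otimes>\<^bsub>A\<^esub> e) ` r"

lemma rA: "a \<in> r \<Longrightarrow> a \<in> carrier A" by (rule r.Icarr)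

lemma \<epsilon>_one: "\<epsilon> \<one>\<^bsub>A\<^esub> = \<one>\<^bsub>K\<^esub>"
  using \<epsilon>_scalar[of "\<one>\<^bsub>K\<^esub>"] scalar_one field by (metis cring.axioms(1) domain.axioms(1) field.axioms(1) monoid.one_closed ring.is_monoid)

lemma diff_add: "x \<in> carrier A \<Longrightarrow> y \<in> carrier A \<Longrightarrow> (x \<ominus>\<^bsub>A\<^esub> y) \<oplus>\<^bsub>A\<^esub> y = x"
  by (simp add: a_minus_def A.a_assoc A.l_neg)

lemma mult_e_decomp:
  assumes b: "b \<in> carrier A"
  obtains s where "s \<in> r" "b \<otimes>\<^bsub>A\<^esub> e = s \<otimes>\<^bsub>A\<^esub> e \<oplus>\<^bsub>A\<^esub> scalar (\<epsilon> b) \<otimes>\<^bsub>A\<^esub> e"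
proof -
  let ?s = "b \<otimes>\<^bsub>A\<^esub> e \<ominus>\<^bsub>A\<^esub> scalar (\<epsilon> b) \<otimes>\<^bsub>A\<^esub> e"
  have se: "scalar (\<epsilon> b) \<in> carrier A" using b by (simp add: \<epsilon>_closed)
  have "?s \<otimes>\<^bsub>A\<^esub> e = ?s"
    using b e_in se by (simp add: a_minus_def A.l_distr A.l_minus A.m_assoc ee)
  then have "b \<otimes>\<^bsub>A\<^esub> e = ?s \<otimes>\<^bsub>A\<^esub> e \<oplus>\<^bsub>A\<^esub> scalar (\<epsilon> b) \<otimes>\<^bsub>A\<^esub> e"
    using b e_in se by (simp add: diff_add)
  then show ?thesis using e_right[OF b] that by blast
qed

lemma e_mult_decomp:
  assumes b: "b \<in> carrier A"
  obtains s where "s \<in> r" "e \<otimes>\<^bsub>A\<^esub> b = e \<otimes>\<^bsub>A\<^esub> s \<oplus>\<^bsub>A\<^esub> scalar (\<epsilon> b) \<otimes>\<^bsub>A\<^esub> e"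
proof -
  let ?s = "e \<otimes>\<^bsub>A\<^esub> b \<ominus>\<^bsub>A\<^esub> scalar (\<epsilon> b) \<otimes>\<^bsub>A\<^esub> e"
  have se: "scalar (\<epsilon> b) \<in> carrier A" using b by (simp add: \<epsilon>_closed)
  have "e \<otimes>\<^bsub>A\<^esub> (scalar (\<epsilon> b) \<otimes>\<^bsub>A\<^esub> e) = scalar (\<epsilon> b) \<otimes>\<^bsub>A\<^esub> e"
    using b e_in se scalar_mult_eq[OF \<epsilon>_closed[OF b] e_in] by (metis A.m_assoc ee)
  moreover have "e \<otimes>\<^bsub>A\<^esub> (e \<otimes>\<^bsub>A\<^esub> b) = e \<otimes>\<^bsub>A\<^esub> b" using b e_in by (metis A.m_assoc ee)
  ultimately have "e \<otimes>\<^bsub>A\<^esub> ?s = ?s"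
    using b e_in se by (simp add: a_minus_def A.r_distr A.r_minus)
  then have "e \<otimes>\<^bsub>A\<^esub> b = e \<otimes>\<^bsub>A\<^esub> ?s \<oplus>\<^bsub>A\<^esub> scalar (\<epsilon> b) \<otimes>\<^bsub>A\<^esub> e"
    using b e_in se by (simp add: diff_add)
  then show ?thesis using e_left[OF b] that by blast
qed

lemma J_in_ideal: "ideal J_in A"
proof (rule idealI)
  show "ring A" by (rule alg_ring)
  show "subgroup J_in (add_monoid A)"
  proof (rule A.add.subgroupI)
    show "J_in \<subseteq> carrier A" using rA e_in by (auto simp: J_in_def)
    show "J_in \<noteq> {}" unfolding J_in_def using additive_subgroup.zero_closed[OF r.additive_subgroup_axioms] by blast
    fix x assume "x \<in> J_in"
    then obtain a where a: "a \<in> r" "x = e \<otimes>\<^bsub>A\<^esub> a" by (auto simp: J_in_def)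
    then have "\<ominus>\<^bsub>A\<^esub> x = e \<otimes>\<^bsub>A\<^esub> (\<ominus>\<^bsub>A\<^esub> a)" using e_in rA by (simp add: A.r_minus)
    then show "\<ominus>\<^bsub>A\<^esub> x \<in> J_in" using r.a_inv_closed a(1) by (auto simp: J_in_def)
    fix y assume "y \<in> J_in"
    then obtain b where b: "b \<in> r" "y = e \<otimes>\<^bsub>A\<^esub> b" by (auto simp: J_in_def)
    then have "x \<oplus>\<^bsub>A\<^esub> y = e \<otimes>\<^bsub>A\<^esub> (a \<oplus>\<^bsub>A\<^esub> b)" using a e_in rA by (simp add: A.r_distr)
    then show "x \<oplus>\<^bsub>A\<^esub> y \<in> J_in" using r.a_closed a(1) b(1) by (auto simp: J_in_def)
  qed
  fix x b assume x: "x \<in> J_in" and b: "b \<in> carrier A"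
  obtain a where a: "a \<in> r" "x = e \<otimes>\<^bsub>A\<^esub> a" using x by (auto simp: J_in_def)
  obtain s where s: "s \<in> r" "b \<otimes>\<^bsub>A\<^esub> e = s \<otimes>\<^bsub>A\<^esub> e \<oplus>\<^bsub>A\<^esub> scalar (\<epsilon> b) \<otimes>\<^bsub>A\<^esub> e"
    by (rule mult_e_decomp[OF b])
  have se: "scalar (\<epsilon> b) \<in> carrier A" using b by (simp add: \<epsilon>_closed)
  have "b \<otimes>\<^bsub>A\<^esub> x = (b \<otimes>\<^bsub>A\<^esub> e) \<otimes>\<^bsub>A\<^esub> a" using a b e_in rA by (simp add: A.m_assoc)
  also have "\<dots> = (s \<otimes>\<^bsub>A\<^esub> e) \<otimes>\<^bsub>A\<^esub> a \<oplus>\<^bsub>A\<^esub> (scalar (\<epsilon> b) \<otimes>\<^bsub>A\<^esub> e) \<otimes>\<^bsub>A\<^esub> a"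
    using s a e_in rA se by (simp add: A.l_distr)
  also have "\<dots> = (e \<otimes>\<^bsub>A\<^esub> scalar (\<epsilon> b)) \<otimes>\<^bsub>A\<^esub> a"
  proof -
    have "scalar (\<epsilon> b) \<otimes>\<^bsub>A\<^esub> e = e \<otimes>\<^bsub>A\<^esub> scalar (\<epsilon> b)" using scalar_mult_eq[OF \<epsilon>_closed[OF b] e_in] by simp
    then show ?thesis using rer[OF s(1) a(1)] rA[OF a(1)] e_in se by simp
  qed
  also have "\<dots> = e \<otimes>\<^bsub>A\<^esub> (scalar (\<epsilon> b) \<otimes>\<^bsub>A\<^esub> a)" using a e_in rA se by (simp add: A.m_assoc)
  finally show "b \<otimes>\<^bsub>A\<^esub> x \<in> J_in" using r.I_l_closed[OF a(1) se] by (auto simp: J_in_def)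
  have "x \<otimes>\<^bsub>A\<^esub> b = e \<otimes>\<^bsub>A\<^esub> (a \<otimes>\<^bsub>A\<^esub> b)" using a b e_in rA by (simp add: A.m_assoc)
  then show "x \<otimes>\<^bsub>A\<^esub> b \<in> J_in" using r.I_r_closed[OF a(1) b] by (auto simp: J_in_def)
qed

lemma J_out_ideal: "ideal J_out A"
proof (rule idealI)
  show "ring A" by (rule alg_ring)
  show "subgroup J_out (add_monoid A)"
  proof (rule A.add.subgroupI)
    show "J_out \<subseteq> carrier A" using rA e_in by (auto simp: J_out_def)
    show "J_out \<noteq> {}" unfolding J_out_def using additive_subgroup.zero_closed[OF r.additive_subgroup_axioms] by blast
    fix x assume "x \<in> J_out"
    then obtain a where a: "a \<in> r" "x = a \<otimes>\<^bsub>A\<^esub> e" by (auto simp: J_out_def)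
    then have "\<ominus>\<^bsub>A\<^esub> x = (\<ominus>\<^bsub>A\<^esub> a) \<otimes>\<^bsub>A\<^esub> e" using e_in rA by (simp add: A.l_minus)
    then show "\<ominus>\<^bsub>A\<^esub> x \<in> J_out" using r.a_inv_closed a(1) by (auto simp: J_out_def)
    fix y assume "y \<in> J_out"
    then obtain b where b: "b \<in> r" "y = b \<otimes>\<^bsub>A\<^esub> e" by (auto simp: J_out_def)
    then have "x \<oplus>\<^bsub>A\<^esub> y = (a \<oplus>\<^bsub>A\<^esub> b) \<otimes>\<^bsub>A\<^esub> e" using a e_in rA by (simp add: A.l_distr)
    then show "x \<oplus>\<^bsub>A\<^esub> y \<in> J_out" using r.a_closed a(1) b(1) by (auto simp: J_out_def)
  qed
  fix x b assume x: "x \<in> J_out" and b: "b \<in> carrier A"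
  obtain a where a: "a \<in> r" "x = a \<otimes>\<^bsub>A\<^esub> e" using x by (auto simp: J_out_def)
  obtain s where s: "s \<in> r" "e \<otimes>\<^bsub>A\<^esub> b = e \<otimes>\<^bsub>A\<^esub> s \<oplus>\<^bsub>A\<^esub> scalar (\<epsilon> b) \<otimes>\<^bsub>A\<^esub> e"
    by (rule e_mult_decomp[OF b])
  have se: "scalar (\<epsilon> b) \<in> carrier A" using b by (simp add: \<epsilon>_closed)
  have "x \<otimes>\<^bsub>A\<^esub> b = a \<otimes>\<^bsub>A\<^esub> (e \<otimes>\<^bsub>A\<^esub> b)" using a b e_in rA by (simp add: A.m_assoc)
  also have "\<dots> = (a \<otimes>\<^bsub>A\<^esub> e) \<otimes>\<^bsub>A\<^esub> s \<oplus>\<^bsub>A\<^esub> (a \<otimes>\<^bsub>A\<^esub> scalar (\<epsilon> b)) \<otimes>\<^bsub>A\<^esub> e"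
    using s a e_in rA se by (simp add: A.r_distr A.m_assoc)
  also have "\<dots> = (a \<otimes>\<^bsub>A\<^esub> scalar (\<epsilon> b)) \<otimes>\<^bsub>A\<^esub> e"
    using rer[OF a(1) s(1)] a e_in rA se by simp
  finally show "x \<otimes>\<^bsub>A\<^esub> b \<in> J_out" using r.I_r_closed[OF a(1) se] by (auto simp: J_out_def)
  have "b \<otimes>\<^bsub>A\<^esub> x = (b \<otimes>\<^bsub>A\<^esub> a) \<otimes>\<^bsub>A\<^esub> e" using a b e_in rA by (simp add: A.m_assoc)
  then show "b \<otimes>\<^bsub>A\<^esub> x \<in> J_out" using r.I_l_closed[OF a(1) b] by (auto simp: J_out_def)
qed

sublocale jin: quotient_algebra K A J_in
  by (intro quotient_algebra.intro quotient_algebra_axioms.intro k_algebra_axioms J_in_ideal)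

sublocale jout: quotient_algebra K A J_out
  by (intro quotient_algebra.intro quotient_algebra_axioms.intro k_algebra_axioms J_out_ideal)

lemma J_in_square: "\<forall>i\<in>J_in. \<forall>j\<in>J_in. i \<otimes>\<^bsub>A\<^esub> j = \<zero>\<^bsub>A\<^esub>"
proof -
  have "(e \<otimes>\<^bsub>A\<^esub> a) \<otimes>\<^bsub>A\<^esub> (e \<otimes>\<^bsub>A\<^esub> b) = \<zero>\<^bsub>A\<^esub>" if "a \<in> r" "b \<in> r" for a b
  proof -
    have "(e \<otimes>\<^bsub>A\<^esub> a) \<otimes>\<^bsub>A\<^esub> (e \<otimes>\<^bsub>A\<^esub> b) = e \<otimes>\<^bsub>A\<^esub> ((a \<otimes>\<^bsub>A\<^esub> e) \<otimes>\<^bsub>A\<^esub> b)"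
      using that e_in rA by (simp add: A.m_assoc)
    then show ?thesis using rer[OF that] e_in by simp
  qed
  then show ?thesis by (auto simp: J_in_def)
qed

lemma J_out_square: "\<forall>i\<in>J_out. \<forall>j\<in>J_out. i \<otimes>\<^bsub>A\<^esub> j = \<zero>\<^bsub>A\<^esub>"
proof -
  have "(a \<otimes>\<^bsub>A\<^esub> e) \<otimes>\<^bsub>A\<^esub> (b \<otimes>\<^bsub>A\<^esub> e) = \<zero>\<^bsub>A\<^esub>" if "a \<in> r" "b \<in> r" for a b
  proof -
    have "(a \<otimes>\<^bsub>A\<^esub> e) \<otimes>\<^bsub>A\<^esub> (b \<otimes>\<^bsub>A\<^esub> e) = ((a \<otimes>\<^bsub>A\<^esub> e) \<otimes>\<^bsub>A\<^esub> b) \<otimes>\<^bsub>A\<^esub> e"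
      using that e_in rA by (simp add: A.m_assoc)
    then show ?thesis using rer[OF that] e_in by simp
  qed
  then show ?thesis by (auto simp: J_out_def)
qed

text \<open>The simple module at the node is not a direct summand of \<open>N/rN\<close>.\<close>
definition avoids_top :: "('a, 'b) module \<Rightarrow> bool"
  where "avoids_top N \<longleftrightarrow> (\<forall>y\<in>carrier N. e \<odot>\<^bsub>N\<^esub> y \<in> ideal_smult r N)"

lemma rad_e_rad:
  assumes N: "left_module A N" and a: "a \<in> r" and z: "z \<in> ideal_smult r N"
  shows "a \<odot>\<^bsub>N\<^esub> (e \<odot>\<^bsub>N\<^esub> z) = \<zero>\<^bsub>N\<^esub>"
proof -
  interpret N: left_module A N by (rule N)
  have sub: "\<And>y. y \<in> ideal_smult r N \<Longrightarrow> y \<in> carrier N"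
    using ideal_smult_submodule[OF N r] unfolding N.submodule_iff by blast
  have "(a \<otimes>\<^bsub>A\<^esub> e) \<odot>\<^bsub>N\<^esub> z = \<zero>\<^bsub>N\<^esub>" using z
  proof induct
    case (smult b y)
    then show ?case using rer[OF a smult(1)] rA a e_in by (simp add: N.smult_assoc1[symmetric])
  next
    case (add x y)
    then show ?case using sub rA a e_in by (simp add: N.smult_r_distr)
  qed
  then show ?thesis using rA a e_in sub[OF z] by (simp add: N.smult_assoc1)
qed

lemma J_in_multiples:
  assumes N: "left_module A N" and z: "z \<in> ideal_smult J_in N"
  shows "e \<odot>\<^bsub>N\<^esub> z = z" "a \<in> r \<Longrightarrow> a \<odot>\<^bsub>N\<^esub> z = \<zero>\<^bsub>N\<^esub>"
proof -
  interpret N: left_module A N by (rule N)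
  have sub: "\<And>y. y \<in> ideal_smult J_in N \<Longrightarrow> y \<in> carrier N"
    using ideal_smult_submodule[OF N J_in_ideal] unfolding N.submodule_iff by blast
  show ez: "e \<odot>\<^bsub>N\<^esub> z = z" using z
  proof induct
    case (smult j y)
    then obtain b where b: "b \<in> r" "j = e \<otimes>\<^bsub>A\<^esub> b" by (auto simp: J_in_def)
    have "e \<otimes>\<^bsub>A\<^esub> j = j" using b rA e_in by (metis A.m_assoc ee)
    then show ?case using b rA e_in smult by (metis A.m_closed N.smult_assoc1)
  next
    case (add x y)
    then show ?case using sub e_in by (simp add: N.smult_r_distr)
  qed
  show "a \<odot>\<^bsub>N\<^esub> z = \<zero>\<^bsub>N\<^esub>" if a: "a \<in> r" using z
  proof induct
    case (smult j y)
    then obtain b where b: "b \<in> r" "j = e \<otimes>\<^bsub>A\<^esub> b" by (auto simp: J_in_def)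
    have "a \<otimes>\<^bsub>A\<^esub> j = \<zero>\<^bsub>A\<^esub>" using b rer[OF a b(1)] a rA e_in by (simp add: A.m_assoc)
    then show ?case using b rA e_in smult a by (metis A.m_closed N.smult_assoc1 N.smult_l_null)
  next
    case (add x y)
    then show ?case using sub a rA by (simp add: N.smult_r_distr)
  qed
qed

lemma J_out_multiples:
  assumes N: "left_module A N" and top: "avoids_top N"
  shows "ideal_smult J_out N = {\<zero>\<^bsub>N\<^esub>}"
proof -
  interpret N: left_module A N by (rule N)
  have "ideal_smult J_out N \<subseteq> {\<zero>\<^bsub>N\<^esub>}"
  proof (rule ideal_smult_least[OF N N.submodule_zero])
    fix j y assume j: "j \<in> J_out" and y: "y \<in> carrier N"
    obtain a where a: "a \<in> r" "j = a \<otimes>\<^bsub>A\<^esub> e" using j by (auto simp: J_out_def)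
    have "e \<odot>\<^bsub>N\<^esub> (e \<odot>\<^bsub>N\<^esub> y) = e \<odot>\<^bsub>N\<^esub> y" using e_in y ee by (metis N.smult_assoc1)
    then have "j \<odot>\<^bsub>N\<^esub> y = a \<odot>\<^bsub>N\<^esub> (e \<odot>\<^bsub>N\<^esub> (e \<odot>\<^bsub>N\<^esub> y))" using a rA e_in y by (simp add: N.smult_assoc1)
    also have "\<dots> = \<zero>\<^bsub>N\<^esub>" using rad_e_rad[OF N a(1)] top y by (simp add: avoids_top_def)
    finally show "j \<odot>\<^bsub>N\<^esub> y \<in> {\<zero>\<^bsub>N\<^esub>}" by simp
  qed
  moreover have "\<zero>\<^bsub>N\<^esub> \<in> ideal_smult J_out N"
    using ideal_smult_submodule[OF N J_out_ideal] unfolding N.submodule_iff by blast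
  ultimately show ?thesis by blast
qed

section \<open>The simple module at the node\<close>

text \<open>The simple module at the node is \<open>K\<close> with the action through \<open>\<epsilon>\<close>. Constant sequences turn it into
  an object of the module category.\<close>
definition node_simple :: "('a, nat \<Rightarrow> 'k) module"
  where "node_simple = image_module (with_smult (regular_module K) (\<lambda>a x. \<epsilon> a \<otimes>\<^bsub>K\<^esub> x)) (\<lambda>c n. c)"

lemma node_simple:
  shows "node_simple \<in> mod_cat A"
    and "carrier node_simple = (\<lambda>c n. c) ` carrier K"
    and "c \<in> carrier K \<Longrightarrow> d \<in> carrier K \<Longrightarrow> (\<lambda>n. c) \<oplus>\<^bsub>node_simple\<^esub> (\<lambda>n. d) = (\<lambda>n. c \<oplus>\<^bsub>K\<^esub> d)"
    and "a \<in> carrier A \<Longrightarrow> c \<in> carrier K \<Longrightarrow> a \<odot>\<^bsub>node_simple\<^esub> (\<lambda>n. c) = (\<lambda>n. \<epsilon> a \<otimes>\<^bsub>K\<^esub> c)"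
    and "\<zero>\<^bsub>node_simple\<^esub> = (\<lambda>n. \<zero>\<^bsub>K\<^esub>)"
proof -
  let ?V = "with_smult (regular_module K) (\<lambda>a x. \<epsilon> a \<otimes>\<^bsub>K\<^esub> x) :: ('a, 'k) module"
  have V: "left_module A ?V"
  proof (rule left_moduleI)
    show "abelian_group ?V"
      using abelian_groupE[OF K.is_abelian_group] by (intro abelian_groupI) simp_all
  qed (simp_all add: alg_ring \<epsilon>_closed \<epsilon>_add \<epsilon>_mult \<epsilon>_one K.l_distr K.r_distr K.m_assoc)
  interpret V: left_module A ?V by (rule V)
  have "inj_on (\<lambda>c n::nat. c) (carrier ?V)" by (auto simp: inj_on_def fun_eq_iff)
  then interpret q: module_quotient_map A ?V "{\<zero>\<^bsub>?V\<^esub>}" "\<lambda>c n::nat. c"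
    by (rule module_quotient_map_inj[OF V])
  have "fin_gen A ?V" unfolding fin_gen_def
  proof (intro exI conjI allI impI)
    show "finite {\<one>\<^bsub>K\<^esub>}" "{\<one>\<^bsub>K\<^esub>} \<subseteq> carrier ?V" by simp_all
    fix N assume N: "submodule N A ?V \<and> {\<one>\<^bsub>K\<^esub>} \<subseteq> N"
    have "c \<in> N" if "c \<in> carrier K" for c
    proof -
      have "\<forall>a\<in>carrier A. \<forall>x\<in>N. a \<odot>\<^bsub>?V\<^esub> x \<in> N" "\<one>\<^bsub>K\<^esub> \<in> N"
        using conjunct1[OF N] conjunct2[OF N] unfolding V.submodule_iff by simp_all
      then have "scalar c \<odot>\<^bsub>?V\<^esub> \<one>\<^bsub>K\<^esub> \<in> N" using scalar_closed[OF that] by blast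
      then show ?thesis using that by (simp add: \<epsilon>_scalar)
    qed
    then show "N = carrier ?V" using conjunct1[OF N] unfolding V.submodule_iff by auto
  qed
  then show "node_simple \<in> mod_cat A"
    using q.left_module_image q.fin_gen_quotient by (simp add: mod_cat_def node_simple_def)
  show "carrier node_simple = (\<lambda>c n. c) ` carrier K"
    and "c \<in> carrier K \<Longrightarrow> d \<in> carrier K \<Longrightarrow> (\<lambda>n. c) \<oplus>\<^bsub>node_simple\<^esub> (\<lambda>n. d) = (\<lambda>n. c \<oplus>\<^bsub>K\<^esub> d)"
    and "a \<in> carrier A \<Longrightarrow> c \<in> carrier K \<Longrightarrow> a \<odot>\<^bsub>node_simple\<^esub> (\<lambda>n. c) = (\<lambda>n. \<epsilon> a \<otimes>\<^bsub>K\<^esub> c)"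
    and "\<zero>\<^bsub>node_simple\<^esub> = (\<lambda>n. \<zero>\<^bsub>K\<^esub>)"
    using q.carrier_image q.q_add[of c d] q.q_smult[of a c] q.q_zero by (simp_all add: node_simple_def)
qed

lemma hom_to_node_simple:
  assumes N: "left_module A N" and x: "x \<in> carrier N" "e \<odot>\<^bsub>N\<^esub> x \<notin> ideal_smult r N"
  obtains h where "h \<in> module_hom A N node_simple" "h x = (\<lambda>n. \<one>\<^bsub>K\<^esub>)"
proof -
  interpret N: left_module A N by (rule N)
  let ?R = "ideal_smult r N"
  have R: "submodule ?R A N" by (rule ideal_smult_submodule[OF N r])
  have Rc: "\<And>y. y \<in> ?R \<Longrightarrow> y \<in> carrier N" and Rs: "\<And>a y. a \<in> carrier A \<Longrightarrow> y \<in> ?R \<Longrightarrow> a \<odot>\<^bsub>N\<^esub> y \<in> ?R"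
    and Ra: "\<And>y z. y \<in> ?R \<Longrightarrow> z \<in> ?R \<Longrightarrow> y \<oplus>\<^bsub>N\<^esub> z \<in> ?R" and R0: "\<zero>\<^bsub>N\<^esub> \<in> ?R"
    using R unfolding N.submodule_iff by blast+
  let ?V = "restrict_scalars A N"
  have V_simps: "carrier ?V = carrier N" "add ?V = add N" "\<zero>\<^bsub>?V\<^esub> = \<zero>\<^bsub>N\<^esub>" "\<And>c y. c \<odot>\<^bsub>?V\<^esub> y = scalar c \<odot>\<^bsub>N\<^esub> y"
    by (simp_all add: restrict_scalars_def scalar_def)
  have V: "left_module K ?V"
  proof (rule left_moduleI)
    show "abelian_group ?V"
      using abelian_groupE[OF N.M.abelian_group_axioms] by (intro abelian_groupI) (simp_all add: V_simps)
  qed (simp_all add: V_simps K.ring_axioms scalar_add scalar_mult scalar_one N.smult_l_distr N.smult_r_distr N.smult_assoc1)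
  interpret V: left_module K ?V by (rule V)
  let ?W = "{y \<in> carrier N. e \<odot>\<^bsub>N\<^esub> y \<in> ?R}"
  have com: "e \<odot>\<^bsub>N\<^esub> (scalar c \<odot>\<^bsub>N\<^esub> y) = scalar c \<odot>\<^bsub>N\<^esub> (e \<odot>\<^bsub>N\<^esub> y)" if "c \<in> carrier K" "y \<in> carrier N" for c y
    using that e_in by (simp add: N.smult_assoc1[symmetric] scalar_mult_eq)
  have W: "submodule ?W K ?V"
    unfolding V.submodule_iff V_simps using e_in Rs Ra R0 com by (auto simp: N.smult_r_distr)
  obtain F where F_cl: "\<And>y. y \<in> carrier N \<Longrightarrow> F y \<in> carrier K"
    and F_add: "\<And>y z. y \<in> carrier N \<Longrightarrow> z \<in> carrier N \<Longrightarrow> F (y \<oplus>\<^bsub>N\<^esub> z) = F y \<oplus>\<^bsub>K\<^esub> F z"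
    and F_smult: "\<And>c y. c \<in> carrier K \<Longrightarrow> y \<in> carrier N \<Longrightarrow> F (scalar c \<odot>\<^bsub>N\<^esub> y) = c \<otimes>\<^bsub>K\<^esub> F y"
    and F_W: "\<And>w. w \<in> ?W \<Longrightarrow> F w = \<zero>\<^bsub>K\<^esub>" and F_x: "F x = \<one>\<^bsub>K\<^esub>"
    using linear_functional_exists[OF field V W, of x] x unfolding V_simps by blast
  have F_A: "F (a \<odot>\<^bsub>N\<^esub> y) = \<epsilon> a \<otimes>\<^bsub>K\<^esub> F y" if a: "a \<in> carrier A" and y: "y \<in> carrier N" for a y
  proof -
    let ?c = "scalar (\<epsilon> a)"
    have c: "?c \<in> carrier A" using a by (simp add: \<epsilon>_closed)
    let ?w = "a \<odot>\<^bsub>N\<^esub> y \<ominus>\<^bsub>N\<^esub> ?c \<odot>\<^bsub>N\<^esub> y"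
    have "e \<odot>\<^bsub>N\<^esub> ?w = (e \<otimes>\<^bsub>A\<^esub> a \<ominus>\<^bsub>A\<^esub> ?c \<otimes>\<^bsub>A\<^esub> e) \<odot>\<^bsub>N\<^esub> y"
    proof -
      have "e \<otimes>\<^bsub>A\<^esub> ?c = ?c \<otimes>\<^bsub>A\<^esub> e" using scalar_mult_eq[OF \<epsilon>_closed[OF a] e_in] by simp
      then have "e \<odot>\<^bsub>N\<^esub> (?c \<odot>\<^bsub>N\<^esub> y) = (?c \<otimes>\<^bsub>A\<^esub> e) \<odot>\<^bsub>N\<^esub> y"
        using c e_in y N.smult_assoc1[of e ?c y] by simp
      then show ?thesis
        using a c y e_in by (simp add: N.smult_r_diff N.smult_l_diff N.smult_assoc1[of e a y])
    qed
    also have "\<dots> \<in> ?R" by (rule ideal_smult.smult[OF e_left[OF a] y])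
    finally have "F ?w = \<zero>\<^bsub>K\<^esub>" using F_W a c y by simp
    moreover have "F (a \<odot>\<^bsub>N\<^esub> y) = F ?w \<oplus>\<^bsub>K\<^esub> F (?c \<odot>\<^bsub>N\<^esub> y)"
      using F_add[of ?w "?c \<odot>\<^bsub>N\<^esub> y"] a c y by (simp add: N.diff_add_cancel)
    ultimately show ?thesis using F_smult[OF \<epsilon>_closed[OF a] y] F_cl y a c by (simp add: \<epsilon>_closed)
  qed
  have "(\<lambda>y\<in>carrier N. (\<lambda>n. F y)) \<in> module_hom A N node_simple"
    by (rule module_homI) (auto simp: node_simple F_cl F_add F_A N)
  then show ?thesis using that[of "\<lambda>y\<in>carrier N. (\<lambda>n. F y)"] x F_x by simp
qed

end

section \<open>Tau-rigid modules over an algebra with a node\<close>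

lemma tau_rigid_factors:
  fixes M :: "('a, 'k) fmod" and \<iota> :: "'a \<Rightarrow> nat \<Rightarrow> 'k"
  assumes "k_algebra K A" and \<iota>: "inj_on \<iota> (carrier A)" and "tau_rigid K A M"
  obtains P1 P0 f g where "minimal_projective_presentation A P1 P0 M f g"
    "\<And>\<psi>. \<psi> \<in> module_hom A P1 M \<Longrightarrow> \<exists>\<chi>\<in>module_hom A P0 M. \<psi> = compose (carrier P1) \<chi> f"
proof -
  have M: "left_module A M" using assms(3) by (simp add: tau_rigid_def mod_cat_def)
  obtain P1 P0 f g where pres: "minimal_projective_presentation A P1 P0 M f g"
    and hom: "module_hom A M (dual_module K A (transpose_module A P1 P0 f))
      = {zero_hom M (dual_module K A (transpose_module A P1 P0 f))}"
    using assms(3) unfolding tau_rigid_def AR_translate_def by blast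
  have proj: "projective A P0" "projective A P1"
    and f: "f \<in> module_hom A P1 (P0\<lparr>carrier := a_kernel P0 M g\<rparr>)"
    using pres by (auto simp: minimal_projective_presentation_def projective_cover_def)
  have P0: "left_module A P0" and P1: "left_module A P1" using proj by (auto simp: projective_def mod_cat_def)
  have f0: "f \<in> module_hom A P1 P0" by (rule hom_restrict_target[OF f]) (auto simp: a_kernel_iff)
  obtain n1 p1 \<phi>1 n0 p0 \<phi>0 where "dual_basis A P1 n1 p1 \<phi>1" "dual_basis A P0 n0 p0 \<phi>0"
    using dual_basis_exists[OF \<iota> proj(2)] dual_basis_exists[OF \<iota> proj(1)] by blast
  then interpret presentation_map K A P1 P0 f n1 p1 \<phi>1 n0 p0 \<phi>0
    by (intro presentation_map.intro presentation_map_axioms.intro assms(1) P1 P0 f0)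
  show ?thesis
  proof (rule that[OF pres])
    fix \<psi> assume "\<psi> \<in> module_hom A P1 M"
    then show "\<exists>\<chi>\<in>module_hom A P0 M. \<psi> = compose (carrier P1) \<chi> f"
      by (rule factors_through_presentation[OF M hom])
  qed
qed

lemma hom_factors_through_cokernel:
  assumes P: "left_module A P" and M: "left_module A M" and N: "left_module A N"
    and g: "g \<in> module_hom A P M" "g ` carrier P = carrier M" and t: "t \<in> module_hom A P N"
    and ker: "\<And>x. x \<in> a_kernel P M g \<Longrightarrow> t x = \<zero>\<^bsub>N\<^esub>"
  obtains t' where "t' \<in> module_hom A M N" "\<And>x. x \<in> carrier P \<Longrightarrow> t' (g x) = t x"
proof -
  interpret P: left_module A P by (rule P)
  interpret M: left_module A M by (rule M)
  interpret N: left_module A N by (rule N)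
  let ?s = "inv_into (carrier P) g"
  have eq: "t (?s (g x)) = t x" if x: "x \<in> carrier P" for x
  proof -
    have s: "?s (g x) \<in> carrier P" "g (?s (g x)) = g x" using x by (auto simp: inv_into_into f_inv_into_f)
    then have "?s (g x) \<ominus>\<^bsub>P\<^esub> x \<in> a_kernel P M g"
      using x hom_diff[OF P M g(1) s(1) x] hom_closed[OF g(1) x] M.diff_eq_zero_iff by (simp add: a_kernel_iff)
    then have "t (?s (g x)) \<ominus>\<^bsub>N\<^esub> t x = \<zero>\<^bsub>N\<^esub>" using ker hom_diff[OF P N t s(1) x] by simp
    then show ?thesis using N.diff_eq_zero_iff hom_closed[OF t] s(1) x by blast
  qed
  have "restrict (\<lambda>y. t (?s y)) (carrier M) \<in> module_hom A M N"
  proof (rule module_homI)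
    fix y z assume "y \<in> carrier M" "z \<in> carrier M"
    then obtain u v where u: "u \<in> carrier P" "y = g u" "v \<in> carrier P" "z = g v" using g(2) by blast
    then show "t (?s (y \<oplus>\<^bsub>M\<^esub> z)) = t (?s y) \<oplus>\<^bsub>N\<^esub> t (?s z)"
      by (simp add: eq hom_add[OF t] flip: hom_add[OF g(1)])
  next
    fix a y assume a: "a \<in> carrier A" and "y \<in> carrier M"
    then obtain u where u: "u \<in> carrier P" "y = g u" using g(2) by blast
    then show "t (?s (a \<odot>\<^bsub>M\<^esub> y)) = a \<odot>\<^bsub>N\<^esub> t (?s y)"
      using a by (simp add: eq hom_smult[OF t] flip: hom_smult[OF g(1)])
  next
    fix y assume "y \<in> carrier M"
    then obtain u where u: "u \<in> carrier P" "y = g u" using g(2) by blast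
    then show "t (?s y) \<in> carrier N" by (simp add: eq hom_closed[OF t])
  qed (rule M)
  then show ?thesis using that eq hom_closed[OF g(1)] by simp
qed

context node_algebra
begin

text \<open>Let \<open>S\<close> be the simple module at the node, and let \<open>K1\<close> be the kernel of \<open>P0 \<rightarrow> M\<close>. If \<open>S\<close> is
  a quotient of both \<open>M\<close> and \<open>K1\<close>, then \<open>P1 \<rightarrow> K1 \<rightarrow> S\<close> lifts to a homomorphism \<open>P1 \<rightarrow> M\<close>. As the latter
  factors through \<open>P0\<close>, there is a homomorphism \<open>P0 \<rightarrow> S\<close> that is nonzero on the superfluous submodule
  \<open>K1\<close>, which is impossible.\<close>
lemma top_avoidance_dichotomy:
  fixes M P1 P0 :: "('a, 'k) fmod"
  assumes Mcat: "M \<in> mod_cat A" and pres: "minimal_projective_presentation A P1 P0 M f g"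
    and factors: "\<And>\<psi>. \<psi> \<in> module_hom A P1 M \<Longrightarrow> \<exists>\<chi>\<in>module_hom A P0 M. \<psi> = compose (carrier P1) \<chi> f"
  shows "avoids_top M \<or> avoids_top (P0\<lparr>carrier := a_kernel P0 M g\<rparr>)"
proof (rule ccontr)
  let ?PK = "P0\<lparr>carrier := a_kernel P0 M g\<rparr>"
  let ?S = node_simple
  assume neg: "\<not> (avoids_top M \<or> avoids_top ?PK)"
  have proj: "projective A P0" "projective A P1" and g: "g \<in> module_hom A P0 M" "g ` carrier P0 = carrier M"
    and sup0: "superfluous A P0 (a_kernel P0 M g)"
    and f: "f \<in> module_hom A P1 ?PK" "f ` carrier P1 = a_kernel P0 M g"
    using pres by (auto simp: minimal_projective_presentation_def projective_cover_def)
  have P0: "left_module A P0" and P1: "left_module A P1" using proj by (auto simp: projective_def mod_cat_def)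
  have M: "left_module A M" using Mcat by (simp add: mod_cat_def)
  have S: "left_module A ?S" using node_simple(1) by (simp add: mod_cat_def)
  interpret P0: left_module A P0 by (rule P0)
  interpret M: left_module A M by (rule M)
  have Ksub: "submodule (a_kernel P0 M g) A P0" by (rule submodule_kernel[OF P0 M g(1)])
  have PK: "left_module A ?PK" by (rule P0.left_module_submodule[OF Ksub])
  obtain m where m: "m \<in> carrier M" "e \<odot>\<^bsub>M\<^esub> m \<notin> ideal_smult r M" using neg by (auto simp: avoids_top_def)
  obtain k where k: "k \<in> carrier ?PK" "e \<odot>\<^bsub>?PK\<^esub> k \<notin> ideal_smult r ?PK" using neg unfolding avoids_top_def by blast
  obtain l where l: "l \<in> module_hom A M ?S" "l m = (\<lambda>n. \<one>\<^bsub>K\<^esub>)" by (rule hom_to_node_simple[OF M m])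
  obtain h where h: "h \<in> module_hom A ?PK ?S" "h k = (\<lambda>n. \<one>\<^bsub>K\<^esub>)" by (rule hom_to_node_simple[OF PK k])
  have l_surj: "l ` carrier M = carrier ?S"
  proof (intro equalityI subsetI)
    fix y assume "y \<in> carrier ?S"
    then obtain c where c: "c \<in> carrier K" "y = (\<lambda>n. c)" by (auto simp: node_simple(2))
    have "l (scalar c \<odot>\<^bsub>M\<^esub> m) = y"
      using c hom_smult[OF l(1) scalar_closed[OF c(1)] m(1)] l(2) node_simple(4)[OF scalar_closed[OF c(1)] K.one_closed]
      by (simp add: \<epsilon>_scalar)
    then show "y \<in> l ` carrier M" using m(1) c(1) by (metis M.smult_closed imageI scalar_closed)
  qed (use hom_closed[OF l(1)] in auto)
  have hf: "compose (carrier P1) h f \<in> module_hom A P1 ?S" by (rule hom_comp[OF f(1) h(1) P1])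
  obtain \<psi> where \<psi>: "\<psi> \<in> module_hom A P1 M" "compose (carrier P1) l \<psi> = compose (carrier P1) h f"
    using proj(2) Mcat node_simple(1) l(1) hf l_surj unfolding projective_def by blast
  obtain \<chi> where \<chi>: "\<chi> \<in> module_hom A P0 M" "\<psi> = compose (carrier P1) \<chi> f" using factors[OF \<psi>(1)] by blast
  define z where "z = compose (carrier P0) l \<chi>"
  have z: "z \<in> module_hom A P0 ?S" unfolding z_def by (rule hom_comp[OF \<chi>(1) l(1) P0])
  have kc: "k \<in> a_kernel P0 M g" "k \<in> carrier P0" using k(1) by (auto simp: a_kernel_iff)
  obtain p where p: "p \<in> carrier P1" "k = f p" using kc(1) f(2) by blast
  have "l (\<chi> (f p)) = h (f p)" using fun_cong[OF \<psi>(2), of p] \<chi>(2) p(1) by (simp add: compose_def)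
  then have zk: "z k = (\<lambda>n. \<one>\<^bsub>K\<^esub>)" using p h(2) kc(2) by (simp add: z_def compose_def)
  let ?U = "a_kernel P0 ?S z"
  have U: "submodule ?U A P0" by (rule submodule_kernel[OF P0 S z])
  have "a_kernel P0 M g <+>\<^bsub>P0\<^esub> ?U = carrier P0"
  proof (subst P0.set_add_eq_carrier)
    show "\<forall>q\<in>carrier P0. \<exists>x\<in>a_kernel P0 M g. \<exists>y\<in>?U. q = x \<oplus>\<^bsub>P0\<^esub> y"
    proof
      fix q assume q: "q \<in> carrier P0"
      obtain c where c: "c \<in> carrier K" "z q = (\<lambda>n. c)" using hom_closed[OF z q] by (auto simp: node_simple(2))
      let ?x = "scalar c \<odot>\<^bsub>P0\<^esub> k"
      have sc: "scalar c \<in> carrier A" using c(1) by simp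
      have x: "?x \<in> a_kernel P0 M g" using Ksub kc(1) sc unfolding P0.submodule_iff by blast
      have xc: "?x \<in> carrier P0" using sc kc by simp
      have zx: "z ?x = z q"
        using hom_smult[OF z sc kc(2)] zk node_simple(4)[OF sc K.one_closed] c by (simp add: \<epsilon>_scalar)
      interpret S: left_module A ?S by (rule S)
      have "z (q \<ominus>\<^bsub>P0\<^esub> ?x) = \<zero>\<^bsub>?S\<^esub>"
        using hom_diff[OF P0 S z q xc] zx S.diff_eq_zero_iff[OF hom_closed[OF z q] hom_closed[OF z q]] by simp
      then have "q \<ominus>\<^bsub>P0\<^esub> ?x \<in> ?U" using q xc by (simp add: a_kernel_iff)
      moreover have "q = ?x \<oplus>\<^bsub>P0\<^esub> (q \<ominus>\<^bsub>P0\<^esub> ?x)"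
        using q xc P0.diff_add_cancel[OF q xc] P0.M.a_comm[of ?x "q \<ominus>\<^bsub>P0\<^esub> ?x"] by simp
      ultimately show "\<exists>x\<in>a_kernel P0 M g. \<exists>y\<in>?U. q = x \<oplus>\<^bsub>P0\<^esub> y" using x by blast
    qed
  qed (auto simp: a_kernel_iff)
  then have "?U = carrier P0" using sup0 U unfolding superfluous_def by blast
  then have "z k = \<zero>\<^bsub>?S\<^esub>" using kc(2) by (auto simp: a_kernel_iff)
  then show False using zk node_simple(5) K.one_not_zero by (metis)
qed

text \<open>On \<open>J_in P\<close> the ideal \<open>r\<close> acts as zero and \<open>e\<close> as the identity, so \<open>J_in P\<close> is a direct sum of copies of
  the simple module at the node. If that module is not a quotient of \<open>X\<close>, the intersection
  of \<open>X\<close> and \<open>J_in P\<close> lies in \<open>rX\<close>.\<close>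
lemma superfluous_J_in:
  assumes P: "left_module A P" and X: "submodule X A P" and top: "avoids_top (P\<lparr>carrier := X\<rparr>)"
  shows "superfluous A (P\<lparr>carrier := X\<rparr>) (X \<inter> ideal_smult J_in P)"
proof -
  interpret P: left_module A P by (rule P)
  let ?X = "P\<lparr>carrier := X\<rparr>"
  have Xm: "left_module A ?X" by (rule P.left_module_submodule[OF X])
  interpret X: left_module A ?X by (rule Xm)
  have J: "submodule (ideal_smult J_in P) A P" by (rule ideal_smult_submodule[OF P J_in_ideal])
  show ?thesis unfolding superfluous_def
  proof (intro conjI allI impI)
    show "submodule (X \<inter> ideal_smult J_in P) A ?X"
      using P.submodule_Int[OF X J] by (simp add: P.submodule_of_submodule[OF X])
    fix U assume "submodule U A ?X \<and> (X \<inter> ideal_smult J_in P) <+>\<^bsub>?X\<^esub> U = carrier ?X"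
    then have U: "submodule U A ?X" and sum: "(X \<inter> ideal_smult J_in P) <+>\<^bsub>?X\<^esub> U = carrier ?X" by auto
    have UX: "U \<subseteq> X" and U_add: "\<And>x y. x \<in> U \<Longrightarrow> y \<in> U \<Longrightarrow> x \<oplus>\<^bsub>P\<^esub> y \<in> U"
      and U_smult: "\<And>a x. a \<in> carrier A \<Longrightarrow> x \<in> U \<Longrightarrow> a \<odot>\<^bsub>P\<^esub> x \<in> U"
      using U unfolding X.submodule_iff by auto
    have Xc: "X \<subseteq> carrier P" using X unfolding P.submodule_iff by blast
    have split: "\<exists>y\<in>X \<inter> ideal_smult J_in P. \<exists>u\<in>U. x = y \<oplus>\<^bsub>P\<^esub> u" if "x \<in> X" for x
    proof -
      have "x \<in> (X \<inter> ideal_smult J_in P) <+>\<^bsub>?X\<^esub> U" using that sum by simp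
      then show ?thesis unfolding set_add_iff by simp
    qed
    have rU: "ideal_smult r ?X \<subseteq> U"
    proof (rule ideal_smult_least[OF Xm U])
      fix a x assume a: "a \<in> r" and "x \<in> carrier ?X"
      then obtain y u where yu: "y \<in> X \<inter> ideal_smult J_in P" "u \<in> U" "x = y \<oplus>\<^bsub>P\<^esub> u" using split[of x] by auto
      have uc: "u \<in> carrier P" "y \<in> carrier P" using yu UX Xc by auto
      have "a \<odot>\<^bsub>P\<^esub> x = a \<odot>\<^bsub>P\<^esub> u"
        using yu uc J_in_multiples(2)[OF P _ a, of y] rA[OF a] by (simp add: P.smult_r_distr)
      then show "a \<odot>\<^bsub>?X\<^esub> x \<in> U" using U_smult[OF rA[OF a] yu(2)] by simp
    qed
    have "x \<in> U" if x: "x \<in> X" for x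
    proof -
      obtain y u where yu: "y \<in> X \<inter> ideal_smult J_in P" "u \<in> U" "x = y \<oplus>\<^bsub>P\<^esub> u" using split[OF x] by blast
      have "e \<odot>\<^bsub>?X\<^esub> y \<in> ideal_smult r ?X" using top yu(1) by (simp add: avoids_top_def)
      then have "y \<in> U" using rU J_in_multiples(1)[OF P, of y] yu(1) by auto
      then show ?thesis using U_add yu by simp
    qed
    then show "U = carrier ?X" using UX by auto
  qed
qed

text \<open>A homomorphism \<open>M \<rightarrow> N/(J_in N)\<close> lifts to \<open>P0 \<rightarrow> N\<close>, which maps the kernel of \<open>P0 \<rightarrow> M\<close> into the semisimple
  module \<open>J_in N\<close>. That restriction is zero, because the simple module at the node is not a quotient
  of the kernel.\<close>
lemma lifts_J_in:
  fixes M N P0 :: "('a, 'k) fmod"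
  assumes proj: "projective A P0" and M: "left_module A M" and N: "N \<in> mod_cat A"
    and g: "g \<in> module_hom A P0 M" "g ` carrier P0 = carrier M"
    and top: "avoids_top (P0\<lparr>carrier := a_kernel P0 M g\<rparr>)"
  shows "jin.lifts M N"
  unfolding jin.lifts_def
proof
  fix \<psi> assume \<psi>: "\<psi> \<in> module_hom A M (jin.reduce N)"
  have Nm: "left_module A N" and P0: "left_module A P0" using N proj by (auto simp: mod_cat_def projective_def)
  interpret P0: left_module A P0 by (rule P0)
  interpret N: left_module A N by (rule Nm)
  note r' = jin.reduce_facts[OF Nm]
  let ?PK = "P0\<lparr>carrier := a_kernel P0 M g\<rparr>"
  let ?\<rho> = "jin.reduce_map N"
  have redN: "jin.reduce N \<in> mod_cat A" using N r'(1,10) by (simp add: mod_cat_def)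
  have surj: "restrict ?\<rho> (carrier N) ` carrier N = carrier (jin.reduce N)" by (auto simp: r'(2))
  obtain t where t: "t \<in> module_hom A P0 N"
    "compose (carrier P0) (restrict ?\<rho> (carrier N)) t = compose (carrier P0) \<psi> g"
    using proj N redN r'(3) surj hom_comp[OF g(1) \<psi> P0] unfolding projective_def by blast
  have t_eq: "?\<rho> (t x) = \<psi> (g x)" if "x \<in> carrier P0" for x
    using fun_cong[OF t(2), of x] that hom_closed[OF t(1)] by (simp add: compose_def)
  have K: "submodule (a_kernel P0 M g) A P0" by (rule submodule_kernel[OF P0 M g(1)])
  have PK: "left_module A ?PK" by (rule P0.left_module_submodule[OF K])
  have tK: "t k \<in> ideal_smult J_in N" if k: "k \<in> a_kernel P0 M g" for k
  proof -
    have kc: "k \<in> carrier P0" "g k = \<zero>\<^bsub>M\<^esub>" using k by (auto simp: a_kernel_iff)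
    have "?\<rho> (t k) = \<zero>\<^bsub>jin.reduce N\<^esub>" using t_eq[OF kc(1)] kc(2) hom_zero[OF M r'(1) \<psi>] by simp
    then show ?thesis using r'(7)[OF hom_closed[OF t(1) kc(1)]] by simp
  qed
  have t_rad: "t y = \<zero>\<^bsub>N\<^esub>" if "y \<in> ideal_smult r ?PK" for y
  proof -
    have "ideal_smult r ?PK \<subseteq> {y \<in> carrier ?PK. t y \<in> {\<zero>\<^bsub>N\<^esub>}}"
    proof (rule ideal_smult_least[OF PK])
      have "restrict t (a_kernel P0 M g) \<in> module_hom A ?PK N"
        using hom_closed[OF t(1)] hom_add[OF t(1)] hom_smult[OF t(1)]
          module_homI[where h = t and M = ?PK and N = N and A = A] PK by (auto simp: a_kernel_iff)
      from hom_vimage_submodule[OF PK Nm this N.submodule_zero]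
      show "submodule {y \<in> carrier ?PK. t y \<in> {\<zero>\<^bsub>N\<^esub>}} A ?PK" by (simp cong: conj_cong)
      fix a k assume a: "a \<in> r" and k: "k \<in> carrier ?PK"
      have kc: "k \<in> a_kernel P0 M g" "k \<in> carrier P0" using k by (auto simp: a_kernel_iff)
      have "a \<odot>\<^bsub>P0\<^esub> k \<in> a_kernel P0 M g" using K kc rA[OF a] unfolding P0.submodule_iff by blast
      then show "a \<odot>\<^bsub>?PK\<^esub> k \<in> {y \<in> carrier ?PK. t y \<in> {\<zero>\<^bsub>N\<^esub>}}"
        using hom_smult[OF t(1) rA[OF a] kc(2)] J_in_multiples(2)[OF Nm tK[OF kc(1)] a] by simp
    qed
    then show ?thesis using that by blast
  qed
  have "t k = \<zero>\<^bsub>N\<^esub>" if k: "k \<in> a_kernel P0 M g" for k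
  proof -
    have kc: "k \<in> carrier P0" using k by (auto simp: a_kernel_iff)
    have "t (e \<odot>\<^bsub>P0\<^esub> k) = \<zero>\<^bsub>N\<^esub>" using t_rad top k by (simp add: avoids_top_def)
    then show ?thesis using hom_smult[OF t(1) e_in kc] J_in_multiples(1)[OF Nm tK[OF k]] by simp
  qed
  then obtain t' where t': "t' \<in> module_hom A M N" "\<And>x. x \<in> carrier P0 \<Longrightarrow> t' (g x) = t x"
    using hom_factors_through_cokernel[OF P0 M Nm g t(1)] by blast
  have "\<forall>x\<in>carrier M. ?\<rho> (t' x) = \<psi> x"
  proof
    fix x assume "x \<in> carrier M"
    then obtain p where "p \<in> carrier P0" "x = g p" using g(2) by blast
    then show "?\<rho> (t' x) = \<psi> x" using t'(2) t_eq by simp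
  qed
  then show "\<exists>\<theta>\<in>module_hom A M N. \<forall>x\<in>carrier M. ?\<rho> (\<theta> x) = \<psi> x" using t'(1) by blast
qed

lemma avoids_top_projective_cover:
  assumes P: "left_module A P" and M: "left_module A M" and g: "g \<in> module_hom A P M" "g ` carrier P = carrier M"
    and sup: "superfluous A P (a_kernel P M g)" and top: "avoids_top M"
  shows "avoids_top P"
proof -
  interpret P: left_module A P by (rule P)
  interpret M: left_module A M by (rule M)
  let ?R = "ideal_smult r P"
  have R: "submodule ?R A P" by (rule ideal_smult_submodule[OF P r])
  have Rc: "\<And>y. y \<in> ?R \<Longrightarrow> y \<in> carrier P" and Rs: "\<And>a y. a \<in> carrier A \<Longrightarrow> y \<in> ?R \<Longrightarrow> a \<odot>\<^bsub>P\<^esub> y \<in> ?R"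
    and Ra: "\<And>y z. y \<in> ?R \<Longrightarrow> z \<in> ?R \<Longrightarrow> y \<oplus>\<^bsub>P\<^esub> z \<in> ?R" and R0: "\<zero>\<^bsub>P\<^esub> \<in> ?R"
    using R unfolding P.submodule_iff by blast+
  have eey: "e \<odot>\<^bsub>P\<^esub> (e \<odot>\<^bsub>P\<^esub> y) = e \<odot>\<^bsub>P\<^esub> y" if "y \<in> carrier P" for y
    using e_in ee that by (metis P.smult_assoc1)
  let ?U = "{y \<in> carrier P. e \<odot>\<^bsub>P\<^esub> y \<in> ?R}"
  have U: "submodule ?U A P" unfolding P.submodule_iff
  proof (intro conjI ballI)
    fix a y assume a: "a \<in> carrier A" and y: "y \<in> ?U"
    let ?c = "scalar (\<epsilon> a)"
    have c: "?c \<in> carrier A" using a by (simp add: \<epsilon>_closed)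
    have yc: "y \<in> carrier P" "e \<odot>\<^bsub>P\<^esub> y \<in> ?R" using y by auto
    have "(e \<otimes>\<^bsub>A\<^esub> a \<ominus>\<^bsub>A\<^esub> ?c \<otimes>\<^bsub>A\<^esub> e) \<odot>\<^bsub>P\<^esub> y \<oplus>\<^bsub>P\<^esub> ?c \<odot>\<^bsub>P\<^esub> (e \<odot>\<^bsub>P\<^esub> y) \<in> ?R"
      using Ra[OF ideal_smult.smult[OF e_left[OF a] yc(1)] Rs[OF c yc(2)]] .
    moreover have "(e \<otimes>\<^bsub>A\<^esub> a \<ominus>\<^bsub>A\<^esub> ?c \<otimes>\<^bsub>A\<^esub> e) \<odot>\<^bsub>P\<^esub> y \<oplus>\<^bsub>P\<^esub> ?c \<odot>\<^bsub>P\<^esub> (e \<odot>\<^bsub>P\<^esub> y) = e \<odot>\<^bsub>P\<^esub> (a \<odot>\<^bsub>P\<^esub> y)"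
      using a c yc(1) e_in by (simp add: P.smult_l_diff P.smult_assoc1 P.diff_add_cancel)
    ultimately show "a \<odot>\<^bsub>P\<^esub> y \<in> ?U" using a yc(1) by simp
  qed (use e_in R0 Ra in \<open>auto simp: P.smult_r_distr\<close>)
  have "a_kernel P M g <+>\<^bsub>P\<^esub> ?U = carrier P"
  proof (subst P.set_add_eq_carrier)
    show "\<forall>p\<in>carrier P. \<exists>x\<in>a_kernel P M g. \<exists>y\<in>?U. p = x \<oplus>\<^bsub>P\<^esub> y"
    proof
      fix p assume p: "p \<in> carrier P"
      have ep: "e \<odot>\<^bsub>P\<^esub> p \<in> carrier P" using p e_in by simp
      have "e \<odot>\<^bsub>M\<^esub> g p \<in> ideal_smult r M" using top hom_closed[OF g(1) p] by (simp add: avoids_top_def)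
      then obtain z where z: "z \<in> ?R" "g z = e \<odot>\<^bsub>M\<^esub> g p" using hom_ideal_smult_surj[OF g(1) P r g(2)] by blast
      have zc: "z \<in> carrier P" using Rc z(1) .
      let ?k = "e \<odot>\<^bsub>P\<^esub> p \<ominus>\<^bsub>P\<^esub> z"
      have kc: "?k \<in> carrier P" using ep zc by simp
      have k: "?k \<in> a_kernel P M g"
        using kc hom_diff[OF P M g(1) ep zc] hom_smult[OF g(1) e_in p] z(2)
          M.diff_eq_zero_iff[of "e \<odot>\<^bsub>M\<^esub> g p" "e \<odot>\<^bsub>M\<^esub> g p"] hom_closed[OF g(1) p] e_in by (simp add: a_kernel_iff)
      have "e \<odot>\<^bsub>P\<^esub> (p \<ominus>\<^bsub>P\<^esub> ?k) = e \<odot>\<^bsub>P\<^esub> z"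
      proof -
        have "e \<odot>\<^bsub>P\<^esub> (p \<ominus>\<^bsub>P\<^esub> ?k) = e \<odot>\<^bsub>P\<^esub> p \<ominus>\<^bsub>P\<^esub> (e \<odot>\<^bsub>P\<^esub> p \<ominus>\<^bsub>P\<^esub> e \<odot>\<^bsub>P\<^esub> z)"
          using p ep zc e_in by (simp add: P.smult_r_diff eey)
        moreover have "x \<ominus>\<^bsub>P\<^esub> (x \<ominus>\<^bsub>P\<^esub> y) = y" if "x \<in> carrier P" "y \<in> carrier P" for x y
          using that P.add_diff_cancel[of y "x \<ominus>\<^bsub>P\<^esub> y"] P.diff_add_cancel[of x y] P.M.a_comm[of y "x \<ominus>\<^bsub>P\<^esub> y"] by simp
        ultimately show ?thesis using p zc e_in by simp
      qed
      then have "p \<ominus>\<^bsub>P\<^esub> ?k \<in> ?U" using Rs[OF e_in z(1)] p kc by simp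
      moreover have "p = ?k \<oplus>\<^bsub>P\<^esub> (p \<ominus>\<^bsub>P\<^esub> ?k)"
        using p kc P.diff_add_cancel[OF p kc] P.M.a_comm[of ?k "p \<ominus>\<^bsub>P\<^esub> ?k"] by simp
      ultimately show "\<exists>x\<in>a_kernel P M g. \<exists>y\<in>?U. p = x \<oplus>\<^bsub>P\<^esub> y" using k by blast
    qed
  qed (auto simp: a_kernel_iff)
  then have "?U = carrier P" using sup U unfolding superfluous_def by blast
  then show ?thesis by (auto simp: avoids_top_def)
qed

lemma lifts_J_out:
  assumes M: "left_module A M" and N: "left_module A N" and top: "avoids_top N"
  shows "jout.lifts M N"
  unfolding jout.lifts_def
proof
  interpret N: left_module A N by (rule N)
  let ?\<rho> = "jout.reduce_map N"
  fix \<psi> assume \<psi>: "\<psi> \<in> module_hom A M (jout.reduce N)"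
  note r' = jout.reduce_facts[OF N]
  have "inj_on (restrict ?\<rho> (carrier N)) (carrier N)"
    using r'(8) J_out_multiples[OF N top] N.diff_eq_zero_iff by (auto simp: inj_on_def)
  then have bij: "bij_betw (restrict ?\<rho> (carrier N)) (carrier N) (carrier (jout.reduce N))"
    by (auto simp: bij_betw_def r'(2))
  define i where "i = restrict (inv_into (carrier N) (restrict ?\<rho> (carrier N))) (carrier (jout.reduce N))"
  have i: "i \<in> module_hom A (jout.reduce N) N" unfolding i_def by (rule bij_hom_inv[OF N r'(1) r'(3) bij])
  have i_inv: "?\<rho> (i y) = y" if y: "y \<in> carrier (jout.reduce N)" for y
  proof -
    have "restrict ?\<rho> (carrier N) (i y) = y" using bij_betw_inv_into_right[OF bij y] y by (simp only: i_def restrict_apply')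
    then show ?thesis using hom_closed[OF i y] by (simp only: restrict_apply')
  qed
  have "\<forall>x\<in>carrier M. ?\<rho> (compose (carrier M) i \<psi> x) = \<psi> x"
    using i_inv hom_closed[OF \<psi>] by (simp add: compose_def)
  then show "\<exists>\<theta>\<in>module_hom A M N. \<forall>x\<in>carrier M. ?\<rho> (\<theta> x) = \<psi> x"
    by (rule bexI[OF _ hom_comp[OF \<psi> i M]])
qed

text \<open>The tau-rigid modules without the simple module at the node in the top embed, up to
  isomorphism, into those over \<open>A/J_out\<close>, and the other ones into those over \<open>A/J_in\<close>.\<close>
theorem not_minimal_tau_tilting_infinite:
  assumes \<iota>: "inj_on (\<iota> :: 'a \<Rightarrow> nat \<Rightarrow> 'k) (carrier A)" and in0: "J_in \<noteq> {\<zero>\<^bsub>A\<^esub>}" and out0: "J_out \<noteq> {\<zero>\<^bsub>A\<^esub>}"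
  shows "\<not> minimal_tau_tilting_infinite K A"
proof
  assume min: "minimal_tau_tilting_infinite K A"
  then have fin_in: "tau_tilting_finite K (A /\<^sub>m J_in)" and fin_out: "tau_tilting_finite K (A /\<^sub>m J_out)"
    using in0 out0 J_in_ideal J_out_ideal by (auto simp: minimal_tau_tilting_infinite_def)
  let ?T = "{M :: ('a, 'k) fmod. indecomposable A M \<and> tau_rigid K A M}"
  let ?out = "{M \<in> ?T. avoids_top M}" and ?in = "{M \<in> ?T. \<not> avoids_top M}"
  have T_cat: "M \<in> mod_cat A" "left_module A M" if "M \<in> ?T" for M using that by (auto simp: tau_rigid_def mod_cat_def)
  have "finite ((\<lambda>M. iso_rel A `` {M}) ` ?out)"
  proof (rule jout.finitely_many_classes[OF J_out_square fin_out])
    fix M assume M: "M \<in> ?out"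
    then have MT: "M \<in> ?T" and top: "avoids_top M" by auto
    then have "tau_rigid K A M" by simp
    then obtain P1 P0 f g where pres: "minimal_projective_presentation A P1 P0 M f g"
      and fac: "\<And>\<psi>. \<psi> \<in> module_hom A P1 M \<Longrightarrow> \<exists>\<chi>\<in>module_hom A P0 M. \<psi> = compose (carrier P1) \<chi> f"
      by (rule tau_rigid_factors[OF k_algebra_axioms \<iota>]) blast
    have proj: "projective A P0" and g: "g \<in> module_hom A P0 M" "g ` carrier P0 = carrier M"
      and sup0: "superfluous A P0 (a_kernel P0 M g)"
      using pres by (auto simp: minimal_projective_presentation_def projective_cover_def)
    have P0: "left_module A P0" using proj by (auto simp: projective_def mod_cat_def)
    interpret P0: left_module A P0 by (rule P0)
    have "ideal_smult J_out P0 = {\<zero>\<^bsub>P0\<^esub>}"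
      by (rule J_out_multiples[OF P0 avoids_top_projective_cover[OF P0 T_cat(2)[OF MT] g sup0 top]])
    moreover have Ksub: "submodule (a_kernel P0 M g) A P0" by (rule submodule_kernel[OF P0 T_cat(2)[OF MT] g(1)])
    ultimately have int: "a_kernel P0 M g \<inter> ideal_smult J_out P0 = {\<zero>\<^bsub>P0\<^esub>}" unfolding P0.submodule_iff by auto
    interpret PK: left_module A "P0\<lparr>carrier := a_kernel P0 M g\<rparr>" by (rule P0.left_module_submodule[OF Ksub])
    have "superfluous A (P0\<lparr>carrier := a_kernel P0 M g\<rparr>) (a_kernel P0 M g \<inter> ideal_smult J_out P0)"
      unfolding int superfluous_def
    proof (intro conjI allI impI)
      show "submodule {\<zero>\<^bsub>P0\<^esub>} A (P0\<lparr>carrier := a_kernel P0 M g\<rparr>)" using PK.submodule_zero by simp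
      fix U assume U: "submodule U A (P0\<lparr>carrier := a_kernel P0 M g\<rparr>) \<and>
        {\<zero>\<^bsub>P0\<^esub>} <+>\<^bsub>P0\<lparr>carrier := a_kernel P0 M g\<rparr>\<^esub> U = carrier (P0\<lparr>carrier := a_kernel P0 M g\<rparr>)"
      then have "U \<subseteq> carrier P0" unfolding PK.submodule_iff by (auto simp: a_kernel_iff)
      then have "{\<zero>\<^bsub>P0\<^esub>} <+>\<^bsub>P0\<lparr>carrier := a_kernel P0 M g\<rparr>\<^esub> U = U"
        unfolding set_eq_iff set_add_iff by (auto simp: subset_iff)
      then show "U = carrier (P0\<lparr>carrier := a_kernel P0 M g\<rparr>)" using U by simp
    qed
    then have "tau_rigid K (A /\<^sub>m J_out) (jout.reduction M)"
      by (rule jout.tau_rigid_reduction[OF \<iota> T_cat(1)[OF MT] pres _ fac])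
    then show "M \<in> mod_cat A \<and> indecomposable A M \<and> tau_rigid K (A /\<^sub>m J_out) (jout.reduction M)"
      using T_cat(1)[OF MT] M by simp
  next
    fix M N assume "M \<in> ?out" "N \<in> ?out"
    then show "jout.lifts M N" using lifts_J_out[OF T_cat(2) T_cat(2)] by blast
  qed
  moreover have "finite ((\<lambda>M. iso_rel A `` {M}) ` ?in)"
  proof (rule jin.finitely_many_classes[OF J_in_square fin_in])
    have data: "tau_rigid K (A /\<^sub>m J_in) (jin.reduction M) \<and> (\<forall>N\<in>(mod_cat A :: ('a, 'k) fmod set). jin.lifts M N)"
      if M: "M \<in> ?in" for M
    proof -
      have MT: "M \<in> ?T" and top: "\<not> avoids_top M" using M by auto
      from MT have "tau_rigid K A M" by simp
      then obtain P1 P0 f g where pres: "minimal_projective_presentation A P1 P0 M f g"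
        and fac: "\<And>\<psi>. \<psi> \<in> module_hom A P1 M \<Longrightarrow> \<exists>\<chi>\<in>module_hom A P0 M. \<psi> = compose (carrier P1) \<chi> f"
        by (rule tau_rigid_factors[OF k_algebra_axioms \<iota>]) blast
      have proj: "projective A P0" and g: "g \<in> module_hom A P0 M" "g ` carrier P0 = carrier M"
        using pres by (auto simp: minimal_projective_presentation_def projective_cover_def)
      have P0: "left_module A P0" using proj by (auto simp: projective_def mod_cat_def)
      have topK: "avoids_top (P0\<lparr>carrier := a_kernel P0 M g\<rparr>)"
        using top_avoidance_dichotomy[OF T_cat(1)[OF MT] pres fac] top by blast
      have "superfluous A (P0\<lparr>carrier := a_kernel P0 M g\<rparr>) (a_kernel P0 M g \<inter> ideal_smult J_in P0)"
        by (rule superfluous_J_in[OF P0 submodule_kernel[OF P0 T_cat(2)[OF MT] g(1)] topK])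
      then have "tau_rigid K (A /\<^sub>m J_in) (jin.reduction M)"
        by (rule jin.tau_rigid_reduction[OF \<iota> T_cat(1)[OF MT] pres _ fac])
      moreover have "jin.lifts M N" if "N \<in> mod_cat A" for N :: "('a, 'k) fmod"
        by (rule lifts_J_in[OF proj T_cat(2)[OF MT] that g topK])
      ultimately show ?thesis by blast
    qed
    fix M assume M: "M \<in> ?in"
    show "M \<in> mod_cat A \<and> indecomposable A M \<and> tau_rigid K (A /\<^sub>m J_in) (jin.reduction M)"
      using data[OF M] T_cat(1)[of M] M by simp
    fix N assume N: "N \<in> ?in"
    show "jin.lifts M N" using data[OF M] T_cat(1)[of N] N by blast
  qed
  ultimately have "finite ((\<lambda>M. iso_rel A `` {M}) ` (?out \<union> ?in))" unfolding image_Un by (rule finite_UnI)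
  moreover have "?T // iso_rel A = (\<lambda>M. iso_rel A `` {M}) ` (?out \<union> ?in)" unfolding quotient_def by blast
  ultimately have "tau_tilting_finite K A" unfolding tau_tilting_finite_def by simp
  then show False using min by (simp add: minimal_tau_tilting_infinite_def)
qed

end

section \<open>Path algebras\<close>

lemma (in abelian_monoid) finsum_triangle:
  fixes f :: "nat \<Rightarrow> nat \<Rightarrow> 'a" and n :: nat
  assumes "\<And>i j. j \<le> i \<Longrightarrow> i \<le> n \<Longrightarrow> f i j \<in> carrier G"
  shows "finsum G (\<lambda>i. finsum G (f i) {..i}) {..n} = finsum G (\<lambda>j. finsum G (\<lambda>k. f (j + k) j) {..n - j}) {..n}"
  using assms
proof (induction n)
  case 0
  then show ?case by simp
next
  case (Suc n)
  have c: "\<And>j. j \<le> n \<Longrightarrow> finsum G (\<lambda>k. f (j + k) j) {..n - j} \<in> carrier G"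
    using Suc.prems by (intro finsum_closed) auto
  have "finsum G (\<lambda>k. f (j + k) j) {..Suc n - j} = f (Suc n) j \<oplus> finsum G (\<lambda>k. f (j + k) j) {..n - j}" if "j \<le> n" for j
    using that Suc.prems by (simp add: Suc_diff_le finsum_Suc Pi_def)
  then have "finsum G (\<lambda>j. finsum G (\<lambda>k. f (j + k) j) {..Suc n - j}) {..n}
      = finsum G (\<lambda>j. f (Suc n) j \<oplus> finsum G (\<lambda>k. f (j + k) j) {..n - j}) {..n}"
    using Suc.prems c by (intro finsum_cong') auto
  also have "\<dots> = finsum G (f (Suc n)) {..n} \<oplus> finsum G (\<lambda>j. finsum G (\<lambda>k. f (j + k) j) {..n - j}) {..n}"
    using Suc.prems c by (intro finsum_addf) auto
  also have "finsum G (\<lambda>j. finsum G (\<lambda>k. f (j + k) j) {..n - j}) {..n} = finsum G (\<lambda>i. finsum G (f i) {..i}) {..n}"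
    using Suc by simp
  finally have 1: "finsum G (\<lambda>j. finsum G (\<lambda>k. f (j + k) j) {..Suc n - j}) {..n}
      = finsum G (f (Suc n)) {..n} \<oplus> finsum G (\<lambda>i. finsum G (f i) {..i}) {..n}" .
  have c2: "\<And>j. j \<le> Suc n \<Longrightarrow> finsum G (\<lambda>k. f (j + k) j) {..Suc n - j} \<in> carrier G"
    using Suc.prems by (intro finsum_closed) auto
  have c3: "\<And>i. i \<le> Suc n \<Longrightarrow> finsum G (f i) {..i} \<in> carrier G" using Suc.prems by (intro finsum_closed) auto
  have "finsum G (\<lambda>j. finsum G (\<lambda>k. f (j + k) j) {..Suc n - j}) {..Suc n}
      = f (Suc n) (Suc n) \<oplus> (finsum G (f (Suc n)) {..n} \<oplus> finsum G (\<lambda>i. finsum G (f i) {..i}) {..n})"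
    using c2 Suc.prems by (simp add: finsum_Suc Pi_def 1)
  also have "\<dots> = (f (Suc n) (Suc n) \<oplus> finsum G (f (Suc n)) {..n}) \<oplus> finsum G (\<lambda>i. finsum G (f i) {..i}) {..n}"
    using Suc.prems c3 by (intro a_assoc[symmetric] finsum_closed) auto
  also have "\<dots> = finsum G (\<lambda>i. finsum G (f i) {..i}) {..Suc n}"
    using c3 Suc.prems by (simp add: finsum_Suc Pi_def)
  finally show ?case by simp
qed

text \<open>A field and a finite quiver. A finite quiver may have oriented cycles, so that the path algebra may be
  infinite-dimensional.\<close>
locale path_algebra_data =
  fixes K :: "('k, 'c) ring_scheme" and Q :: "('v, 'e) pre_digraph"
  assumes field: "field K" and fin_digraph: "fin_digraph Q"
begin

sublocale K: field K by (rule field)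
sublocale Q: fin_digraph Q by (rule fin_digraph)

abbreviation "PA \<equiv> path_algebra K Q"
abbreviation "paths \<equiv> quiver_paths Q"
abbreviation endpt :: "'v \<Rightarrow> 'e list \<Rightarrow> 'v" where "endpt u p \<equiv> Q.awlast u p"

lemma endpt_simps [simp]: "endpt (endpt u p) q = endpt u (p @ q)"
  by (simp add: Q.awlast_append)

lemma paths_iff: "(u, p) \<in> paths \<longleftrightarrow> Q.awalk u p (endpt u p)"
  by (auto simp: quiver_paths_def)

lemma paths_append: "(u, p @ q) \<in> paths \<longleftrightarrow> (u, p) \<in> paths \<and> (endpt u p, q) \<in> paths"
  by (simp add: paths_iff)

lemma paths_Nil: "(u, []) \<in> paths \<longleftrightarrow> u \<in> verts Q"
  by (simp add: paths_iff Q.awalk_Nil_iff)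

lemma paths_Cons: "(u, a # p) \<in> paths \<longleftrightarrow> a \<in> arcs Q \<and> u = tail Q a \<and> (head Q a, p) \<in> paths"
  by (auto simp: quiver_paths_def Q.awalk_Cons_iff)

lemma endpt_in_verts: "(u, p) \<in> paths \<Longrightarrow> endpt u p \<in> verts Q"
  unfolding paths_iff by (rule Q.awalk_last_in_verts)

lemma start_in_verts: "(u, p) \<in> paths \<Longrightarrow> u \<in> verts Q"
  unfolding paths_iff by (rule Q.awalk_hd_in_verts)

lemma mult_eq: "(f \<otimes>\<^bsub>PA\<^esub> g) (u, p) =
    finsum K (\<lambda>i. f (endpt u (take i p), drop i p) \<otimes>\<^bsub>K\<^esub> g (u, take i p)) {..length p}"
  by (simp add: path_algebra_def)

lemma PA_simps:
  "\<one>\<^bsub>PA\<^esub> = (\<lambda>(u, p). if u \<in> verts Q \<and> p = [] then \<one>\<^bsub>K\<^esub> else \<zero>\<^bsub>K\<^esub>)"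
  "\<zero>\<^bsub>PA\<^esub> = (\<lambda>_. \<zero>\<^bsub>K\<^esub>)"
  "f \<oplus>\<^bsub>PA\<^esub> g = (\<lambda>p. f p \<oplus>\<^bsub>K\<^esub> g p)"
  "c \<odot>\<^bsub>PA\<^esub> f = (\<lambda>p. c \<otimes>\<^bsub>K\<^esub> f p)"
  by (simp_all add: path_algebra_def)

lemma PA_carrier: "f \<in> carrier PA \<longleftrightarrow>
    (\<forall>p. f p \<in> carrier K) \<and> finite {p. f p \<noteq> \<zero>\<^bsub>K\<^esub>} \<and> (\<forall>p. p \<notin> paths \<longrightarrow> f p = \<zero>\<^bsub>K\<^esub>)"
  by (auto simp: path_algebra_def)

lemma PA_closed: "f \<in> carrier PA \<Longrightarrow> f p \<in> carrier K"
  and PA_zero: "f \<in> carrier PA \<Longrightarrow> p \<notin> paths \<Longrightarrow> f p = \<zero>\<^bsub>K\<^esub>"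
  and PA_finite: "f \<in> carrier PA \<Longrightarrow> finite {p. f p \<noteq> \<zero>\<^bsub>K\<^esub>}"
  unfolding PA_carrier by blast+

lemma mult_closed:
  assumes f: "f \<in> carrier PA" and g: "g \<in> carrier PA" shows "f \<otimes>\<^bsub>PA\<^esub> g \<in> carrier PA"
proof -
  have cl: "(f \<otimes>\<^bsub>PA\<^esub> g) q \<in> carrier K" for q
    by (cases q) (simp add: mult_eq Pi_def PA_closed[OF f] PA_closed[OF g])
  have ne: "\<exists>i\<le>length p. f (endpt u (take i p), drop i p) \<noteq> \<zero>\<^bsub>K\<^esub> \<and> g (u, take i p) \<noteq> \<zero>\<^bsub>K\<^esub>"
    if "(f \<otimes>\<^bsub>PA\<^esub> g) (u, p) \<noteq> \<zero>\<^bsub>K\<^esub>" for u p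
  proof (rule ccontr)
    assume "\<not> ?thesis"
    then have "f (endpt u (take i p), drop i p) \<otimes>\<^bsub>K\<^esub> g (u, take i p) = \<zero>\<^bsub>K\<^esub>" if "i \<le> length p" for i
      using that PA_closed[OF f] PA_closed[OF g] by (metis K.l_null K.r_null)
    then have "(f \<otimes>\<^bsub>PA\<^esub> g) (u, p) = finsum K (\<lambda>i. \<zero>\<^bsub>K\<^esub>) {..length p}"
      unfolding mult_eq by (intro K.finsum_cong') auto
    then show False using that by simp
  qed
  let ?S = "{p. f p \<noteq> \<zero>\<^bsub>K\<^esub>} \<times> {p. g p \<noteq> \<zero>\<^bsub>K\<^esub>}"
  have "{q. (f \<otimes>\<^bsub>PA\<^esub> g) q \<noteq> \<zero>\<^bsub>K\<^esub>} \<subseteq> (\<lambda>((w, p1), (u, p2)). (u, p2 @ p1)) ` ?S"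
  proof
    fix q assume "q \<in> {q. (f \<otimes>\<^bsub>PA\<^esub> g) q \<noteq> \<zero>\<^bsub>K\<^esub>}"
    then obtain u p where q: "q = (u, p)" "(f \<otimes>\<^bsub>PA\<^esub> g) (u, p) \<noteq> \<zero>\<^bsub>K\<^esub>" by (cases q) auto
    from ne[OF q(2)] obtain i where "f (endpt u (take i p), drop i p) \<noteq> \<zero>\<^bsub>K\<^esub>" "g (u, take i p) \<noteq> \<zero>\<^bsub>K\<^esub>" by blast
    then show "q \<in> (\<lambda>((w, p1), (u, p2)). (u, p2 @ p1)) ` ?S"
      unfolding q(1) by (intro image_eqI[of _ _ "((endpt u (take i p), drop i p), (u, take i p))"]) auto
  qed
  moreover have "finite ?S" by (intro finite_cartesian_product PA_finite f g)
  ultimately have "finite {q. (f \<otimes>\<^bsub>PA\<^esub> g) q \<noteq> \<zero>\<^bsub>K\<^esub>}" by (meson finite_imageI finite_subset)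
  moreover have "(f \<otimes>\<^bsub>PA\<^esub> g) q = \<zero>\<^bsub>K\<^esub>" if "q \<notin> paths" for q
  proof (rule ccontr)
    assume "(f \<otimes>\<^bsub>PA\<^esub> g) q \<noteq> \<zero>\<^bsub>K\<^esub>"
    moreover obtain u p where q: "q = (u, p)" by (cases q)
    ultimately obtain i where "f (endpt u (take i p), drop i p) \<noteq> \<zero>\<^bsub>K\<^esub>" "g (u, take i p) \<noteq> \<zero>\<^bsub>K\<^esub>" using ne by blast
    then have "(endpt u (take i p), drop i p) \<in> paths" "(u, take i p) \<in> paths" using PA_zero[OF f] PA_zero[OF g] by blast+
    then have "(u, take i p @ drop i p) \<in> paths" unfolding paths_append by blast
    then show False using that q by simp
  qed
  ultimately show ?thesis using cl by (simp add: PA_carrier)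
qed

lemma left_module_PA: "left_module K PA"
proof (rule left_moduleI)
  show "abelian_group PA"
  proof (rule abelian_groupI)
    fix f g assume fg: "f \<in> carrier PA" "g \<in> carrier PA"
    have "{p. f p \<oplus>\<^bsub>K\<^esub> g p \<noteq> \<zero>\<^bsub>K\<^esub>} \<subseteq> {p. f p \<noteq> \<zero>\<^bsub>K\<^esub>} \<union> {p. g p \<noteq> \<zero>\<^bsub>K\<^esub>}" by auto
    then have "finite {p. f p \<oplus>\<^bsub>K\<^esub> g p \<noteq> \<zero>\<^bsub>K\<^esub>}"
      by (rule finite_subset) (intro finite_UnI PA_finite fg)
    then show "f \<oplus>\<^bsub>PA\<^esub> g \<in> carrier PA" using fg by (simp add: PA_carrier PA_simps)
    show "f \<oplus>\<^bsub>PA\<^esub> g = g \<oplus>\<^bsub>PA\<^esub> f" using fg by (simp add: PA_simps PA_closed K.a_comm)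
  next
    fix f assume f: "f \<in> carrier PA"
    have "{p. \<ominus>\<^bsub>K\<^esub> f p \<noteq> \<zero>\<^bsub>K\<^esub>} \<subseteq> {p. f p \<noteq> \<zero>\<^bsub>K\<^esub>}" by auto
    then have "finite {p. \<ominus>\<^bsub>K\<^esub> f p \<noteq> \<zero>\<^bsub>K\<^esub>}" by (rule finite_subset) (rule PA_finite[OF f])
    then have "(\<lambda>p. \<ominus>\<^bsub>K\<^esub> f p) \<in> carrier PA" using f by (simp add: PA_carrier)
    then show "\<exists>g\<in>carrier PA. g \<oplus>\<^bsub>PA\<^esub> f = \<zero>\<^bsub>PA\<^esub>"
      by (rule bexI[rotated]) (simp add: PA_simps PA_closed[OF f] K.l_neg)
  qed (auto simp: PA_simps PA_carrier K.a_assoc)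
next
  fix c f assume c: "c \<in> carrier K" and f: "f \<in> carrier PA"
  have "{p. c \<otimes>\<^bsub>K\<^esub> f p \<noteq> \<zero>\<^bsub>K\<^esub>} \<subseteq> {p. f p \<noteq> \<zero>\<^bsub>K\<^esub>}" using c by auto
  then have "finite {p. c \<otimes>\<^bsub>K\<^esub> f p \<noteq> \<zero>\<^bsub>K\<^esub>}" by (rule finite_subset) (rule PA_finite[OF f])
  then show "c \<odot>\<^bsub>PA\<^esub> f \<in> carrier PA" using c f by (simp add: PA_carrier PA_simps)
qed (auto simp: PA_simps PA_closed K.l_distr K.r_distr K.m_assoc K.ring_axioms)

lemma mult_assoc:
  assumes f: "f \<in> carrier PA" and g: "g \<in> carrier PA" and h: "h \<in> carrier PA"
  shows "f \<otimes>\<^bsub>PA\<^esub> g \<otimes>\<^bsub>PA\<^esub> h = f \<otimes>\<^bsub>PA\<^esub> (g \<otimes>\<^bsub>PA\<^esub> h)"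
proof
  fix q :: "'v \<times> 'e list"
  obtain u p where q: "q = (u, p)" by (cases q)
  let ?n = "length p"
  note cl = PA_closed[OF f] PA_closed[OF g] PA_closed[OF h]
  let ?t = "\<lambda>i j. f (endpt u (take i p), drop i p) \<otimes>\<^bsub>K\<^esub>
      (g (endpt u (take j p), take (i - j) (drop j p)) \<otimes>\<^bsub>K\<^esub> h (u, take j p))"
  have "(f \<otimes>\<^bsub>PA\<^esub> (g \<otimes>\<^bsub>PA\<^esub> h)) q = finsum K (\<lambda>i. finsum K (?t i) {..i}) {..?n}"
    unfolding q mult_eq
  proof (rule K.finsum_cong')
    fix i assume i: "i \<in> {..?n}"
    have "finsum K (\<lambda>j. g (endpt u (take j (take i p)), drop j (take i p)) \<otimes>\<^bsub>K\<^esub> h (u, take j (take i p))) {..length (take i p)}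
        = finsum K (\<lambda>j. g (endpt u (take j p), take (i - j) (drop j p)) \<otimes>\<^bsub>K\<^esub> h (u, take j p)) {..i}"
      using i cl by (intro K.finsum_cong') (auto simp: drop_take min_def)
    then show "f (endpt u (take i p), drop i p) \<otimes>\<^bsub>K\<^esub> finsum K (\<lambda>j. g (endpt u (take j (take i p)), drop j (take i p)) \<otimes>\<^bsub>K\<^esub> h (u, take j (take i p))) {..length (take i p)}
        = finsum K (?t i) {..i}"
      using cl by (simp add: K.finsum_rdistr)
  qed (use cl in \<open>auto intro!: K.finsum_closed\<close>)
  also have "\<dots> = finsum K (\<lambda>j. finsum K (\<lambda>k. ?t (j + k) j) {..?n - j}) {..?n}"
    using cl by (intro K.finsum_triangle) auto
  also have "\<dots> = (f \<otimes>\<^bsub>PA\<^esub> g \<otimes>\<^bsub>PA\<^esub> h) q"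
    unfolding q mult_eq
  proof (rule K.finsum_cong'[symmetric])
    fix j assume j: "j \<in> {..?n}"
    have eq: "endpt (endpt u (take j p)) (take k (drop j p)) = endpt u (take (j + k) p)" for k
      by (simp add: take_add)
    have "finsum K (\<lambda>k. f (endpt (endpt u (take j p)) (take k (drop j p)), drop k (drop j p)) \<otimes>\<^bsub>K\<^esub>
          g (endpt u (take j p), take k (drop j p))) {..length (drop j p)} \<otimes>\<^bsub>K\<^esub> h (u, take j p)
        = finsum K (\<lambda>k. f (endpt u (take (j + k) p), drop (j + k) p) \<otimes>\<^bsub>K\<^esub>
          g (endpt u (take j p), take k (drop j p)) \<otimes>\<^bsub>K\<^esub> h (u, take j p)) {..?n - j}"
      unfolding eq using cl by (simp add: K.finsum_ldistr add.commute)
    also have "\<dots> = finsum K (\<lambda>k. ?t (j + k) j) {..?n - j}"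
      using cl by (intro K.finsum_cong') (auto simp: K.m_assoc)
    finally show "finsum K (\<lambda>k. f (endpt (endpt u (take j p)) (take k (drop j p)), drop k (drop j p)) \<otimes>\<^bsub>K\<^esub>
          g (endpt u (take j p), take k (drop j p))) {..length (drop j p)} \<otimes>\<^bsub>K\<^esub> h (u, take j p)
        = finsum K (\<lambda>k. ?t (j + k) j) {..?n - j}" .
  qed (use cl in \<open>auto intro!: K.finsum_closed\<close>)
  finally show "(f \<otimes>\<^bsub>PA\<^esub> g \<otimes>\<^bsub>PA\<^esub> h) q = (f \<otimes>\<^bsub>PA\<^esub> (g \<otimes>\<^bsub>PA\<^esub> h)) q" by simp
qed

lemma one_closed: "\<one>\<^bsub>PA\<^esub> \<in> carrier PA"
proof -
  have "{p. \<one>\<^bsub>PA\<^esub> p \<noteq> \<zero>\<^bsub>K\<^esub>} \<subseteq> verts Q \<times> {[]}" by (auto simp: PA_simps split: if_splits)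
  then have "finite {p. \<one>\<^bsub>PA\<^esub> p \<noteq> \<zero>\<^bsub>K\<^esub>}" by (rule finite_subset) simp
  then show ?thesis unfolding PA_carrier by (auto simp: PA_simps paths_Nil split: if_splits)
qed

lemma finsum_single:
  assumes "finite X" "k \<in> X" "t k \<in> carrier K" "\<And>i. i \<in> X \<Longrightarrow> i \<noteq> k \<Longrightarrow> t i = \<zero>\<^bsub>K\<^esub>"
  shows "finsum K t X = t k"
proof -
  have "finsum K t X = finsum K (\<lambda>i. if k = i then (\<lambda>_. t k) i else \<zero>\<^bsub>K\<^esub>) X"
    using assms by (intro K.finsum_cong') auto
  also have "\<dots> = t k" using assms by (subst K.finsum_singleton) auto
  finally show ?thesis .
qed

lemma l_one: assumes f: "f \<in> carrier PA" shows "\<one>\<^bsub>PA\<^esub> \<otimes>\<^bsub>PA\<^esub> f = f"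
proof
  fix q :: "'v \<times> 'e list"
  obtain u p where q: "q = (u, p)" by (cases q)
  have "(\<one>\<^bsub>PA\<^esub> \<otimes>\<^bsub>PA\<^esub> f) q = \<one>\<^bsub>PA\<^esub> (endpt u (take (length p) p), drop (length p) p) \<otimes>\<^bsub>K\<^esub> f (u, take (length p) p)"
    unfolding q mult_eq using PA_closed[OF f] PA_closed[OF one_closed]
    by (intro finsum_single) (auto simp: PA_simps)
  also have "\<dots> = f q"
  proof (cases "(u, p) \<in> paths")
    case True
    then show ?thesis using endpt_in_verts PA_closed[OF f] by (simp add: q PA_simps)
  next
    case False
    then show ?thesis using PA_zero[OF f] PA_closed[OF one_closed] by (simp add: q)
  qed
  finally show "(\<one>\<^bsub>PA\<^esub> \<otimes>\<^bsub>PA\<^esub> f) q = f q" .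
qed

lemma r_one: assumes f: "f \<in> carrier PA" shows "f \<otimes>\<^bsub>PA\<^esub> \<one>\<^bsub>PA\<^esub> = f"
proof
  fix q :: "'v \<times> 'e list"
  obtain u p where q: "q = (u, p)" by (cases q)
  have "(f \<otimes>\<^bsub>PA\<^esub> \<one>\<^bsub>PA\<^esub>) q = f (endpt u (take 0 p), drop 0 p) \<otimes>\<^bsub>K\<^esub> \<one>\<^bsub>PA\<^esub> (u, take 0 p)"
    unfolding q mult_eq using PA_closed[OF f] PA_closed[OF one_closed]
    by (intro finsum_single) (auto simp: PA_simps)
  also have "\<dots> = f q"
  proof (cases "(u, p) \<in> paths")
    case True
    then show ?thesis using start_in_verts PA_closed[OF f] by (simp add: q PA_simps)
  next
    case False
    then show ?thesis using PA_zero[OF f] PA_closed[OF one_closed] by (simp add: q)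
  qed
  finally show "(f \<otimes>\<^bsub>PA\<^esub> \<one>\<^bsub>PA\<^esub>) q = f q" .
qed

lemma ring_PA: "ring PA"
proof (rule ringI)
  show "abelian_group PA" by (rule left_module_group[OF left_module_PA])
  show "Group.monoid PA"
    by (rule monoidI) (auto simp: mult_closed one_closed mult_assoc l_one r_one)
next
  fix f g h assume "f \<in> carrier PA" "g \<in> carrier PA" "h \<in> carrier PA"
  note cl = PA_closed[OF this(1)] PA_closed[OF this(2)] PA_closed[OF this(3)]
  show "(f \<oplus>\<^bsub>PA\<^esub> g) \<otimes>\<^bsub>PA\<^esub> h = f \<otimes>\<^bsub>PA\<^esub> h \<oplus>\<^bsub>PA\<^esub> g \<otimes>\<^bsub>PA\<^esub> h"
  proof
    fix q :: "'v \<times> 'e list"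
    show "((f \<oplus>\<^bsub>PA\<^esub> g) \<otimes>\<^bsub>PA\<^esub> h) q = (f \<otimes>\<^bsub>PA\<^esub> h \<oplus>\<^bsub>PA\<^esub> g \<otimes>\<^bsub>PA\<^esub> h) q"
      using cl by (cases q) (simp add: mult_eq PA_simps K.l_distr K.finsum_addf Pi_def)
  qed
  show "h \<otimes>\<^bsub>PA\<^esub> (f \<oplus>\<^bsub>PA\<^esub> g) = h \<otimes>\<^bsub>PA\<^esub> f \<oplus>\<^bsub>PA\<^esub> h \<otimes>\<^bsub>PA\<^esub> g"
  proof
    fix q :: "'v \<times> 'e list"
    show "(h \<otimes>\<^bsub>PA\<^esub> (f \<oplus>\<^bsub>PA\<^esub> g)) q = (h \<otimes>\<^bsub>PA\<^esub> f \<oplus>\<^bsub>PA\<^esub> h \<otimes>\<^bsub>PA\<^esub> g) q"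
      using cl by (cases q) (simp add: mult_eq PA_simps K.r_distr K.finsum_addf Pi_def)
  qed
qed

lemma k_algebra_PA: "k_algebra K PA"
proof (intro k_algebra.intro field left_module_PA ring_PA)
  fix c f g assume c: "c \<in> carrier K" and "f \<in> carrier PA" "g \<in> carrier PA"
  note cl = PA_closed[OF this(2)] PA_closed[OF this(3)]
  show "(c \<odot>\<^bsub>PA\<^esub> f) \<otimes>\<^bsub>PA\<^esub> g = c \<odot>\<^bsub>PA\<^esub> (f \<otimes>\<^bsub>PA\<^esub> g)"
  proof
    fix q :: "'v \<times> 'e list"
    show "((c \<odot>\<^bsub>PA\<^esub> f) \<otimes>\<^bsub>PA\<^esub> g) q = (c \<odot>\<^bsub>PA\<^esub> (f \<otimes>\<^bsub>PA\<^esub> g)) q"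
      using c cl by (cases q) (simp add: mult_eq PA_simps K.finsum_rdistr K.m_assoc)
  qed
  show "f \<otimes>\<^bsub>PA\<^esub> (c \<odot>\<^bsub>PA\<^esub> g) = c \<odot>\<^bsub>PA\<^esub> (f \<otimes>\<^bsub>PA\<^esub> g)"
  proof
    fix q :: "'v \<times> 'e list"
    show "(f \<otimes>\<^bsub>PA\<^esub> (c \<odot>\<^bsub>PA\<^esub> g)) q = (c \<odot>\<^bsub>PA\<^esub> (f \<otimes>\<^bsub>PA\<^esub> g)) q"
      using c cl by (cases q) (simp add: mult_eq PA_simps K.finsum_rdistr K.m_lcomm)
  qed
qed

section \<open>The basis of paths\<close>

text \<open>The path \<open>q\<close> as an element of the path algebra.\<close>
definition path_elt :: "'v \<times> 'e list \<Rightarrow> 'v \<times> 'e list \<Rightarrow> 'k"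
  where "path_elt q = (\<lambda>p. if p = q then \<one>\<^bsub>K\<^esub> else \<zero>\<^bsub>K\<^esub>)"

lemma path_elt_closed: "q \<in> paths \<Longrightarrow> path_elt q \<in> carrier PA"
  unfolding PA_carrier path_elt_def by (auto simp: if_distrib cong: if_cong)

lemma arrow_eq: "arrow K Q a = path_elt (tail Q a, [a])"
  by (simp add: arrow_def path_elt_def)

lemma path_elt_mult:
  "path_elt (w, p1) \<otimes>\<^bsub>PA\<^esub> path_elt (u, p2) = (if endpt u p2 = w then path_elt (u, p2 @ p1) else \<zero>\<^bsub>PA\<^esub>)"
proof
  fix q :: "'v \<times> 'e list"
  obtain u' p where q: "q = (u', p)" by (cases q)
  let ?t = "\<lambda>i. path_elt (w, p1) (endpt u' (take i p), drop i p) \<otimes>\<^bsub>K\<^esub> path_elt (u, p2) (u', take i p)"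
  have t: "?t i = (if i = length p2 \<and> p = p2 @ p1 \<and> u' = u \<and> endpt u p2 = w then \<one>\<^bsub>K\<^esub> else \<zero>\<^bsub>K\<^esub>)"
    if "i \<le> length p" for i
  proof -
    have "take i p = p2 \<and> drop i p = p1 \<longleftrightarrow> i = length p2 \<and> p = p2 @ p1"
      using that append_take_drop_id[of i p] by auto
    then show ?thesis by (auto simp: path_elt_def)
  qed
  show "(path_elt (w, p1) \<otimes>\<^bsub>PA\<^esub> path_elt (u, p2)) q = (if endpt u p2 = w then path_elt (u, p2 @ p1) else \<zero>\<^bsub>PA\<^esub>) q"
  proof (cases "p = p2 @ p1 \<and> u' = u \<and> endpt u p2 = w")
    case True
    have le: "length p2 \<le> length p" using True by simp
    have tk: "?t (length p2) = \<one>\<^bsub>K\<^esub>" unfolding t[OF le] using True by simp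
    have t0: "?t i = \<zero>\<^bsub>K\<^esub>" if "i \<in> {..length p}" "i \<noteq> length p2" for i
      using t[of i] that by simp
    have "finsum K ?t {..length p} = ?t (length p2)"
      by (rule finsum_single[OF finite_atMost _ _ t0]) (use le tk in simp_all)
    then have "finsum K ?t {..length p} = \<one>\<^bsub>K\<^esub>" unfolding tk .
    then show ?thesis using True by (simp add: q mult_eq path_elt_def)
  next
    case False
    have "finsum K ?t {..length p} = finsum K (\<lambda>_. \<zero>\<^bsub>K\<^esub>) {..length p}"
      using t False by (intro K.finsum_cong') auto
    then have "(path_elt (w, p1) \<otimes>\<^bsub>PA\<^esub> path_elt (u, p2)) q = \<zero>\<^bsub>K\<^esub>" by (simp add: q mult_eq)
    then show ?thesis using False by (auto simp: q path_elt_def PA_simps)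
  qed
qed

lemma path_elt_span:
  assumes N: "submodule N K PA" and f: "f \<in> carrier PA" and "\<And>q. f q \<noteq> \<zero>\<^bsub>K\<^esub> \<Longrightarrow> path_elt q \<in> N"
  shows "f \<in> N"
proof -
  interpret PA: left_module K PA by (rule left_module_PA)
  have N0: "\<zero>\<^bsub>PA\<^esub> \<in> N" and Na: "\<And>x y. x \<in> N \<Longrightarrow> y \<in> N \<Longrightarrow> x \<oplus>\<^bsub>PA\<^esub> y \<in> N"
    and Ns: "\<And>c x. c \<in> carrier K \<Longrightarrow> x \<in> N \<Longrightarrow> c \<odot>\<^bsub>PA\<^esub> x \<in> N"
    using N unfolding PA.submodule_iff by blast+
  have "f \<in> N" if "finite X" "{p. f p \<noteq> \<zero>\<^bsub>K\<^esub>} \<subseteq> X" "f \<in> carrier PA" "\<And>q. f q \<noteq> \<zero>\<^bsub>K\<^esub> \<Longrightarrow> path_elt q \<in> N" for X f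
    using that
  proof (induction X arbitrary: f rule: finite_induct)
    case empty
    then have "f = \<zero>\<^bsub>PA\<^esub>" by (auto simp: PA_simps fun_eq_iff)
    then show ?case using N0 by simp
  next
    case (insert q X)
    let ?f = "f(q := \<zero>\<^bsub>K\<^esub>)"
    have "{p. ?f p \<noteq> \<zero>\<^bsub>K\<^esub>} \<subseteq> {p. f p \<noteq> \<zero>\<^bsub>K\<^esub>}" by auto
    then have "finite {p. ?f p \<noteq> \<zero>\<^bsub>K\<^esub>}" by (rule finite_subset) (rule PA_finite[OF insert.prems(2)])
    then have c: "?f \<in> carrier PA" using insert.prems(2) by (auto simp: PA_carrier)
    have "{p. ?f p \<noteq> \<zero>\<^bsub>K\<^esub>} \<subseteq> X" using insert.prems(1) by auto
    moreover have "path_elt p \<in> N" if "?f p \<noteq> \<zero>\<^bsub>K\<^esub>" for p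
      using that insert.prems(3)[of p] by (auto split: if_splits)
    ultimately have 1: "?f \<in> N" using insert.IH c by blast
    have fq: "f q \<in> carrier K" using insert.prems(2) by (rule PA_closed)
    show ?case
    proof (cases "f q = \<zero>\<^bsub>K\<^esub>")
      case True
      then have "?f = f" by (auto simp: fun_eq_iff)
      then show ?thesis using 1 by simp
    next
      case False
      have "?f \<oplus>\<^bsub>PA\<^esub> f q \<odot>\<^bsub>PA\<^esub> path_elt q = f"
        using fq PA_closed[OF insert.prems(2)] by (auto simp: PA_simps path_elt_def fun_eq_iff)
      then show ?thesis using Na[OF 1 Ns[OF fq insert.prems(3)[OF False]]] by simp
    qed
  qed
  from this[of "{p. f p \<noteq> \<zero>\<^bsub>K\<^esub>}" f] show ?thesis using assms by (simp add: PA_carrier)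
qed

text \<open>The set of paths is countable, whatever the types of vertices and arrows are.\<close>
lemma inj_on_PA: "\<exists>\<iota> :: ('v \<times> 'e list \<Rightarrow> 'k) \<Rightarrow> nat \<Rightarrow> 'k. inj_on \<iota> (carrier PA)"
proof -
  have "countable (verts Q \<times> lists (arcs Q))"
    by (intro countable_SIGMA countable_lists) (simp_all add: countable_finite)
  moreover have "paths \<subseteq> verts Q \<times> lists (arcs Q)"
    by (auto simp: quiver_paths_def Q.awalk_def)
  ultimately have cnt: "countable paths" by (rule countable_subset[rotated])
  have "inj_on (\<lambda>f n. f (from_nat_into paths n)) (carrier PA)"
  proof (rule inj_onI)
    fix f g assume fg: "f \<in> carrier PA" "g \<in> carrier PA"
      and eq: "(\<lambda>n. f (from_nat_into paths n)) = (\<lambda>n. g (from_nat_into paths n))"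
    show "f = g"
    proof
      fix p
      show "f p = g p"
      proof (cases "p \<in> paths")
        case True
        then have "from_nat_into paths (to_nat_on paths p) = p" using cnt by simp
        then show ?thesis using fun_cong[OF eq, of "to_nat_on paths p"] by simp
      qed (simp add: PA_zero[OF fg(1)] PA_zero[OF fg(2)])
    qed
  qed
  then show ?thesis by blast
qed

section \<open>The arrow ideal\<close>

text \<open>The linear combinations of paths of positive length. These form the arrow ideal, of which only the
  inclusion into \<open>positive\<close> is needed.\<close>
definition positive where "positive = {f \<in> carrier PA. \<forall>u. f (u, []) = \<zero>\<^bsub>K\<^esub>}"

lemma mult_Nil: "f \<in> carrier PA \<Longrightarrow> g \<in> carrier PA \<Longrightarrow> (f \<otimes>\<^bsub>PA\<^esub> g) (u, []) = f (u, []) \<otimes>\<^bsub>K\<^esub> g (u, [])"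
  using PA_closed[of f] PA_closed[of g] by (simp add: mult_eq)

lemma positive_submodule: "submodule positive K PA"
proof -
  interpret PA: left_module K PA by (rule left_module_PA)
  show ?thesis unfolding PA.submodule_iff positive_def using PA.smult_closed PA.M.zero_closed PA.M.a_closed
    by (auto simp: PA_simps)
qed

lemma positive_ideal: "ideal positive PA"
proof (rule idealI)
  show "ring PA" by (rule ring_PA)
  show "subgroup positive (add_monoid PA)" using positive_submodule by (rule submodule.axioms(1))
qed (auto simp: positive_def mult_closed mult_Nil PA_closed)

lemma arrow_positive: "a \<in> arcs Q \<Longrightarrow> arrow K Q a \<in> positive"
  by (auto simp: positive_def arrow_eq path_elt_closed paths_Cons paths_Nil) (simp add: path_elt_def)

lemma arrow_ideal_subset: "arrow_ideal K Q \<subseteq> positive"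
  unfolding arrow_ideal_def by (rule ring.genideal_minimal[OF ring_PA positive_ideal]) (use arrow_positive in auto)

text \<open>Elements of the square of the arrow ideal, hence of an admissible ideal, have no
  coefficients at paths of length at most one.\<close>
lemma arrow_ideal_square:
  assumes "f \<in> ideal_power PA (arrow_ideal K Q) 2"
  shows "f (u, []) = \<zero>\<^bsub>K\<^esub>" "f (u, [a]) = \<zero>\<^bsub>K\<^esub>"
proof -
  interpret P: ideal positive PA by (rule positive_ideal)
  have 1: "f \<in> positive" if "f \<in> ideal_prod PA (arrow_ideal K Q) (carrier PA)" for f
    using that by induct (use arrow_ideal_subset P.I_r_closed in auto)
  have "f \<in> positive \<and> f (u, [a]) = \<zero>\<^bsub>K\<^esub>"
    if "f \<in> ideal_prod PA (arrow_ideal K Q) (ideal_prod PA (arrow_ideal K Q) (carrier PA))" for f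
    using that
  proof induct
    case (prod i j)
    have i: "i \<in> positive" by (rule subsetD[OF arrow_ideal_subset prod(1)])
    have j: "j \<in> positive" by (rule 1[OF prod(2)])
    have ic: "i \<in> carrier PA" and jc: "j \<in> carrier PA" and "\<And>v. i (v, []) = \<zero>\<^bsub>K\<^esub>" "\<And>v. j (v, []) = \<zero>\<^bsub>K\<^esub>"
      using i j unfolding positive_def by blast+
    then have "(i \<otimes>\<^bsub>PA\<^esub> j) (u, [a]) = \<zero>\<^bsub>K\<^esub>"
      using PA_closed[OF ic] PA_closed[OF jc] by (simp add: mult_eq K.finsum_Suc Pi_def)
    then show ?case using P.I_r_closed[OF i jc] by simp
  next
    case (sum f g)
    then show ?case using additive_subgroup.a_closed[OF P.additive_subgroup_axioms, of f g] K.r_zero[OF K.zero_closed] by (simp add: PA_simps(3))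
  qed
  moreover have "f \<in> ideal_prod PA (arrow_ideal K Q) (ideal_prod PA (arrow_ideal K Q) (carrier PA))"
    using assms by (simp add: ideal_power_def numeral_2_eq_2)
  ultimately show "f (u, []) = \<zero>\<^bsub>K\<^esub>" "f (u, [a]) = \<zero>\<^bsub>K\<^esub>" unfolding positive_def by blast+
qed

end

section \<open>The algebra of a bound quiver with a node\<close>

text \<open>A bound quiver, with admissible ideal \<open>I\<close>, and a node \<open>x\<close> of it.\<close>
locale node_data = path_algebra_data K Q
  for K :: "('k, 'c) ring_scheme" and Q :: "('v, 'e) pre_digraph" +
  fixes I :: "('v \<times> 'e list \<Rightarrow> 'k) set" and x :: 'v
  assumes admissible: "admissible K Q I" and node: "is_node K Q I x"
begin

lemma I_ideal: "ideal I PA"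
  using admissible by (simp add: admissible_def)

lemma I_sub: "f \<in> I \<Longrightarrow> f (u, []) = \<zero>\<^bsub>K\<^esub>" "f \<in> I \<Longrightarrow> f (u, [a]) = \<zero>\<^bsub>K\<^esub>"
  using admissible arrow_ideal_square by (auto simp: admissible_def)

sublocale PA: ring PA by (rule ring_PA)
sublocale I: ideal I PA by (rule I_ideal)
sublocale bq: quotient_algebra K PA I
  by (intro quotient_algebra.intro quotient_algebra_axioms.intro k_algebra_PA I_ideal)

abbreviation "cl f \<equiv> I +>\<^bsub>PA\<^esub> f"

text \<open>The trivial path at the node.\<close>
definition ex where "ex = path_elt (x, [])"

lemma x_vert: "x \<in> verts Q" using node by (simp add: is_node_def)

lemma ex_closed: "ex \<in> carrier PA"
  unfolding ex_def by (rule path_elt_closed) (simp add: paths_Nil x_vert)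

lemma ex_ex: "ex \<otimes>\<^bsub>PA\<^esub> ex = ex"
  by (simp add: ex_def path_elt_mult)

lemma ex_x: "ex (x, []) = \<one>\<^bsub>K\<^esub>" and ex_other: "u \<noteq> x \<Longrightarrow> ex (u, []) = \<zero>\<^bsub>K\<^esub>"
  by (auto simp: ex_def path_elt_def)

text \<open>It suffices to consider two paths of positive length through the node. Their product contains the
  product of an arrow starting at the node and one ending there.\<close>
lemma positive_node_positive:
  assumes f: "f \<in> positive" and g: "g \<in> positive"
  shows "f \<otimes>\<^bsub>PA\<^esub> ex \<otimes>\<^bsub>PA\<^esub> g \<in> I"
proof -
  have Isub: "submodule I K PA" by (rule bq.quot.submod)
  have I0: "\<zero>\<^bsub>PA\<^esub> \<in> I" and Ia: "\<And>a b. a \<in> I \<Longrightarrow> b \<in> I \<Longrightarrow> a \<oplus>\<^bsub>PA\<^esub> b \<in> I"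
    and Is: "\<And>c a. c \<in> carrier K \<Longrightarrow> a \<in> I \<Longrightarrow> c \<odot>\<^bsub>PA\<^esub> a \<in> I"
    using Isub unfolding bq.quot.submodule_iff by blast+
  have sm: "(c \<odot>\<^bsub>PA\<^esub> f) \<otimes>\<^bsub>PA\<^esub> g = c \<odot>\<^bsub>PA\<^esub> (f \<otimes>\<^bsub>PA\<^esub> g)" "f \<otimes>\<^bsub>PA\<^esub> (c \<odot>\<^bsub>PA\<^esub> g) = c \<odot>\<^bsub>PA\<^esub> (f \<otimes>\<^bsub>PA\<^esub> g)"
    if "c \<in> carrier K" "f \<in> carrier PA" "g \<in> carrier PA" for c f g
    using that by (simp_all add: bq.smult_mult_left bq.smult_mult_right)
  have paths: "path_elt p \<otimes>\<^bsub>PA\<^esub> ex \<otimes>\<^bsub>PA\<^esub> path_elt q \<in> I"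
    if p: "p \<in> paths" "snd p \<noteq> []" and q: "q \<in> paths" "snd q \<noteq> []" for p q
  proof -
    obtain w \<beta> p' where p': "p = (w, \<beta> # p')" using p(2) by (cases p; cases "snd p") auto
    obtain u q' \<alpha> where q': "q = (u, q' @ [\<alpha>])" using q(2) by (cases q; cases "snd q" rule: rev_cases) auto
    have \<beta>: "\<beta> \<in> arcs Q" "w = tail Q \<beta>" "(head Q \<beta>, p') \<in> paths" using p(1) by (auto simp: p' paths_Cons)
    have \<alpha>: "(u, q') \<in> paths" "\<alpha> \<in> arcs Q" "endpt u q' = tail Q \<alpha>"
      using q(1) by (auto simp: q' paths_append paths_Cons)
    have endq: "endpt u (q' @ [\<alpha>]) = head Q \<alpha>" by (simp add: Q.awalk_verts_conv)
    show ?thesis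
    proof (cases "w = x \<and> head Q \<alpha> = x")
      case True
      then have "arrow K Q \<beta> \<otimes>\<^bsub>PA\<^esub> arrow K Q \<alpha> \<in> I"
        using node \<alpha>(2) \<beta>(1,2) by (auto simp: is_node_def in_arcs_def out_arcs_def)
      then have "path_elt (head Q \<beta>, p') \<otimes>\<^bsub>PA\<^esub> (arrow K Q \<beta> \<otimes>\<^bsub>PA\<^esub> arrow K Q \<alpha>) \<otimes>\<^bsub>PA\<^esub> path_elt (u, q') \<in> I"
        by (rule I.I_r_closed[OF I.I_l_closed[OF _ path_elt_closed[OF \<beta>(3)]] path_elt_closed[OF \<alpha>(1)]])
      moreover have "path_elt (head Q \<beta>, p') \<otimes>\<^bsub>PA\<^esub> (arrow K Q \<beta> \<otimes>\<^bsub>PA\<^esub> arrow K Q \<alpha>) \<otimes>\<^bsub>PA\<^esub> path_elt (u, q')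
          = path_elt p \<otimes>\<^bsub>PA\<^esub> ex \<otimes>\<^bsub>PA\<^esub> path_elt q"
        using True \<alpha>(3) \<beta>(2) endq
        by (simp add: arrow_eq path_elt_mult ex_def p' q' Q.awalk_verts_conv)
      ultimately show ?thesis by simp
    next
      case False
      have "path_elt p \<otimes>\<^bsub>PA\<^esub> ex \<otimes>\<^bsub>PA\<^esub> path_elt q = \<zero>\<^bsub>PA\<^esub>"
        using False endq path_elt_closed[OF q(1)] by (auto simp: path_elt_mult ex_def p' q')
      then show ?thesis using I0 by simp
    qed
  qed
  have ne: "snd p \<noteq> [] \<and> p \<in> paths" if "h \<in> positive" "h p \<noteq> \<zero>\<^bsub>K\<^esub>" for h p
    using that PA_zero[of h p] by (cases p) (auto simp: positive_def)
  have fc: "f \<in> carrier PA" "g \<in> carrier PA" using f g by (auto simp: positive_def)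
  have 1: "path_elt p \<otimes>\<^bsub>PA\<^esub> ex \<otimes>\<^bsub>PA\<^esub> g \<in> I" if p: "p \<in> paths" "snd p \<noteq> []" for p
  proof -
    have pc: "path_elt p \<otimes>\<^bsub>PA\<^esub> ex \<in> carrier PA" using path_elt_closed[OF p(1)] ex_closed by simp
    let ?N = "{g \<in> carrier PA. path_elt p \<otimes>\<^bsub>PA\<^esub> ex \<otimes>\<^bsub>PA\<^esub> g \<in> I}"
    have "submodule ?N K PA" unfolding bq.quot.submodule_iff
      using pc I0 Ia Is bq.quot.smult_closed by (auto simp: PA.r_distr sm)
    then have "g \<in> ?N"
      by (rule path_elt_span[OF _ fc(2)]) (use ne[OF g] paths[OF p] path_elt_closed in auto)
    then show ?thesis by simp
  qed
  let ?N = "{f \<in> carrier PA. f \<otimes>\<^bsub>PA\<^esub> ex \<otimes>\<^bsub>PA\<^esub> g \<in> I}"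
  have "submodule ?N K PA" unfolding bq.quot.submodule_iff
    using ex_closed fc I0 Ia Is bq.quot.smult_closed by (auto simp: PA.l_distr sm)
  then have "f \<in> ?N"
    by (rule path_elt_span[OF _ fc(1)]) (use ne[OF f] 1 path_elt_closed in auto)
  then show ?thesis by simp
qed

lemma cl_mem_iff: "f \<in> carrier PA \<Longrightarrow> h \<in> cl f \<longleftrightarrow> h \<in> carrier PA \<and> h \<ominus>\<^bsub>PA\<^esub> f \<in> I"
  by (rule bq.quot.mem_coset_iff)

lemma minus_apply:
  assumes "f \<in> carrier PA" "g \<in> carrier PA" shows "(f \<ominus>\<^bsub>PA\<^esub> g) p = f p \<ominus>\<^bsub>K\<^esub> g p"
proof -
  have "f \<ominus>\<^bsub>PA\<^esub> g \<oplus>\<^bsub>PA\<^esub> g = f" using assms by (simp add: a_minus_def PA.a_assoc PA.l_neg)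
  then have "(f \<ominus>\<^bsub>PA\<^esub> g) p \<oplus>\<^bsub>K\<^esub> g p = f p" unfolding PA_simps by (rule fun_cong)
  moreover have "(f \<ominus>\<^bsub>PA\<^esub> g) p \<in> carrier K" "f p \<in> carrier K" "g p \<in> carrier K"
    using assms PA_closed[of "f \<ominus>\<^bsub>PA\<^esub> g"] PA_closed[of f] PA_closed[of g] by simp_all
  ultimately show ?thesis by (metis K.add.inv_solve_right a_minus_def)
qed

text \<open>The coefficient of the trivial path at the node; it vanishes on \<open>I\<close>.\<close>
definition aug :: "('v \<times> 'e list \<Rightarrow> 'k) set \<Rightarrow> 'k"
  where "aug X = (SOME f. f \<in> X) (x, [])"

lemma aug_cl: assumes f: "f \<in> carrier PA" shows "aug (cl f) = f (x, [])"
proof -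
  have "f \<in> cl f" using f by (rule bq.quot.coset_self)
  then have s: "(SOME h. h \<in> cl f) \<in> cl f" by (rule someI[of "\<lambda>h. h \<in> cl f"])
  let ?h = "SOME h. h \<in> cl f"
  have h: "?h \<in> carrier PA" "?h \<ominus>\<^bsub>PA\<^esub> f \<in> I" using s f by (simp_all add: cl_mem_iff)
  have "?h (x, []) \<ominus>\<^bsub>K\<^esub> f (x, []) = \<zero>\<^bsub>K\<^esub>" using minus_apply[OF h(1) f] I_sub(1)[OF h(2)] by simp
  then have "?h (x, []) = f (x, [])"
    using PA_closed[OF h(1)] PA_closed[OF f] by (metis K.add.inv_solve_right K.l_zero K.zero_closed a_minus_def)
  then show ?thesis by (simp add: aug_def)
qed

abbreviation "\<Lambda> \<equiv> bound_quiver_algebra K Q I"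

lemma \<Lambda>_eq: "\<Lambda> = bq.B" by (simp add: bound_quiver_algebra_def)

text \<open>The image of the arrow ideal in the bound quiver algebra.\<close>
definition rad where "rad = (\<lambda>f. cl f) ` positive"

lemma k_algebra_\<Lambda>: "k_algebra K \<Lambda>" unfolding \<Lambda>_eq by (rule bq.k_algebra_quotient)

sublocale \<Lambda>: k_algebra K \<Lambda> by (rule k_algebra_\<Lambda>)

lemma cl_ops:
  assumes "f \<in> carrier PA" "g \<in> carrier PA"
  shows "cl f \<otimes>\<^bsub>\<Lambda>\<^esub> cl g = cl (f \<otimes>\<^bsub>PA\<^esub> g)" "cl f \<oplus>\<^bsub>\<Lambda>\<^esub> cl g = cl (f \<oplus>\<^bsub>PA\<^esub> g)"
    "cl f \<ominus>\<^bsub>\<Lambda>\<^esub> cl g = cl (f \<ominus>\<^bsub>PA\<^esub> g)"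
proof -
  interpret L: left_module K \<Lambda> by (rule \<Lambda>.vector_space)
  show "cl f \<otimes>\<^bsub>\<Lambda>\<^esub> cl g = cl (f \<otimes>\<^bsub>PA\<^esub> g)" unfolding \<Lambda>_eq by (rule bq.B_mult[OF assms])
  have add: "cl f \<oplus>\<^bsub>\<Lambda>\<^esub> cl g = cl (f \<oplus>\<^bsub>PA\<^esub> g)" if "f \<in> carrier PA" "g \<in> carrier PA" for f g
    unfolding \<Lambda>_eq by (rule bq.quot.quot_add[OF that])
  show "cl f \<oplus>\<^bsub>\<Lambda>\<^esub> cl g = cl (f \<oplus>\<^bsub>PA\<^esub> g)" by (rule add[OF assms])
  have c: "cl h \<in> carrier \<Lambda>" if "h \<in> carrier PA" for h unfolding \<Lambda>_eq using that by (rule bq.quot.coset_closed)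
  have d: "f \<ominus>\<^bsub>PA\<^esub> g \<in> carrier PA" using assms by simp
  have "cl (f \<ominus>\<^bsub>PA\<^esub> g) \<oplus>\<^bsub>\<Lambda>\<^esub> cl g = cl f"
    using add[OF d assms(2)] bq.quot.diff_add_cancel[OF assms] by simp
  then show "cl f \<ominus>\<^bsub>\<Lambda>\<^esub> cl g = cl (f \<ominus>\<^bsub>PA\<^esub> g)"
    using L.add_diff_cancel[OF c[OF d] c[OF assms(2)]] by simp
qed

lemma cl_carrier: "carrier \<Lambda> = cl ` carrier PA"
  unfolding \<Lambda>_eq by (rule bq.quot.carrier_quot)

lemma \<Lambda>_zero: "\<zero>\<^bsub>\<Lambda>\<^esub> = I" unfolding \<Lambda>_eq by (rule bq.quot.quot_zero)

lemma scalar_cl: "c \<in> carrier K \<Longrightarrow> \<Lambda>.scalar c = cl (bq.scalar c)"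
  unfolding \<Lambda>.scalar_def bq.scalar_def unfolding \<Lambda>_eq bq.B_one
  by (rule bq.quot.quot_smult) (simp_all add: one_closed)

lemma positive_closed: "f \<in> positive \<Longrightarrow> f \<in> carrier PA" by (simp add: positive_def)

lemma rad_ideal: "ideal rad \<Lambda>"
proof (rule idealI)
  interpret L: left_module K \<Lambda> by (rule \<Lambda>.vector_space)
  interpret P: ideal positive PA by (rule positive_ideal)
  show "ring \<Lambda>" by (rule \<Lambda>.alg_ring)
  have pos: "\<zero>\<^bsub>PA\<^esub> \<in> positive" "\<And>f g. f \<in> positive \<Longrightarrow> g \<in> positive \<Longrightarrow> f \<oplus>\<^bsub>PA\<^esub> g \<in> positive"
    "\<And>c f. c \<in> carrier K \<Longrightarrow> f \<in> positive \<Longrightarrow> c \<odot>\<^bsub>PA\<^esub> f \<in> positive"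
    using positive_submodule unfolding bq.quot.submodule_iff by blast+
  have "submodule rad K \<Lambda>" unfolding L.submodule_iff
  proof (intro conjI ballI)
    show "rad \<subseteq> carrier \<Lambda>" by (auto simp: rad_def cl_carrier positive_closed)
    show "\<zero>\<^bsub>\<Lambda>\<^esub> \<in> rad" unfolding rad_def \<Lambda>_zero using pos(1) bq.quot.coset_zero by (metis imageI)
    show "X \<oplus>\<^bsub>\<Lambda>\<^esub> Y \<in> rad" if "X \<in> rad" "Y \<in> rad" for X Y
      using that pos(2) by (auto simp: rad_def cl_ops positive_closed)
    show "c \<odot>\<^bsub>\<Lambda>\<^esub> X \<in> rad" if "c \<in> carrier K" "X \<in> rad" for c X
      using that pos(3) bq.quot.quot_smult[of c] by (auto simp: rad_def \<Lambda>_eq positive_closed)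
  qed
  then show "subgroup rad (add_monoid \<Lambda>)" by (rule submodule.axioms(1))
  fix X Y assume X: "X \<in> rad" and Y: "Y \<in> carrier \<Lambda>"
  show "Y \<otimes>\<^bsub>\<Lambda>\<^esub> X \<in> rad" "X \<otimes>\<^bsub>\<Lambda>\<^esub> Y \<in> rad"
    using X Y P.I_l_closed P.I_r_closed by (auto simp: rad_def cl_carrier cl_ops positive_closed)
qed

lemma bq_scalar: "c \<in> carrier K \<Longrightarrow> bq.scalar c \<in> carrier PA"
  by (rule bq.scalar_closed)

lemma scalar_mult_ex: "c \<in> carrier K \<Longrightarrow> bq.scalar c \<otimes>\<^bsub>PA\<^esub> ex = c \<odot>\<^bsub>PA\<^esub> ex"
  by (rule bq.scalar_mult_eq(1)[OF _ ex_closed])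

lemma node_algebra: "node_algebra K \<Lambda> (cl ex) rad aug"
proof (intro node_algebra.intro node_algebra_axioms.intro k_algebra_\<Lambda> rad_ideal)
  show "cl ex \<in> carrier \<Lambda>" by (simp add: cl_carrier ex_closed)
  show "cl ex \<otimes>\<^bsub>\<Lambda>\<^esub> cl ex = cl ex" by (simp add: cl_ops ex_closed ex_ex)
  show "a \<otimes>\<^bsub>\<Lambda>\<^esub> cl ex \<otimes>\<^bsub>\<Lambda>\<^esub> b = \<zero>\<^bsub>\<Lambda>\<^esub>" if ab: "a \<in> rad" "b \<in> rad" for a b
  proof -
    obtain f g where fg: "f \<in> positive" "g \<in> positive" "a = cl f" "b = cl g" using ab unfolding rad_def by blast
    then show ?thesis
      using positive_node_positive[OF fg(1,2)] bq.quot.coset_eq_self_iff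
      by (simp add: cl_ops positive_closed ex_closed \<Lambda>_zero)
  qed
  show "aug a \<in> carrier K" if "a \<in> carrier \<Lambda>" for a
    using that by (auto simp: cl_carrier aug_cl PA_closed)
  show "aug (a \<oplus>\<^bsub>\<Lambda>\<^esub> b) = aug a \<oplus>\<^bsub>K\<^esub> aug b" "aug (a \<otimes>\<^bsub>\<Lambda>\<^esub> b) = aug a \<otimes>\<^bsub>K\<^esub> aug b"
    if "a \<in> carrier \<Lambda>" "b \<in> carrier \<Lambda>" for a b
    using that by (auto simp: cl_carrier cl_ops aug_cl mult_Nil) (simp add: PA_simps)
  show "aug (\<Lambda>.scalar c) = c" if "c \<in> carrier K" for c
    using that x_vert by (simp add: scalar_cl aug_cl bq_scalar) (simp add: bq.scalar_def PA_simps)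
  fix a assume "a \<in> carrier \<Lambda>"
  then obtain f where f: "f \<in> carrier PA" "a = cl f" by (auto simp: cl_carrier)
  let ?c = "f (x, [])"
  have c: "?c \<in> carrier K" by (rule PA_closed[OF f(1)])
  have sc: "\<Lambda>.scalar (aug a) \<otimes>\<^bsub>\<Lambda>\<^esub> cl ex = cl (bq.scalar ?c \<otimes>\<^bsub>PA\<^esub> ex)"
    using f c by (simp add: aug_cl scalar_cl cl_ops bq_scalar ex_closed)
  have s: "bq.scalar ?c \<otimes>\<^bsub>PA\<^esub> ex \<in> carrier PA" using c bq_scalar ex_closed by simp
  have at: "(bq.scalar ?c \<otimes>\<^bsub>PA\<^esub> ex) (u, []) = ?c \<otimes>\<^bsub>K\<^esub> ex (u, [])" for u
    using c by (simp add: scalar_mult_ex PA_simps)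
  have diff: "h \<ominus>\<^bsub>PA\<^esub> (bq.scalar ?c \<otimes>\<^bsub>PA\<^esub> ex) \<in> positive"
    if h: "h \<in> carrier PA" "\<And>u. h (u, []) = f (u, []) \<otimes>\<^bsub>K\<^esub> ex (u, [])" for h
  proof -
    have "(h \<ominus>\<^bsub>PA\<^esub> (bq.scalar ?c \<otimes>\<^bsub>PA\<^esub> ex)) (u, []) = \<zero>\<^bsub>K\<^esub>" for u
    proof -
      have "(h \<ominus>\<^bsub>PA\<^esub> (bq.scalar ?c \<otimes>\<^bsub>PA\<^esub> ex)) (u, []) = f (u, []) \<otimes>\<^bsub>K\<^esub> ex (u, []) \<ominus>\<^bsub>K\<^esub> ?c \<otimes>\<^bsub>K\<^esub> ex (u, [])"
        by (simp only: minus_apply[OF h(1) s] h(2) at)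
      then show ?thesis
        using PA_closed[OF f(1)] by (cases "u = x") (simp_all add: ex_x ex_other a_minus_def K.r_neg)
    qed
    then show ?thesis using h(1) s by (simp add: positive_def)
  qed
  have "ex \<otimes>\<^bsub>PA\<^esub> f \<ominus>\<^bsub>PA\<^esub> (bq.scalar ?c \<otimes>\<^bsub>PA\<^esub> ex) \<in> positive"
    using f(1) ex_closed PA_closed[OF f(1)] PA_closed[OF ex_closed] by (intro diff) (simp_all add: mult_Nil K.m_comm)
  then show "cl ex \<otimes>\<^bsub>\<Lambda>\<^esub> a \<ominus>\<^bsub>\<Lambda>\<^esub> \<Lambda>.scalar (aug a) \<otimes>\<^bsub>\<Lambda>\<^esub> cl ex \<in> rad"
    unfolding sc using f ex_closed s by (simp add: cl_ops rad_def)
  have "f \<otimes>\<^bsub>PA\<^esub> ex \<ominus>\<^bsub>PA\<^esub> (bq.scalar ?c \<otimes>\<^bsub>PA\<^esub> ex) \<in> positive"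
    using f(1) ex_closed by (intro diff) (simp_all add: mult_Nil)
  then show "a \<otimes>\<^bsub>\<Lambda>\<^esub> cl ex \<ominus>\<^bsub>\<Lambda>\<^esub> \<Lambda>.scalar (aug a) \<otimes>\<^bsub>\<Lambda>\<^esub> cl ex \<in> rad"
    unfolding sc using f ex_closed s by (simp add: cl_ops rad_def)
qed

sublocale node_algebra K \<Lambda> "cl ex" rad aug by (rule node_algebra)

lemma not_minimal: "\<not> minimal_tau_tilting_infinite K \<Lambda>"
proof -
  have arrow_not_I: "arrow K Q a \<notin> I" for a
    using I_sub(2)[of "arrow K Q a" "tail Q a" a] by (auto simp: arrow_eq path_elt_def)
  have arrow_closed: "a \<in> arcs Q \<Longrightarrow> arrow K Q a \<in> carrier PA" for a
    using arrow_positive positive_closed by blast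
  have ne: "X \<noteq> {\<zero>\<^bsub>\<Lambda>\<^esub>}" if "a \<in> arcs Q" "cl (arrow K Q a) \<in> X" for a X
  proof
    assume "X = {\<zero>\<^bsub>\<Lambda>\<^esub>}"
    then have "cl (arrow K Q a) = I" using that(2) by (simp add: \<Lambda>_zero)
    then show False using bq.quot.coset_eq_self_iff[OF arrow_closed[OF that(1)]] arrow_not_I by blast
  qed
  obtain \<alpha> \<beta> where a: "\<alpha> \<in> in_arcs Q x" and b: "\<beta> \<in> out_arcs Q x"
    using node unfolding is_node_def by blast
  have \<alpha>: "\<alpha> \<in> arcs Q" "head Q \<alpha> = x" and \<beta>: "\<beta> \<in> arcs Q" "tail Q \<beta> = x"
    using a b by (simp_all add: in_arcs_def out_arcs_def)
  have "ex \<otimes>\<^bsub>PA\<^esub> arrow K Q \<alpha> = arrow K Q \<alpha>"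
    using \<alpha>(2) by (simp add: ex_def arrow_eq path_elt_mult)
  then have "cl (arrow K Q \<alpha>) = cl ex \<otimes>\<^bsub>\<Lambda>\<^esub> cl (arrow K Q \<alpha>)"
    using arrow_closed[OF \<alpha>(1)] by (simp add: cl_ops ex_closed)
  moreover have "cl (arrow K Q \<alpha>) \<in> rad" using arrow_positive[OF \<alpha>(1)] by (simp add: rad_def)
  ultimately have "J_in \<noteq> {\<zero>\<^bsub>\<Lambda>\<^esub>}" unfolding J_in_def by (intro ne[OF \<alpha>(1)]) (rule image_eqI)
  moreover have "arrow K Q \<beta> \<otimes>\<^bsub>PA\<^esub> ex = arrow K Q \<beta>"
    using \<beta>(2) by (simp add: ex_def arrow_eq path_elt_mult)
  then have "cl (arrow K Q \<beta>) = cl (arrow K Q \<beta>) \<otimes>\<^bsub>\<Lambda>\<^esub> cl ex"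
    using arrow_closed[OF \<beta>(1)] by (simp add: cl_ops ex_closed)
  moreover have "cl (arrow K Q \<beta>) \<in> rad" using arrow_positive[OF \<beta>(1)] by (simp add: rad_def)
  ultimately have "J_in \<noteq> {\<zero>\<^bsub>\<Lambda>\<^esub>}" "J_out \<noteq> {\<zero>\<^bsub>\<Lambda>\<^esub>}"
    unfolding J_out_def by (blast, intro ne[OF \<beta>(1)]) (rule image_eqI)
  moreover obtain \<iota> :: "('v \<times> 'e list \<Rightarrow> 'k) \<Rightarrow> nat \<Rightarrow> 'k" where "inj_on \<iota> (carrier PA)" using inj_on_PA by blast
  then have "inj_on (\<lambda>X. \<iota> (SOME f. f \<in> X)) (carrier \<Lambda>)" unfolding \<Lambda>_eq by (rule bq.inj_on_quotient)
  ultimately show ?thesis by (intro not_minimal_tau_tilting_infinite)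
qed

end

theorem theorem1p1:
  fixes K :: "('k, 'c) ring_scheme"
    and Q :: "('v, 'e) pre_digraph"
    and I :: "('v \<times> 'e list \<Rightarrow> 'k) set"
  assumes "field K"
    and "bound_quiver K Q I"
    and "minimal_tau_tilting_infinite K (bound_quiver_algebra K Q I)"
  shows "node_free K Q I"
  unfolding node_free_def
proof
  assume "\<exists>x. is_node K Q I x"
  then obtain x where "is_node K Q I x" by blast
  then interpret node_data K Q I x
    using assms(1,2)
    by (intro node_data.intro path_algebra_data.intro node_data_axioms.intro) (simp_all add: bound_quiver_def)
  show False using not_minimal assms(3) by blast
qed

end
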